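(* For unit-weight instances, the \textsc{Spanner} problem (given a connected undirected graph $G=(V,E)$ with weights $w(e)=1$ for all $e\in E$, edge lengths $\ell\colon E\to\mathbb{N}_{\ge1}$, a stretch factor $\alpha\ge1$ and a weight bound $W\in\mathbb{N}$, is there an $\alpha$-spanner $H=(V,F)$ of $G$ with $w(H)=|F|\le W$?) admits an FPT algorithm w.r.t. the combined parameter $(\varphi,\tau)$, where $\varphi=|E|-|V|+1$ is the feedback edge set number of $G$ and $\tau$ is the tightness of the instance. The algorithm is obtained by running, for all $1\le\varrho\le\varphi$, an FPT algorithm w.r.t. $(\varrho,\tau)$ that decides whether $G$ has an $\alpha$-spanner obtained by removing at least $\varrho$ nontrivial edges.
   Context: For a subgraph $G'\subseteq G$ and $u,v\in V$, $\ell_{G'}[u,v]$ is the length of a shortest $u$-$v$-path in $G'$ w.r.t. $\ell$. A subgraph $H=(V,F)$, $F\subseteq E$, is an $\alpha$-spanner of $G$ if $\ell_H[u,v]\le\alpha\,\ell_G[u,v]$ for all $u,v\in V$; equivalently, for all $\{u,v\}\in E$. The set of terminal pairs is $K=E$. The feedback edge set number is the minimum number of edges whose removal yields an acyclic subgraph. For $\{u,v\}\in E$, a simple $u$-$v$-path $P$ is settling if $\ell(P)\le\alpha\,\ell_G[u,v]$; it is alternative if it does not contain the edge $\{u,v\}$. $\mathcal{P}_{uv}$ is the set of all settling $u$-$v$-paths. As a preprocessing convention, edges that do not settle themselves (i.e., $\ell(\{u,v\})>\alpha\,\ell_G[u,v]$) are assumed to have been removed from the instance. An edge $\{u,v\}$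 is mandatory if $\mathcal{P}_{uv}$ contains no alternative path. The trivial edges $T\subseteq E$ are the mandatory edges and the edges of weight $0$ (none of the latter exist for unit weights); the nontrivial edges are $N=E\setminus T$. A terminal pair $\{u,v\}\in E$ is critical if no settling $u$-$v$-path consists only of trivial edges; $C$ denotes the set of critical terminal pairs ($C\subseteq N$). For $\{u,v\}\in C$, the tightest alternative path $A_{uv}\in\mathcal{P}_{uv}$ is an alternative settling path with the minimum number of nontrivial edges, and $A^N_{uv}=A_{uv}\cap N$. The tightness of the instance is $\tau=\max\{|A^N_{uv}| : \{u,v\}\in C\}$. An algorithm is FPT w.r.t. a (possibly combined) parameter $k$ if on instance $I$ it runs in $\mathcal{O}(f(k)\cdot p(\langle I\rangle))$ time for a computable function $f$ and a polynomial $p$ in the encoding length $\langle I\rangle$. *)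

theory Defs
  imports "HOL-Library.Extended_Real" "HOL-Computational_Algebra.Polynomial"
begin

section \<open>Machine model\<close>

text \<open>
  The model of computation is first-order pure Lisp on binary trees (Jones' language F, with
  local variables and calls of closed subprograms): tree constructor, projections, a test for
  the empty tree, and recursion, each at unit cost.  There is no built-in arithmetic and no
  built-in comparison of trees.  Every step is a bounded number of pointer operations on shared
  tree cells, so running times agree with those of Turing machines up to a polynomial.
\<close>

datatype val = Leaf | Node val val

text \<open>
  Variables are de Bruijn indices; a program is an expression evaluated in the one-element
  environment that holds its input.  \<open>Rec e\<close> restarts the enclosing program on the value of \<open>e\<close>,
  and \<open>Call q e\<close> runs the program \<open>q\<close> on the value of \<open>e\<close>.
\<close>

datatype exp =
    Var nat
  | LeafE
  | NodeE exp exp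
  | Left exp
  | Right exp
  | If exp exp exp
  | Let exp exp
  | Rec exp
  | Call exp exp

type_synonym prog = exp

fun left :: "val \<Rightarrow> val" where
  "left Leaf = Leaf"
| "left (Node x y) = x"

fun right :: "val \<Rightarrow> val" where
  "right Leaf = Leaf"
| "right (Node x y) = y"

text \<open>
  \<open>eval p env e v t cs\<close>: inside program \<open>p\<close>, the expression \<open>e\<close> has the value \<open>v\<close> in the environment
  \<open>env\<close>; this takes \<open>t\<close> steps, where the cost of called programs is included, and \<open>cs\<close> lists all
  pairs of a program that is called in the course of it and its input, nested calls included.
\<close>

inductive eval ::
  "prog \<Rightarrow> val list \<Rightarrow> exp \<Rightarrow> val \<Rightarrow> nat \<Rightarrow> (prog \<times> val) list \<Rightarrow> bool" where
  Var: "i < length env \<Longrightarrow> eval p env (Var i) (env ! i) 1 []"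
| LeafE: "eval p env LeafE Leaf 1 []"
| NodeE: "eval p env e1 v1 t1 cs1 \<Longrightarrow> eval p env e2 v2 t2 cs2 \<Longrightarrow>
    eval p env (NodeE e1 e2) (Node v1 v2) (t1 + t2 + 1) (cs1 @ cs2)"
| Left: "eval p env e v t cs \<Longrightarrow> eval p env (Left e) (left v) (t + 1) cs"
| Right: "eval p env e v t cs \<Longrightarrow> eval p env (Right e) (right v) (t + 1) cs"
| If_Node: "eval p env e (Node x y) t1 cs1 \<Longrightarrow> eval p env e1 v t2 cs2 \<Longrightarrow>
    eval p env (If e e1 e2) v (t1 + t2 + 1) (cs1 @ cs2)"
| If_Leaf: "eval p env e Leaf t1 cs1 \<Longrightarrow> eval p env e2 v t2 cs2 \<Longrightarrow>
    eval p env (If e e1 e2) v (t1 + t2 + 1) (cs1 @ cs2)"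
| Let: "eval p env e1 v1 t1 cs1 \<Longrightarrow> eval p (v1 # env) e2 v2 t2 cs2 \<Longrightarrow>
    eval p env (Let e1 e2) v2 (t1 + t2 + 1) (cs1 @ cs2)"
| Rec: "eval p env e x t1 cs1 \<Longrightarrow> eval p [x] p v t2 cs2 \<Longrightarrow>
    eval p env (Rec e) v (t1 + t2 + 1) (cs1 @ cs2)"
| Call: "eval p env e x t1 cs1 \<Longrightarrow> eval q [x] q v t2 cs2 \<Longrightarrow>
    eval p env (Call q e) v (t1 + t2 + 1) (cs1 @ (q, x) # cs2)"

definition run :: "prog \<Rightarrow> val \<Rightarrow> val \<Rightarrow> nat \<Rightarrow> (prog \<times> val) list \<Rightarrow> bool" where
  "run p x v t cs \<longleftrightarrow> eval p [x] p v t cs"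

lemma eval_deterministic:
  "eval p env e v t cs \<Longrightarrow> eval p env e v' t' cs' \<Longrightarrow> v' = v \<and> t' = t \<and> cs' = cs"
proof (induction arbitrary: v' t' cs' rule: eval.induct)
  case (Var i env p)
  from Var.prems show ?case by cases auto
next
  case (LeafE p env)
  from LeafE.prems show ?case by cases auto
next
  case (NodeE p env e1 v1 t1 cs1 e2 v2 t2 cs2)
  from NodeE.prems show ?case by cases (auto dest: NodeE.IH)
next
  case (Left p env e v t cs)
  from Left.prems show ?case by cases (auto dest: Left.IH)
next
  case (Right p env e v t cs)
  from Right.prems show ?case by cases (auto dest: Right.IH)
next
  case (If_Node p env e x y t1 cs1 e1 v t2 cs2 e2)
  from If_Node.prems show ?case by cases (auto dest: If_Node.IH)
next
  case (If_Leaf p env e t1 cs1 e2 v t2 cs2 e1)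
  from If_Leaf.prems show ?case by cases (auto dest: If_Leaf.IH)
next
  case (Let p env e1 v1 t1 cs1 e2 v2 t2 cs2)
  from Let.prems show ?case by cases (auto dest!: Let.IH)
next
  case (Rec p env e x t1 cs1 v t2 cs2)
  from Rec.prems show ?case by cases (auto dest!: Rec.IH)
next
  case (Call p env e x t1 cs1 q v t2 cs2)
  from Call.prems show ?case by cases (auto dest!: Call.IH)
qed

section \<open>Encodings and fixed-parameter tractability\<close>

text \<open>Numbers are encoded in binary, least significant bit first.\<close>

fun enc_bool :: "bool \<Rightarrow> val" where
  "enc_bool True = Node Leaf Leaf"
| "enc_bool False = Leaf"

fun enc_list :: "('a \<Rightarrow> val) \<Rightarrow> 'a list \<Rightarrow> val" where
  "enc_list enc [] = Leaf"
| "enc_list enc (x # xs) = Node (enc x) (enc_list enc xs)"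

fun bits :: "nat \<Rightarrow> bool list" where
  "bits n = (if n = 0 then [] else odd n # bits (n div 2))"

declare bits.simps [simp del]

definition enc_nat :: "nat \<Rightarrow> val" where
  "enc_nat n = enc_list enc_bool (bits n)"

definition computable2 :: "(nat \<times> nat \<Rightarrow> nat) \<Rightarrow> bool" where
  "computable2 f \<longleftrightarrow>
    (\<exists>p. \<forall>a b. \<exists>t cs. run p (Node (enc_nat a) (enc_nat b)) (enc_nat (f (a, b))) t cs)"

text \<open>
  \<open>fpt_algorithm p D enc yes \<kappa>\<close>: on every instance \<open>i\<close> in the domain \<open>D\<close>, the program \<open>p\<close> answers the
  question \<open>yes i\<close> in \<open>O(f(\<kappa> i) * q(|i|))\<close> steps, for a computable function \<open>f\<close> of the combined
  parameter \<open>\<kappa> i\<close> and a polynomial \<open>q\<close> in the encoding length \<open>|i|\<close>.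
\<close>

definition fpt_algorithm ::
  "prog \<Rightarrow> 'i set \<Rightarrow> ('i \<Rightarrow> val) \<Rightarrow> ('i \<Rightarrow> bool) \<Rightarrow> ('i \<Rightarrow> nat \<times> nat) \<Rightarrow> bool" where
  "fpt_algorithm p D enc yes \<kappa> \<longleftrightarrow>
    (\<exists>f (q :: nat poly) c. computable2 f \<and>
      (\<forall>i\<in>D. \<exists>t cs. run p (enc i) (enc_bool (yes i)) t cs \<and>
        t \<le> c * (f (\<kappa> i) * poly q (size (enc i)))))"

section \<open>Instances\<close>

text \<open>
  The vertices are \<open>0, \<dots>, n - 1\<close>.  An entry \<open>(u, v, w, l)\<close> of the edge list is the undirected edge
  \<open>{u, v}\<close> with weight \<open>w\<close> and length \<open>l\<close>.
\<close>

record spanner_instance =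
  num_verts :: nat
  edge_list :: "(nat \<times> nat \<times> nat \<times> nat) list"
  stretch :: rat
  weight_bound :: nat

definition verts :: "spanner_instance \<Rightarrow> nat set" where
  "verts I = {..<num_verts I}"

definition edges :: "spanner_instance \<Rightarrow> nat set set" where
  "edges I = (\<lambda>(u, v, w, l). {u, v}) ` set (edge_list I)"

definition weight :: "spanner_instance \<Rightarrow> nat set \<Rightarrow> nat" where
  "weight I e = the (map_of (map (\<lambda>(u, v, w, l). ({u, v}, w)) (edge_list I)) e)"

definition len :: "spanner_instance \<Rightarrow> nat set \<Rightarrow> nat" where
  "len I e = the (map_of (map (\<lambda>(u, v, w, l). ({u, v}, l)) (edge_list I)) e)"

fun enc_edge :: "nat \<times> nat \<times> nat \<times> nat \<Rightarrow> val" where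
  "enc_edge (u, v, w, l) = Node (enc_nat u) (Node (enc_nat v) (Node (enc_nat w) (enc_nat l)))"

definition enc_rat :: "rat \<Rightarrow> val" where
  "enc_rat r = (let (a, b) = quotient_of r in Node (enc_nat (nat a)) (enc_nat (nat b)))"

definition enc_instance :: "spanner_instance \<Rightarrow> val" where
  "enc_instance I =
    Node (enc_nat (num_verts I))
      (Node (enc_list enc_edge (edge_list I))
        (Node (enc_rat (stretch I)) (enc_nat (weight_bound I))))"

section \<open>Paths, distances and spanners\<close>

text \<open>Simple paths are given by their vertex sequences.\<close>

fun path_edges :: "nat list \<Rightarrow> nat set list" where
  "path_edges (u # v # p) = {u, v} # path_edges (v # p)"
| "path_edges _ = []"

definition is_path :: "nat set set \<Rightarrow> nat \<Rightarrow> nat \<Rightarrow> nat list \<Rightarrow> bool" where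
  "is_path F u v p \<longleftrightarrow>
    p \<noteq> [] \<and> hd p = u \<and> last p = v \<and> distinct p \<and> set (path_edges p) \<subseteq> F"

definition path_len :: "spanner_instance \<Rightarrow> nat list \<Rightarrow> nat" where
  "path_len I p = sum_list (map (len I) (path_edges p))"

text \<open>The infimum is a minimum if there is a path from \<open>u\<close> to \<open>v\<close>, and \<open>\<infinity>\<close> otherwise.\<close>

definition path_dist :: "spanner_instance \<Rightarrow> nat set set \<Rightarrow> nat \<Rightarrow> nat \<Rightarrow> ereal" where
  "path_dist I F u v = (INF p\<in>{p. is_path F u v p}. ereal (real (path_len I p)))"

definition valid_instance :: "spanner_instance \<Rightarrow> bool" where
  "valid_instance I \<longleftrightarrow>
    num_verts I \<ge> 1 \<and>
    (\<forall>(u, v, w, l)\<in>set (edge_list I). u \<in> verts I \<and> v \<in> verts I \<and> u \<noteq> v \<and> l \<ge> 1) \<and>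
    distinct (map (\<lambda>(u, v, w, l). {u, v}) (edge_list I)) \<and>
    (\<forall>u\<in>verts I. \<forall>v\<in>verts I. \<exists>p. is_path (edges I) u v p) \<and>
    stretch I \<ge> 1"

definition unit_weights :: "spanner_instance \<Rightarrow> bool" where
  "unit_weights I \<longleftrightarrow> (\<forall>e\<in>edges I. weight I e = 1)"

definition is_spanner :: "spanner_instance \<Rightarrow> nat set set \<Rightarrow> bool" where
  "is_spanner I F \<longleftrightarrow>
    F \<subseteq> edges I \<and>
    (\<forall>u\<in>verts I. \<forall>v\<in>verts I.
      path_dist I F u v \<le> ereal (of_rat (stretch I)) * path_dist I (edges I) u v)"

definition has_spanner :: "spanner_instance \<Rightarrow> bool" where
  "has_spanner I \<longleftrightarrow> (\<exists>F. is_spanner I F \<and> (\<Sum>e\<in>F. weight I e) \<le> weight_bound I)"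

section \<open>Trivial edges, critical terminal pairs and tightness\<close>

definition settling :: "spanner_instance \<Rightarrow> nat \<Rightarrow> nat \<Rightarrow> nat list \<Rightarrow> bool" where
  "settling I u v p \<longleftrightarrow>
    is_path (edges I) u v p \<and>
    ereal (real (path_len I p)) \<le> ereal (of_rat (stretch I)) * path_dist I (edges I) u v"

definition alternative :: "spanner_instance \<Rightarrow> nat \<Rightarrow> nat \<Rightarrow> nat list \<Rightarrow> bool" where
  "alternative I u v p \<longleftrightarrow> settling I u v p \<and> {u, v} \<notin> set (path_edges p)"

definition self_settling :: "spanner_instance \<Rightarrow> bool" where
  "self_settling I \<longleftrightarrow> (\<forall>(u, v, w, l)\<in>set (edge_list I). settling I u v [u, v])"

definition preprocess :: "spanner_instance \<Rightarrow> spanner_instance" where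
  "preprocess I =
    I\<lparr>edge_list := filter (\<lambda>(u, v, w, l). settling I u v [u, v]) (edge_list I)\<rparr>"

lemma preprocess_self_settling: "self_settling I \<Longrightarrow> preprocess I = I"
proof -
  assume "self_settling I"
  then have "filter (\<lambda>(u, v, w, l). settling I u v [u, v]) (edge_list I) = edge_list I"
    unfolding self_settling_def by (intro filter_True) auto
  then show ?thesis unfolding preprocess_def by simp
qed

definition mandatory :: "spanner_instance \<Rightarrow> nat set set" where
  "mandatory I = {{u, v} | u v. {u, v} \<in> edges I \<and> (\<nexists>p. alternative I u v p)}"

definition trivial_edges :: "spanner_instance \<Rightarrow> nat set set" where
  "trivial_edges I = mandatory I \<union> {e \<in> edges I. weight I e = 0}"

definition nontrivial_edges :: "spanner_instance \<Rightarrow> nat set set" where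
  "nontrivial_edges I = edges I - trivial_edges I"

definition critical :: "spanner_instance \<Rightarrow> nat set set" where
  "critical I =
    {{u, v} | u v. {u, v} \<in> edges I \<and>
      (\<nexists>p. settling I u v p \<and> set (path_edges p) \<subseteq> trivial_edges I)}"

definition num_nontrivial :: "spanner_instance \<Rightarrow> nat list \<Rightarrow> nat" where
  "num_nontrivial I p = card (set (path_edges p) \<inter> nontrivial_edges I)"

definition tightest_alternative :: "spanner_instance \<Rightarrow> nat \<Rightarrow> nat \<Rightarrow> nat list \<Rightarrow> bool" where
  "tightest_alternative I u v p \<longleftrightarrow>
    alternative I u v p \<and> (\<forall>p'. alternative I u v p' \<longrightarrow> num_nontrivial I p \<le> num_nontrivial I p')"

text \<open>The tightness of an instance without critical terminal pairs is \<open>0\<close>.\<close>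

definition tightness :: "spanner_instance \<Rightarrow> nat" where
  "tightness I =
    Max (insert 0
      {num_nontrivial I p | p u v. {u, v} \<in> critical I \<and> tightest_alternative I u v p})"

definition removable :: "spanner_instance \<Rightarrow> nat \<Rightarrow> bool" where
  "removable I \<rho> \<longleftrightarrow>
    (\<exists>R. R \<subseteq> nontrivial_edges I \<and> card R \<ge> \<rho> \<and> is_spanner I (edges I - R))"

section \<open>Feedback edge set number\<close>

definition is_cycle :: "nat set set \<Rightarrow> nat list \<Rightarrow> bool" where
  "is_cycle F p \<longleftrightarrow>
    length p \<ge> 3 \<and> distinct p \<and> set (path_edges p) \<subseteq> F \<and> {last p, hd p} \<in> F"

definition feedback_edge_set :: "spanner_instance \<Rightarrow> nat set set \<Rightarrow> bool" where
  "feedback_edge_set I R \<longleftrightarrow> R \<subseteq> edges I \<and> (\<nexists>p. is_cycle (edges I - R) p)"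

definition feedback_number :: "spanner_instance \<Rightarrow> nat" where
  "feedback_number I = (LEAST k. \<exists>R. feedback_edge_set I R \<and> card R = k)"

section \<open>The two parameterized problems\<close>

definition unit_instances :: "spanner_instance set" where
  "unit_instances = {I. valid_instance I \<and> unit_weights I}"

text \<open>
  Edges that do not settle themselves are deleted before the parameters are determined; for
  self-settling instances \<open>preprocess\<close> is the identity.
\<close>

definition spanner_fpt :: "prog \<Rightarrow> bool" where
  "spanner_fpt B \<longleftrightarrow>
    fpt_algorithm B unit_instances enc_instance has_spanner
      (\<lambda>I. (feedback_number (preprocess I), tightness (preprocess I)))"

definition enc_removal :: "spanner_instance \<times> nat \<Rightarrow> val" where
  "enc_removal = (\<lambda>(I, \<rho>). Node (enc_nat \<rho>) (enc_instance I))"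

definition removal_fpt :: "prog \<Rightarrow> bool" where
  "removal_fpt A \<longleftrightarrow>
    fpt_algorithm A {(I, \<rho>). I \<in> unit_instances \<and> self_settling I} enc_removal
      (\<lambda>(I, \<rho>). removable I \<rho>) (\<lambda>(I, \<rho>). (\<rho>, tightness I))"

text \<open>
  The computation of \<open>B\<close> on \<open>I\<close> calls \<open>A\<close> on the preprocessed instance together with \<open>\<rho>\<close> for
  exactly the numbers \<open>\<rho>\<close> from \<open>1\<close> to the feedback edge set number.
\<close>

definition runs_for_all_removals :: "prog \<Rightarrow> prog \<Rightarrow> bool" where
  "runs_for_all_removals B A \<longleftrightarrow>
    (\<forall>I\<in>unit_instances. \<forall>v t cs. run B (enc_instance I) v t cs \<longrightarrow>
      {x. (A, x) \<in> set cs} =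
        (\<lambda>\<rho>. enc_removal (preprocess I, \<rho>)) ` {1..feedback_number (preprocess I)})"

end

theory Submission
  imports Defs
begin

text \<open>
  Removing \<open>R\<close> from a self-settling instance leaves a spanner as soon as every edge of \<open>R\<close> has a
  settling path that avoids \<open>R\<close>.  For each nontrivial edge fix a settling path: one of trivial edges if
  the edge is not critical, a tightest alternative path otherwise.  It uses at most \<open>\<tau>\<close>
  nontrivial edges, so the digraph that joins an edge to the nontrivial edges of its path has
  out-degrees at most \<open>\<tau>\<close>, and among any \<open>\<rho> (2 \<tau> + 1)\<close> nontrivial edges there is an independent set of
  size \<open>\<rho>\<close>, which can be removed.  The algorithm for the parameter \<open>(\<rho>, \<tau>)\<close> therefore never computes \<open>\<tau>\<close>:
  it lists the nontrivial edges (those whose single removal leaves a spanner) and tests the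
  subsets of longer and longer prefixes of this list until one of them, of size at least \<open>\<rho>\<close>, can be
  removed.  Success comes no later than with the prefix of length \<open>\<rho> (2 \<tau> + 1)\<close>, hence after
  \<open>O(2^(\<rho> (2 \<tau> + 1)))\<close> tests, each of them polynomial by Bellman-Ford.

  A spanner of the preprocessed instance is connected, so at most \<open>\<phi> = |E| - |V| + 1\<close> edges are
  removable, and it suffices to run this algorithm for \<open>\<rho> = 1, \<dots>, \<phi>\<close>.
\<close>

section \<open>Evaluating programs\<close>

text \<open>Tightness minimises over simple paths, so it steers the analysis and not the program.
  Trying prefixes by increasing length makes the cost a geometric sum, dominated by the longest
  prefix tried, whichever length that turns out to be.

  The other obstacle is the concrete machine. A time bound needs bounds on all intermediate trees:
  the distance table only ever grows, and relaxing an edge in one direction adds at most one entry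
  and one bit. With \<open>s\<close> bounding the size of the input there are at most
  \<open>s * s\<close> relaxations of an edge, so counts and bit lengths stay quadratic in
  \<open>s\<close>.

  The call trace is part of the claim as well. The removal program must be called for exactly \<rho>
  = 1, ..., \<phi>, so the loop may not stop at the first success, and no auxiliary program may call
  it. The latter follows from sizes: a called program is a proper part of the code that calls it.
  The case \<rho> = 0 is therefore not a call but a comparison of the number of edges with
  \<open>W\<close>.\<close>

definition ev ::
  "prog \<Rightarrow> val list \<Rightarrow> exp \<Rightarrow> (val \<Rightarrow> nat \<Rightarrow> (prog \<times> val) list \<Rightarrow> bool) \<Rightarrow> bool" where
  "ev p env e Q \<longleftrightarrow> (\<exists>v t cs. eval p env e v t cs \<and> Q v t cs)"

definition halts :: "prog \<Rightarrow> val \<Rightarrow> bool" where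
  "halts p x \<longleftrightarrow> (\<exists>v t cs. run p x v t cs)"

text \<open>Determinism makes this description unique, so that value, time and trace become
  functions by which the simplifier can rewrite. Off \<open>halts\<close> they are unspecified,
  hence \<open>halts\<close> in every specification.\<close>

definition outcome :: "prog \<Rightarrow> val \<Rightarrow> val \<times> nat \<times> (prog \<times> val) list" where
  "outcome p x = (THE r. case r of (v, t, cs) \<Rightarrow> run p x v t cs)"

definition res :: "prog \<Rightarrow> val \<Rightarrow> val" where
  "res p x = fst (outcome p x)"

definition time :: "prog \<Rightarrow> val \<Rightarrow> nat" where
  "time p x = fst (snd (outcome p x))"

definition calls :: "prog \<Rightarrow> val \<Rightarrow> (prog \<times> val) list" where
  "calls p x = snd (snd (outcome p x))"

definition computes :: "prog \<Rightarrow> val \<Rightarrow> val \<Rightarrow> nat \<Rightarrow> bool" where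
  "computes p x v T \<longleftrightarrow> halts p x \<and> res p x = v \<and> time p x \<le> T"

lemma outcome_eq: "run p x v t cs \<Longrightarrow> outcome p x = (v, t, cs)"
  unfolding outcome_def run_def by (rule the_equality) (auto dest: eval_deterministic)

lemma run_iff: "run p x v t cs \<longleftrightarrow> halts p x \<and> res p x = v \<and> time p x = t \<and> calls p x = cs"
proof
  assume "run p x v t cs"
  then show "halts p x \<and> res p x = v \<and> time p x = t \<and> calls p x = cs"
    using outcome_eq[of p x v t cs] by (auto simp: halts_def res_def time_def calls_def)
next
  assume r: "halts p x \<and> res p x = v \<and> time p x = t \<and> calls p x = cs"
  then obtain v' t' cs' where "run p x v' t' cs'" unfolding halts_def by blast
  then show "run p x v t cs"
    using r outcome_eq[of p x v' t' cs'] by (simp add: res_def time_def calls_def)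
qed

lemma eval_self_iff:
  "eval p [x] p v t cs \<longleftrightarrow> halts p x \<and> res p x = v \<and> time p x = t \<and> calls p x = cs"
  using run_iff by (simp add: run_def)

lemma ev_self: "ev p [x] p Q \<longleftrightarrow> halts p x \<and> Q (res p x) (time p x) (calls p x)"
  unfolding ev_def eval_self_iff by auto

text \<open>The premise \<open>p = b\<close> is meant for the defining equation of a program. Only
  the code to be executed is unfolded; the enclosing program stays folded, so recursive calls
  reappear as \<open>res p x\<close> and meet the induction hypothesis.\<close>

lemma ev_unfold: "p = b \<Longrightarrow> halts p x \<and> Q (res p x) (time p x) (calls p x) \<longleftrightarrow> ev p [x] b Q"
  using ev_self by metis

lemma computes_unfold: "p = b \<Longrightarrow> computes p x v T \<longleftrightarrow> ev p [x] b (\<lambda>w t cs. w = v \<and> t \<le> T)"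
  unfolding computes_def using ev_unfold[of p b x "\<lambda>w t cs. w = v \<and> t \<le> T"] by simp

lemma computesI: "p = b \<Longrightarrow> ev p [x] b (\<lambda>w t cs. w = v \<and> t \<le> T) \<Longrightarrow> computes p x v T"
  using computes_unfold by blast

lemma computes_mono: "computes p x v T \<Longrightarrow> T \<le> T' \<Longrightarrow> computes p x v T'"
  by (simp add: computes_def)

inductive_cases eval_VarE: "eval p env (Var i) v t cs"
inductive_cases eval_LeafEE: "eval p env LeafE v t cs"
inductive_cases eval_NodeEE: "eval p env (NodeE a b) v t cs"
inductive_cases eval_LeftE: "eval p env (Left a) v t cs"
inductive_cases eval_RightE: "eval p env (Right a) v t cs"
inductive_cases eval_IfE: "eval p env (If a b c) v t cs"
inductive_cases eval_LetE: "eval p env (Let a b) v t cs"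
inductive_cases eval_RecE: "eval p env (Rec a) v t cs"
inductive_cases eval_CallE: "eval p env (Call q a) v t cs"

text \<open>\<open>ev\<close> is a weakest precondition. Its equations execute code symbolically by
  rewriting and stop at \<open>Rec\<close> and \<open>Call\<close>, where the specification of the
  called program takes over.\<close>

lemma ev_Var [simp]: "ev p env (Var i) Q \<longleftrightarrow> i < length env \<and> Q (env ! i) 1 []"
  unfolding ev_def by (metis eval.Var eval_VarE)

lemma ev_LeafE [simp]: "ev p env LeafE Q \<longleftrightarrow> Q Leaf 1 []"
  unfolding ev_def by (metis eval.LeafE eval_LeafEE)

lemma ev_NodeE [simp]: "ev p env (NodeE a b) Q \<longleftrightarrow>
    ev p env a (\<lambda>v t cs. ev p env b (\<lambda>w s ds. Q (Node v w) (t + s + 1) (cs @ ds)))"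
  unfolding ev_def by (fastforce elim: eval_NodeEE intro: eval.intros)

lemma ev_Left [simp]: "ev p env (Left a) Q \<longleftrightarrow> ev p env a (\<lambda>v t. Q (left v) (t + 1))"
  unfolding ev_def by (fastforce elim: eval_LeftE intro: eval.intros)

lemma ev_Right [simp]: "ev p env (Right a) Q \<longleftrightarrow> ev p env a (\<lambda>v t. Q (right v) (t + 1))"
  unfolding ev_def by (fastforce elim: eval_RightE intro: eval.intros)

lemma ev_If [simp]: "ev p env (exp.If a b c) Q \<longleftrightarrow>
    ev p env a (\<lambda>v t cs. ev p env (if v = Leaf then c else b)
      (\<lambda>w s ds. Q w (t + s + 1) (cs @ ds)))"
proof
  assume "ev p env (exp.If a b c) Q"
  then obtain v t cs where "eval p env (exp.If a b c) v t cs" "Q v t cs" unfolding ev_def by blast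
  then show "ev p env a (\<lambda>v t cs. ev p env (if v = Leaf then c else b)
      (\<lambda>w s ds. Q w (t + s + 1) (cs @ ds)))"
    unfolding ev_def by (fastforce elim: eval_IfE)
next
  assume "ev p env a (\<lambda>v t cs. ev p env (if v = Leaf then c else b)
      (\<lambda>w s ds. Q w (t + s + 1) (cs @ ds)))"
  then obtain v t cs w s ds where *: "eval p env a v t cs"
    "eval p env (if v = Leaf then c else b) w s ds" "Q w (t + s + 1) (cs @ ds)"
    unfolding ev_def by blast
  show "ev p env (exp.If a b c) Q"
    using * unfolding ev_def by (cases v) (simp_all del: One_nat_def add_Suc_right, (blast intro: eval.intros)+)
qed

lemma ev_Let [simp]: "ev p env (exp.Let a b) Q \<longleftrightarrow>
    ev p env a (\<lambda>v t cs. ev p (v # env) b (\<lambda>w s ds. Q w (t + s + 1) (cs @ ds)))"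
  unfolding ev_def by (fastforce elim: eval_LetE intro: eval.intros)

lemma ev_Rec [simp]: "ev p env (Rec a) Q \<longleftrightarrow>
    ev p env a (\<lambda>x t cs. halts p x \<and> Q (res p x) (t + time p x + 1) (cs @ calls p x))"
proof -
  have "ev p env (Rec a) Q \<longleftrightarrow>
    ev p env a (\<lambda>x t cs. ev p [x] p (\<lambda>w s ds. Q w (t + s + 1) (cs @ ds)))"
    unfolding ev_def by (fastforce elim: eval_RecE intro: eval.intros)
  then show ?thesis by (simp add: ev_self)
qed

lemma ev_Call [simp]: "ev p env (Call q a) Q \<longleftrightarrow>
    ev p env a (\<lambda>x t cs. halts q x \<and> Q (res q x) (t + time q x + 1) (cs @ (q, x) # calls q x))"
proof -
  have "ev p env (Call q a) Q \<longleftrightarrow>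
    ev p env a (\<lambda>x t cs. ev q [x] q (\<lambda>w s ds. Q w (t + s + 1) (cs @ (q, x) # ds)))"
    unfolding ev_def by (fastforce elim: eval_CallE intro: eval.intros)
  then show ?thesis by (simp add: ev_self)
qed

text \<open>As a congruence rule this keeps the simplifier out of the postcondition \<open>Q\<close>
  until the code in front of it has been executed; otherwise terms blow up.\<close>

lemma ev_cong [cong]: "env = env' \<Longrightarrow> e = e' \<Longrightarrow> ev p env e Q = ev p env' e' Q"
  by simp

text \<open>A program is called by being written out inside the caller, and \<open>Rec\<close> only
  returns to \<open>p\<close>. Sizes therefore show which programs cannot occur in a trace.\<close>

lemma called_smaller:
  "eval p env e v t cs \<Longrightarrow> (q, x) \<in> set cs \<Longrightarrow> size q < size p \<or> size q < size e"
  by (induction arbitrary: q x rule: eval.induct) (auto, (fastforce)+)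

lemma calls_smaller: "halts p x \<Longrightarrow> (q, y) \<in> set (calls p x) \<Longrightarrow> size q < size p"
  using called_smaller[of p "[x]" p] eval_self_iff by blast

section \<open>Binary arithmetic\<close>

lemma enc_bool_eq_Leaf [simp]: "enc_bool b = Leaf \<longleftrightarrow> \<not> b"
  by (cases b) auto

lemma enc_bool_eq_Leaf' [simp]: "Leaf = enc_bool b \<longleftrightarrow> \<not> b"
  by (cases b) auto

lemma enc_bool_inject [simp]: "enc_bool a = enc_bool b \<longleftrightarrow> a = b"
  by (cases a; cases b) auto

lemma enc_bool_eq_Node [simp]: "enc_bool b = Node Leaf Leaf \<longleftrightarrow> b" "Node Leaf Leaf = enc_bool b \<longleftrightarrow> b"
  by (cases b; auto)+

lemma enc_nat_0 [simp]: "enc_nat 0 = Leaf"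
  by (simp add: enc_nat_def bits.simps)

lemma enc_nat_pos: "n > 0 \<Longrightarrow> enc_nat n = Node (enc_bool (odd n)) (enc_nat (n div 2))"
  by (simp add: enc_nat_def bits.simps[of n])

lemma enc_nat_eq_Leaf [simp]: "enc_nat n = Leaf \<longleftrightarrow> n = 0" "Leaf = enc_nat n \<longleftrightarrow> n = 0"
  by (cases "n = 0"; simp add: enc_nat_pos)+

lemma left_enc_nat [simp]: "left (enc_nat n) = enc_bool (odd n)"
  by (cases "n = 0") (auto simp: enc_nat_pos)

lemma right_enc_nat [simp]: "right (enc_nat n) = enc_nat (n div 2)"
  by (cases "n = 0") (auto simp: enc_nat_pos)

text \<open>Encodings have no leading zeros. This is what lets equality of trees decide equality of
  numbers.\<close>

lemma enc_nat_inject [simp]: "enc_nat a = enc_nat b \<longleftrightarrow> a = b"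
proof (induction a arbitrary: b rule: less_induct)
  case (less a)
  show ?case
  proof (cases "a = 0 \<or> b = 0")
    case False
    then have "enc_nat a = enc_nat b \<longleftrightarrow> odd a = odd b \<and> a div 2 = b div 2"
      using less.IH[of "a div 2" "b div 2"] by (simp add: enc_nat_pos)
    also have "\<dots> \<longleftrightarrow> a = b" by (metis dvd_mult_div_cancel odd_two_times_div_two_succ)
    finally show ?thesis .
  qed auto
qed

section \<open>Bit lengths\<close>

definition bl :: "nat \<Rightarrow> nat" where
  "bl n = length (bits n)"

lemma bl_0 [simp]: "bl 0 = 0"
  by (simp add: bl_def bits.simps)

lemma bl_pos: "n > 0 \<Longrightarrow> bl n = Suc (bl (n div 2))"
  by (simp add: bl_def bits.simps[of n])

text \<open>Turns every estimate of a bit length into a comparison with a power of two.\<close>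

lemma bl_le_iff: "bl n \<le> k \<longleftrightarrow> n < 2 ^ k"
proof (induction k arbitrary: n)
  case 0
  then show ?case by (cases "n = 0") (auto simp: bl_pos)
next
  case (Suc k)
  show ?case
  proof (cases "n = 0")
    case False
    then have "bl n \<le> Suc k \<longleftrightarrow> n div 2 < 2 ^ k" using Suc by (simp add: bl_pos)
    then show ?thesis by auto
  qed simp
qed

lemma less_two_power_bl: "n < 2 ^ bl n"
  using bl_le_iff by blast

lemma bl_mono: "a \<le> b \<Longrightarrow> bl a \<le> bl b"
  using bl_le_iff[of a "bl b"] less_two_power_bl[of b] by simp

lemma bl_mult: "bl (a * b) \<le> bl a + bl b"
  unfolding bl_le_iff power_add by (intro mult_strict_mono' less_two_power_bl) auto

lemma bl_half: "bl (n div 2) \<le> bl n"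
  by (rule bl_mono) simp

lemma bl_le_self: "bl n \<le> n"
  using bl_le_iff less_exp by blast

lemma size_enc_bool: "size (enc_bool b) \<le> 1"
  by (cases b) auto

text \<open>\<open>size\<close> counts \<open>Node\<close>: one for each list cell and one more for
  each bit that is set.\<close>

lemma size_enc_nat: "bl n \<le> size (enc_nat n)" "size (enc_nat n) \<le> 2 * bl n"
proof (induction n rule: less_induct)
  case (less n)
  {
    case 1
    show ?case using less[of "n div 2"] by (cases "n = 0") (auto simp: enc_nat_pos bl_pos)
  next
    case 2
    show ?case using less[of "n div 2"] size_enc_bool[of "odd n"]
      by (cases "n = 0") (auto simp: enc_nat_pos bl_pos)
  }
qed

section \<open>Programs for equality, addition, multiplication and order\<close>

abbreviation "TrueE \<equiv> NodeE LeafE LeafE"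

definition p_eq :: prog where
  "p_eq = exp.If (Left (Var 0))
    (exp.If (Right (Var 0))
      (exp.If (Rec (NodeE (Left (Left (Var 0))) (Left (Right (Var 0)))))
        (Rec (NodeE (Right (Left (Var 0))) (Right (Right (Var 0))))) LeafE)
      LeafE)
    (exp.If (Right (Var 0)) LeafE TrueE)"

text \<open>Both trees are descended in parallel, so the first one alone bounds the time;
  \<open>2 * size a + 1\<close> is the number of its nodes, leaves included.\<close>

lemma p_eq: "computes p_eq (Node a b) (enc_bool (a = b)) (40 * (2 * size a + 1))"
proof (induction a arbitrary: b)
  case Leaf
  show ?case by (rule computesI[OF p_eq_def]) simp
next
  case (Node a1 a2)
  show ?case
  proof (cases b)
    case Leaf
    then show ?thesis by (intro computesI[OF p_eq_def]) simp
  next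
    case b: (Node b1 b2)
    show ?thesis using Node.IH(1)[of b1] Node.IH(2)[of b2] unfolding b
      by (intro computesI[OF p_eq_def]) (auto simp: computes_def)
  qed
qed
  
definition p_inc :: prog where
  "p_inc = exp.If (Var 0)
    (exp.If (Left (Var 0)) (NodeE LeafE (Rec (Right (Var 0)))) (NodeE TrueE (Right (Var 0))))
    (NodeE TrueE LeafE)"

lemma p_inc: "computes p_inc (enc_nat n) (enc_nat (Suc n)) (20 * (bl n + 1))"
proof (induction n rule: less_induct)
  case (less n)
  show ?case
  proof (cases "n = 0")
    case True
    then show ?thesis by (intro computesI[OF p_inc_def]) (simp add: enc_nat_pos)
  next
    case False
    then show ?thesis using less.IH[of "n div 2"]
      by (intro computesI[OF p_inc_def]) (auto simp: computes_def enc_nat_pos[of "Suc n"] bl_pos)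
  qed
qed

text \<open>A ripple-carry adder with the carry as first component of the input. After the three
  bindings \<open>Var 0\<close> is the carry, \<open>Var 1\<close> the second and
  \<open>Var 2\<close> the first summand. Once a summand is exhausted, the carry is left to
  \<open>p_inc\<close>.\<close>

definition p_add :: prog where
  "p_add = 
    exp.Let (Left (Right (Var 0))) (exp.Let (Right (Right (Var 1))) (exp.Let (Left (Var 2))
     (exp.If (Var 2)
      (exp.If (Var 1)
        (exp.Let (NodeE (Right (Var 2)) (Right (Var 1)))
          (exp.If (Left (Var 3))
            (exp.If (Left (Var 2))
              (NodeE (Var 1) (Rec (NodeE TrueE (Var 0))))
              (exp.If (Var 1)
                (NodeE LeafE (Rec (NodeE TrueE (Var 0))))
                (NodeE TrueE (Rec (NodeE LeafE (Var 0))))))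
            (exp.If (Left (Var 2))
              (exp.If (Var 1)
                (NodeE LeafE (Rec (NodeE TrueE (Var 0))))
                (NodeE TrueE (Rec (NodeE LeafE (Var 0)))))
              (NodeE (Var 1) (Rec (NodeE LeafE (Var 0)))))))
        (exp.If (Var 0) (Call p_inc (Var 2)) (Var 2)))
      (exp.If (Var 0) (Call p_inc (Var 1)) (Var 1)))))"

lemma p_add: "computes p_add (Node (enc_bool c) (Node (enc_nat a) (enc_nat b)))
  (enc_nat (a + b + of_bool c)) (100 * (bl a + bl b + 1))"
proof (induction a arbitrary: b c rule: less_induct)
  case (less a)
  consider "a = 0" | "b = 0" "a > 0" | "a > 0" "b > 0" by blast
  then show ?case
  proof cases
    case 1
    then show ?thesis using p_inc[of b]
      by (intro computesI[OF p_add_def]) (cases c; simp add: computes_def)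
  next
    case 2
    then show ?thesis using p_inc[of a]
      by (intro computesI[OF p_add_def]) (cases c; simp add: computes_def)
  next
    case 3
    then have s: "enc_nat (a + b + of_bool c) =
      Node (enc_bool (odd (a + b + of_bool c))) (enc_nat ((a + b + of_bool c) div 2))"
      by (simp add: enc_nat_pos)
    have "computes p_add (Node (enc_bool c') (Node (enc_nat (a div 2)) (enc_nat (b div 2))))
      (enc_nat (a div 2 + b div 2 + of_bool c')) (100 * (bl (a div 2) + bl (b div 2) + 1))" for c'
      using less.IH[of "a div 2" c' "b div 2"] 3 by simp
    note IH = this[of True] this[of False]
    show ?thesis unfolding s
      by (intro computesI[OF p_add_def], cases c; cases "odd a"; cases "odd b")
         (use 3 IH in \<open>auto simp: computes_def bl_pos elim!: oddE evenE\<close>)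
  qed
qed

definition p_mul :: prog where
  "p_mul = exp.If (Left (Var 0))
    (exp.Let (Rec (NodeE (Right (Left (Var 0))) (Right (Var 0))))
      (exp.Let (exp.If (Var 0) (NodeE LeafE (Var 0)) LeafE)
        (exp.If (Left (Left (Var 2)))
          (Call p_add (NodeE LeafE (NodeE (Var 0) (Right (Var 2))))) (Var 0))))
    LeafE"

lemma p_mul: "computes p_mul (Node (enc_nat a) (enc_nat b)) (enc_nat (a * b))
  ((bl a + 1) * (100 * (bl a + 2 * bl b) + 200))"
proof (induction a rule: less_induct)
  case (less a)
  show ?case
  proof (cases "a = 0")
    case True
    then show ?thesis by (intro computesI[OF p_mul_def]) simp
  next
    case False
    \<comment> \<open>The recursive product, doubled. The case distinction in the program keeps 0
      from becoming a list with a leading zero, which would encode no number.\<close>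
    define r where "r = 2 * (a div 2 * b)"
    have r: "(if a div 2 * b = 0 then Leaf else Node Leaf (enc_nat (a div 2 * b))) = enc_nat r"
      by (simp add: r_def enc_nat_pos)
    have ab: "a * b = r + of_bool (odd a) * b"
      unfolding r_def by (cases "odd a") (auto elim!: oddE evenE simp: algebra_simps)
    have "bl r \<le> bl (a * b)" by (rule bl_mono) (simp add: ab)
    then have blr: "bl r \<le> bl a + bl b" using bl_mult[of a b] by simp
    \<comment> \<open>The factor for one level mentions the full \<open>a\<close>, so it is the same
      on all levels and the recursion only adds it up. Naming the recursive cost leaves linear
      arithmetic; the later bounds are treated likewise.\<close>
    define X where "X = (bl (a div 2) + 1) * (100 * (bl a + 2 * bl b) + 200)"
    have IH: "computes p_mul (Node (enc_nat (a div 2)) (enc_nat b)) (enc_nat (a div 2 * b)) X"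
      unfolding X_def
      using False bl_half[of a]
      by (intro computes_mono[OF less.IH] mult_le_mono add_le_mono) auto
    have add: "computes p_add (Node Leaf (Node (enc_nat r) (enc_nat b))) (enc_nat (r + b))
       (100 * (bl r + bl b + 1))"
      using p_add[of False r b] by simp
    have bla: "bl a = Suc (bl (a div 2))" using False by (simp add: bl_pos)
    have T: "(bl a + 1) * (100 * (bl a + 2 * bl b) + 200) =
      X + (100 * (bl a + 2 * bl b) + 200)"
      by (simp add: bla X_def)
    have r0: "r = 0 \<longleftrightarrow> a div 2 * b = 0" by (simp add: r_def)
    have r1: "r \<noteq> 0 \<Longrightarrow> Node Leaf (enc_nat (a div 2 * b)) = enc_nat r"
      using r r0 by (metis)
    show ?thesis unfolding T ab using IH add False blr r0 r1
      by (intro computesI[OF p_mul_def], cases "r = 0"; cases "odd a")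
        (auto simp: computes_def)
  qed
qed

text \<open>The first component is the answer if all remaining bits agree.\<close>

definition p_le :: prog where
  "p_le = exp.Let (Left (Right (Var 0))) (exp.Let (Right (Right (Var 1))) 
     (exp.If (Var 1)
      (exp.If (Var 0)
        (Rec (NodeE (exp.If (Left (Var 1)) (exp.If (Left (Var 0)) (Left (Var 2)) LeafE)
            (exp.If (Left (Var 0)) TrueE (Left (Var 2))))
          (NodeE (Right (Var 1)) (Right (Var 0)))))
        LeafE)
      (exp.If (Var 0) TrueE (Left (Var 2)))))"

lemma p_le: "computes p_le (Node (enc_bool f) (Node (enc_nat a) (enc_nat b)))
  (enc_bool (a < b \<or> a = b \<and> f)) (50 * (bl a + 1))"
proof (induction a arbitrary: b f rule: less_induct)
  case (less a)
  show ?case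
  proof (cases "a = 0 \<or> b = 0")
    case True
    then show ?thesis by (intro computesI[OF p_le_def]) auto
  next
    case False
    \<comment> \<open>Bits come least significant first, so a later difference overrules an earlier
      one: \<open>f'\<close> is the verdict on the bits read so far.\<close>
    define f' where "f' = (if odd a then odd b \<and> f else odd b \<or> f)"
    have IH: "computes p_le (Node (enc_bool f') (Node (enc_nat (a div 2)) (enc_nat (b div 2))))
      (enc_bool (a div 2 < b div 2 \<or> a div 2 = b div 2 \<and> f')) (50 * (bl (a div 2) + 1))"
      using less.IH[of "a div 2" f' "b div 2"] False by simp
    have *: "a < b \<or> a = b \<and> f \<longleftrightarrow> a div 2 < b div 2 \<or> a div 2 = b div 2 \<and> f'"
      unfolding f'_def by (cases f; cases "odd a"; cases "odd b"; presburger)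
    show ?thesis unfolding *
      by (intro computesI[OF p_le_def], cases "odd a"; cases "odd b")
        (use False IH in \<open>auto simp: computes_def f'_def bl_pos\<close>)
  qed
qed

lemma p_le_True: "computes p_le (Node (Node Leaf Leaf) (Node (enc_nat a) (enc_nat b)))
  (enc_bool (a \<le> b)) (50 * (bl a + 1))"
  using p_le[of True a b] by (simp add: le_less)

section \<open>Computability of the parameter function\<close>

definition p_pow2 :: prog where
  "p_pow2 = exp.If (Var 0)
    (exp.Let (Rec (Right (Var 0))) (exp.Let (Call p_mul (NodeE (Var 0) (Var 0)))
      (exp.If (Left (Var 2)) (NodeE LeafE (Var 0)) (Var 0))))
    (NodeE TrueE LeafE)"

text \<open>No time bound is given because \<open>computable2\<close> asks for none; inside the
  proof the running times of the subprograms themselves serve as the witness.\<close>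

lemma p_pow2: "halts p_pow2 (enc_nat n) \<and> res p_pow2 (enc_nat n) = enc_nat (2 ^ n)"
proof (induction n rule: less_induct)
  case (less n)
  have "\<exists>T. computes p_pow2 (enc_nat n) (enc_nat (2 ^ n)) T"
  proof (cases "n = 0")
    case True
    then show ?thesis
      by (intro exI[of _ 100] computesI[OF p_pow2_def]) (simp add: enc_nat_pos)
  next
    case False
    let ?m = "2 ^ (n div 2) :: nat"
    have IH: "halts p_pow2 (enc_nat (n div 2))" "res p_pow2 (enc_nat (n div 2)) = enc_nat ?m"
      using less.IH[of "n div 2"] False by simp_all
    have m: "?m * ?m = 2 ^ (2 * (n div 2))" by (simp add: mult_2 power_add)
    have n: "enc_nat (2 ^ n) = (if odd n then Node Leaf (enc_nat (?m * ?m)) else enc_nat (?m * ?m))"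
      unfolding m by (auto simp: enc_nat_pos[of "2 ^ n"] elim!: oddE)
    show ?thesis unfolding n
      by (intro exI[of _ "time p_pow2 (enc_nat (n div 2)) +
          time p_mul (Node (enc_nat ?m) (enc_nat ?m)) + 100"] computesI[OF p_pow2_def])
        (use False IH p_mul[of ?m ?m] in \<open>auto simp: computes_def\<close>)
  qed
  then show ?case by (auto simp: computes_def)
qed

text \<open>The number of subsets of a list of length \<open>a * (2 * b + 1)\<close>, with
  \<open>a\<close> the number of edges to remove and \<open>b\<close> the tightness. Prepending a
  set bit to \<open>b\<close> yields \<open>2 * b + 1\<close>.\<close>

lemma computable2_exp: "computable2 (\<lambda>(a, b). 2 ^ (a * (2 * b + 1)))"
proof -
  define p where "p = Call p_pow2 (Call p_mul (NodeE (Left (Var 0)) (NodeE TrueE (Right (Var 0)))))"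
  have "computes p (Node (enc_nat a) (enc_nat b)) (enc_nat (2 ^ (a * (2 * b + 1))))
    (time p_pow2 (enc_nat (a * (2 * b + 1))) + time p_mul (Node (enc_nat a) (enc_nat (2 * b + 1))) + 100)"
    for a b
    using p_mul[of a "2 * b + 1"] p_pow2[of "a * (2 * b + 1)"] enc_nat_pos[of "2 * b + 1"]
    by (intro computesI[OF p_def]) (simp add: computes_def)
  then have "computable2 (\<lambda>(a, b). 2 ^ (a * (2 * b + 1)))"
    unfolding computable2_def run_iff computes_def by (intro exI[of _ p]) auto
  then show ?thesis .
qed

section \<open>List programs\<close>

lemma enc_list_eq_Leaf [simp]: "enc_list f xs = Leaf \<longleftrightarrow> xs = []" "Leaf = enc_list f xs \<longleftrightarrow> xs = []"
  by (cases xs; simp)+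

definition p_len :: prog where
  "p_len = exp.If (Var 0) (Call p_inc (Rec (Right (Var 0)))) LeafE"

lemma p_len: "length xs \<le> s \<Longrightarrow>
  computes p_len (enc_list f xs) (enc_nat (length xs)) ((length xs + 1) * (20 * s + 50))"
proof (induction xs)
  case Nil
  show ?case by (intro computesI[OF p_len_def]) simp
next
  case (Cons x xs)
  then show ?case using p_inc[of "length xs"] bl_le_self[of "length xs"]
    by (intro computesI[OF p_len_def]) (auto simp: computes_def)
qed

text \<open>The language is first-order, so this is a family of programs, one for each closed step
  program \<open>q\<close>. Data shared by all steps travels as the first component of the
  input.\<close>

definition p_fold :: "prog \<Rightarrow> prog" where
  "p_fold q = exp.If (Right (Right (Var 0)))
    (Rec (NodeE (Left (Var 0))
      (NodeE (Call q (NodeE (Left (Var 0)) (NodeE (Left (Right (Var 0))) (Left (Right (Right (Var 0)))))))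
        (Right (Right (Right (Var 0)))))))
    (Left (Right (Var 0)))"

text \<open>The invariant is indexed by the step number since the accumulators below grow with each
  step, while \<open>T\<close> must serve for all steps. The offset \<open>i0\<close> lets the count
  continue when folds are nested.\<close>

lemma p_fold:
  assumes step: "\<And>i acc x. x \<in> set xs \<Longrightarrow> i < i0 + length xs \<Longrightarrow> P i acc \<Longrightarrow>
    computes q (Node c (Node (encB acc) (encA x))) (encB (g acc x)) T \<and> P (Suc i) (g acc x)"
    and "P i0 acc"
  shows "computes (p_fold q) (Node c (Node (encB acc) (enc_list encA xs)))
      (encB (foldl g acc xs)) ((length xs + 1) * (T + 50)) \<and> P (i0 + length xs) (foldl g acc xs)"
  using assms
proof (induction xs arbitrary: acc i0)
  case Nil
  then show ?case by (intro conjI computesI[OF p_fold_def]) auto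
next
  case (Cons x xs)
  have step: "computes q (Node c (Node (encB acc) (encA x))) (encB (g acc x)) T \<and>
    P (Suc i0) (g acc x)"
    using Cons.prems by (intro Cons.prems) auto
  have "computes (p_fold q) (Node c (Node (encB (g acc x)) (enc_list encA xs)))
      (encB (foldl g (g acc x) xs)) ((length xs + 1) * (T + 50)) \<and>
      P (Suc i0 + length xs) (foldl g (g acc x) xs)"
  proof (rule Cons.IH)
    show "computes q (Node c (Node (encB acc') (encA x'))) (encB (g acc' x')) T \<and>
      P (Suc i) (g acc' x')" if "x' \<in> set xs" "i < Suc i0 + length xs" "P i acc'" for i acc' x'
      using Cons.prems(1)[of x' i acc'] that by simp
  qed (use step in simp)
  then show ?case using step
    by (intro conjI computesI[OF p_fold_def]) (auto simp: computes_def)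
qed

definition p_filter :: "prog \<Rightarrow> prog" where
  "p_filter q = exp.If (Right (Var 0))
    (exp.Let (Rec (NodeE (Left (Var 0)) (Right (Right (Var 0)))))
      (exp.If (Call q (NodeE (Left (Var 1)) (Left (Right (Var 1)))))
        (NodeE (Left (Right (Var 1))) (Var 0)) (Var 0)))
    LeafE"

lemma p_filter:
  assumes "\<And>x. x \<in> set xs \<Longrightarrow> computes q (Node c (enc x)) (enc_bool (P x)) T"
  shows "computes (p_filter q) (Node c (enc_list enc xs)) (enc_list enc (filter P xs))
    ((length xs + 1) * (T + 50))"
  using assms
proof (induction xs)
  case Nil
  show ?case by (intro computesI[OF p_filter_def]) simp
next
  case (Cons x xs)
  from Cons.IH Cons.prems have "computes (p_filter q) (Node c (enc_list enc xs))
    (enc_list enc (filter P xs)) ((length xs + 1) * (T + 50))" by simp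
  then show ?case using Cons.prems[of x]
    by (intro computesI[OF p_filter_def]) (auto simp: computes_def)
qed

definition p_all :: "prog \<Rightarrow> prog" where
  "p_all q = exp.If (Right (Var 0))
    (exp.If (Call q (NodeE (Left (Var 0)) (Left (Right (Var 0)))))
      (Rec (NodeE (Left (Var 0)) (Right (Right (Var 0)))))
      LeafE)
    TrueE"

lemma p_all:
  assumes "\<And>x. x \<in> set xs \<Longrightarrow> computes q (Node c (enc x)) (enc_bool (P x)) T"
  shows "computes (p_all q) (Node c (enc_list enc xs)) (enc_bool (list_all P xs))
    ((length xs + 1) * (T + 50))"
  using assms
proof (induction xs)
  case Nil
  show ?case by (intro computesI[OF p_all_def]) simp
next
  case (Cons x xs)
  from Cons.IH Cons.prems have "computes (p_all q) (Node c (enc_list enc xs))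
    (enc_bool (list_all P xs)) ((length xs + 1) * (T + 50))" by simp
  then show ?case using Cons.prems[of x]
    by (intro computesI[OF p_all_def]) (auto simp: computes_def)
qed

section \<open>Shortest paths\<close>

lemma computes_length_mono:
  "computes p x v ((length xs + 1) * T) \<Longrightarrow> length xs \<le> s \<Longrightarrow> computes p x v ((s + 1) * T)"
  by (erule computes_mono) (intro mult_le_mono; simp)

section \<open>Bellman-Ford on an association list\<close>

type_synonym edge = "nat \<times> nat \<times> nat \<times> nat"

fun enc_opt :: "nat option \<Rightarrow> val" where
  "enc_opt None = Leaf"
| "enc_opt (Some d) = Node Leaf (enc_nat d)"

fun enc_entry :: "nat \<times> nat \<Rightarrow> val" where
  "enc_entry (x, d) = Node (enc_nat x) (enc_nat d)"

fun minl_step :: "nat \<Rightarrow> nat option \<Rightarrow> nat \<times> nat \<Rightarrow> nat option" where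
  "minl_step x None (y, d) = (if x = y then Some d else None)"
| "minl_step x (Some d0) (y, d) = (if x = y \<and> d \<le> d0 then Some d else Some d0)"

definition minl :: "nat \<Rightarrow> (nat \<times> nat) list \<Rightarrow> nat option" where
  "minl x D = foldl (minl_step x) None D"

text \<open>Entries are added and never replaced; the current bound for a vertex is the minimum of
  its entries. Progress is then plain set inclusion, and the growth per step is easy to
  bound.\<close>

definition relax1 :: "nat \<Rightarrow> nat \<Rightarrow> nat \<Rightarrow> (nat \<times> nat) list \<Rightarrow> (nat \<times> nat) list" where
  "relax1 x y l D = (case minl x D of None \<Rightarrow> D | Some d \<Rightarrow> (y, d + l) # D)"

fun relax :: "(nat \<times> nat) list \<Rightarrow> edge \<Rightarrow> (nat \<times> nat) list" where
  "relax D (u, v, w, l) = relax1 v u l (relax1 u v l D)"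

text \<open>The edge list doubles as the counter of rounds. As many rounds as edges are enough,
  since a simple path uses no edge twice.\<close>

definition bellman_ford :: "edge list \<Rightarrow> nat \<Rightarrow> (nat \<times> nat) list" where
  "bellman_ford F u = foldl (\<lambda>D (_ :: edge). foldl relax D F) [(u, 0)] F"

definition distl :: "edge list \<Rightarrow> nat \<Rightarrow> nat \<Rightarrow> nat option" where
  "distl F u v = minl v (bellman_ford F u)"

lemma foldl_minl_step:
  "foldl (minl_step x) acc D = None \<longleftrightarrow> acc = None \<and> (\<forall>d. (x, d) \<notin> set D)"
  "foldl (minl_step x) acc D = Some d \<Longrightarrow> (acc = Some d \<or> (x, d) \<in> set D) \<and>
    (\<forall>d'. acc = Some d' \<or> (x, d') \<in> set D \<longrightarrow> d \<le> d')"
proof (induction D arbitrary: acc)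
  case (Cons yd D)
  {
    case 1
    show ?case using Cons.IH(1)[of "minl_step x acc yd"] by (cases yd; cases acc) auto
  next
    case 2
    show ?case using Cons.IH(2)[of "minl_step x acc yd"] 2
      by (cases yd; cases acc) (fastforce split: if_splits)+
  }
qed auto

lemma minl_None: "minl x D = None \<longleftrightarrow> (\<forall>d. (x, d) \<notin> set D)"
  by (simp add: minl_def foldl_minl_step)

lemma minl_Some: "minl x D = Some d \<Longrightarrow> (x, d) \<in> set D \<and> (\<forall>d'. (x, d') \<in> set D \<longrightarrow> d \<le> d')"
  using foldl_minl_step(2)[of x None D d] by (simp add: minl_def)

definition small_table :: "nat \<Rightarrow> (nat \<times> nat) list \<Rightarrow> bool" where
  "small_table s D \<longleftrightarrow> length D \<le> s \<and> (\<forall>(y, d) \<in> set D. bl d \<le> s)"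

text \<open>One number \<open>s\<close> bounds counts and sizes at once; in the end it is the size
  of the encoded input.\<close>

definition small_edges :: "nat \<Rightarrow> edge list \<Rightarrow> bool" where
  "small_edges s E \<longleftrightarrow> length E \<le> s \<and> (\<forall>e \<in> set E. size (enc_edge e) \<le> s)"

lemma minl_bl: "minl x D = Some d \<Longrightarrow> small_table s D \<Longrightarrow> bl d \<le> s"
  using minl_Some[of x D d] by (auto simp: small_table_def)

definition p_min_step :: prog where
  "p_min_step = exp.Let (Left (Right (Var 0))) (exp.Let (Right (Right (Right (Var 1))))
    (exp.If (Call p_eq (NodeE (Left (Var 2)) (Left (Right (Right (Var 2))))))
      (exp.If (Var 1)
        (exp.If (Call p_le (NodeE TrueE (NodeE (Var 0) (Right (Var 1)))))
          (NodeE LeafE (Var 0)) (Var 1))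
        (NodeE LeafE (Var 0)))
      (Var 1)))"

lemma p_min_step: "computes p_min_step
  (Node (enc_nat x) (Node (enc_opt acc) (enc_entry yd))) (enc_opt (minl_step x acc yd))
  (80 * size (enc_nat x) + 50 * bl (snd yd) + 200)"
proof (cases yd)
  case (Pair y d)
  show ?thesis unfolding Pair using p_eq[of "enc_nat x" "enc_nat y"] p_le_True[of d "the acc"]
    by (intro computesI[OF p_min_step_def]; cases acc) (auto simp: computes_def)
qed

definition p_min :: prog where
  "p_min = Call (p_fold p_min_step) (NodeE (Left (Var 0)) (NodeE LeafE (Right (Var 0))))"

text \<open>Time bounds are kept as named functions of \<open>s\<close> and stay folded in the
  specifications; that they are polynomial is checked once, at the end. The constants are
  generous.\<close>

definition T_min :: "nat \<Rightarrow> nat" where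
  "T_min s = (s + 1) * (130 * s + 250) + 20"

lemma p_min:
  assumes D: "small_table s D" and x: "size (enc_nat x) \<le> s"
  shows "computes p_min (Node (enc_nat x) (enc_list enc_entry D)) (enc_opt (minl x D)) (T_min s)"
proof -
  have "computes (p_fold p_min_step) (Node (enc_nat x) (Node (enc_opt None) (enc_list enc_entry D)))
    (enc_opt (foldl (minl_step x) None D)) ((length D + 1) * (130 * s + 200 + 50)) \<and> True"
    by (rule p_fold[where P = "\<lambda>_ _. True"],
       rule conjI, rule computes_mono[OF p_min_step])
      (use D x in \<open>auto simp: small_table_def\<close>)
  moreover have "(length D + 1) * (130 * s + 200 + 50) \<le> (s + 1) * (130 * s + 250)"
    using D by (intro mult_le_mono) (auto simp: small_table_def)
  ultimately show ?thesis
    by (intro computesI[OF p_min_def]) (simp add: computes_def minl_def T_min_def)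
qed

definition p_relax1 :: prog where
  "p_relax1 = exp.Let (Right (Right (Right (Var 0))))
    (exp.Let (Call p_min (NodeE (Left (Var 1)) (Var 0)))
      (exp.If (Var 0)
        (NodeE (NodeE (Left (Right (Var 2)))
            (Call p_add (NodeE LeafE (NodeE (Right (Var 0)) (Left (Right (Right (Var 2))))))))
          (Var 1))
        (Var 1)))"

definition T_relax1 :: "nat \<Rightarrow> nat" where
  "T_relax1 s = T_min s + 200 * s + 200"

lemma p_relax1:
  assumes D: "small_table s D" and x: "size (enc_nat x) \<le> s" and l: "bl l \<le> s"
  shows "computes p_relax1
    (Node (enc_nat x) (Node (enc_nat y) (Node (enc_nat l) (enc_list enc_entry D))))
    (enc_list enc_entry (relax1 x y l D)) (T_relax1 s)"
proof (cases "minl x D")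
  case None
  then show ?thesis using p_min[OF D x]
    by (intro computesI[OF p_relax1_def]) (simp add: computes_def relax1_def T_relax1_def)
next
  case (Some d)
  then show ?thesis using p_min[OF D x] p_add[of False d l] minl_bl[OF Some D] l
    by (intro computesI[OF p_relax1_def]) (simp add: computes_def relax1_def T_relax1_def)
qed

text \<open>The sum of two numbers of at most \<open>b\<close> bits has at most one bit
  more.\<close>

lemma small_table_relax1:
  assumes "length D \<le> a" "\<forall>(y, d) \<in> set D. bl d \<le> b" "bl l \<le> b"
  shows "length (relax1 x y l D) \<le> Suc a" "\<forall>(y, d) \<in> set (relax1 x y l D). bl d \<le> Suc b"
proof -
  have "bl (d + l) \<le> Suc b" if "minl x D = Some d" for d
  proof -
    have "bl d \<le> b" using minl_Some[OF that] assms(2) by auto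
    then show ?thesis using assms(3) unfolding bl_le_iff by simp
  qed
  then show "length (relax1 x y l D) \<le> Suc a" "\<forall>(y, d) \<in> set (relax1 x y l D). bl d \<le> Suc b"
    using assms by (auto simp: relax1_def split: option.split)
qed

definition p_relax :: prog where
  "p_relax = exp.Let (Right (Right (Var 0)))
    (exp.Let (Right (Right (Right (Var 0))))
      (Call p_relax1 (NodeE (Left (Right (Var 1))) (NodeE (Left (Var 1)) (NodeE (Var 0)
        (Call p_relax1 (NodeE (Left (Var 1)) (NodeE (Left (Right (Var 1)))
          (NodeE (Var 0) (Left (Right (Var 2))))))))))))"

text \<open>The state after \<open>i\<close> edges: the table starts with one entry, and each edge
  is relaxed in both directions.\<close>

definition relax_inv :: "nat \<Rightarrow> nat \<Rightarrow> (nat \<times> nat) list \<Rightarrow> bool" where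
  "relax_inv s i D \<longleftrightarrow> length D \<le> 2 * i + 1 \<and> (\<forall>(y, d) \<in> set D. bl d \<le> 2 * i + s)"

lemma p_relax:
  assumes D: "relax_inv s i D" and e: "size (enc_edge e) \<le> s" and i: "2 * i + s + 2 \<le> M"
  shows "computes p_relax (Node c (Node (enc_list enc_entry D) (enc_edge e)))
    (enc_list enc_entry (relax D e)) (2 * T_relax1 M + 100) \<and> relax_inv s (Suc i) (relax D e)"
proof -
  obtain u v w l where e': "e = (u, v, w, l)" by (cases e)
  have u: "size (enc_nat u) \<le> M" and v: "size (enc_nat v) \<le> M" and l: "bl l \<le> s" "bl l \<le> M"
    using e i size_enc_nat(1)[of l] by (auto simp: e')
  define D' where "D' = relax1 u v l D"
  have D1: "length D' \<le> Suc (2 * i + 1)" "\<forall>(y, d)\<in>set D'. bl d \<le> Suc (2 * i + s)"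
    using small_table_relax1[of D "2 * i + 1" "2 * i + s" l u v] D l
    by (auto simp: relax_inv_def D'_def)
  have D2: "length (relax D e) \<le> Suc (Suc (2 * i + 1))"
    "\<forall>(y, d)\<in>set (relax D e). bl d \<le> Suc (Suc (2 * i + s))"
    using small_table_relax1[of D' "Suc (2 * i + 1)" "Suc (2 * i + s)" l v u] D1 l
    by (auto simp: e' D'_def)
  have "s \<ge> 1" using e by (simp add: e')
  then have "small_table M D" "small_table M D'"
    using D D1 i by (auto simp: small_table_def relax_inv_def)
  then have "computes p_relax (Node c (Node (enc_list enc_entry D) (enc_edge e)))
    (enc_list enc_entry (relax D e)) (2 * T_relax1 M + 100)"
    using p_relax1[of M D u l v] p_relax1[of M D' v l u] u v l
    by (intro computesI[OF p_relax_def]) (simp add: computes_def e' D'_def)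
  then show ?thesis using D2 by (simp add: relax_inv_def)
qed

text \<open>As a step of the outer fold it ignores the element at hand, which merely counts the
  round; the edges to relax come from the context.\<close>

definition p_round :: prog where
  "p_round = Call (p_fold p_relax) (NodeE LeafE (NodeE (Left (Right (Var 0))) (Left (Var 0))))"

definition p_dist :: prog where
  "p_dist = Call p_min (NodeE (Right (Right (Var 0)))
    (Call (p_fold p_round) (NodeE (Left (Var 0))
      (NodeE (NodeE (NodeE (Left (Right (Var 0))) LeafE) LeafE) (Left (Var 0))))))"

definition T_round :: "nat \<Rightarrow> nat" where
  "T_round s = (s + 1) * (2 * T_relax1 (2 * (s * s) + s + 2) + 150) + 20"

definition T_dist :: "nat \<Rightarrow> nat" where
  "T_dist s = (s + 1) * (T_round s + 50) + T_min (2 * (s * s) + s + 2) + 100"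

lemma p_dist:
  assumes F: "small_edges s F" and u: "size (enc_nat u) \<le> s" and v: "size (enc_nat v) \<le> s"
  shows "computes p_dist (Node (enc_list enc_edge F) (Node (enc_nat u) (enc_nat v)))
    (enc_opt (distl F u v)) (T_dist s) \<and> (\<forall>d. distl F u v = Some d \<longrightarrow> bl d \<le> 2 * (s * s) + s)"
proof -
  \<comment> \<open>There are at most \<open>s\<close> rounds of at most \<open>s\<close> edges,
    each adding at most two entries and two bits; the last 2 is for the edge in progress. Round
    \<open>j\<close> begins with \<open>j * m\<close> edges already relaxed.\<close>
  define M where "M = 2 * (s * s) + s + 2"
  define m where "m = length F"
  have m: "m \<le> s" using F by (simp add: small_edges_def m_def)
  have round: "computes p_round (Node (enc_list enc_edge F) (Node (enc_list enc_entry D) x))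
    (enc_list enc_entry (foldl relax D F)) (T_round s) \<and> relax_inv s (Suc j * m) (foldl relax D F)"
    if j: "j < m" and D: "relax_inv s (j * m) D" for j D x
  proof -
    have "Suc j * m \<le> s * s" using j m by (intro mult_le_mono) auto
    then have jm: "j * m + m \<le> s * s" by simp
    have "computes (p_fold p_relax) (Node Leaf (Node (enc_list enc_entry D) (enc_list enc_edge F)))
      (enc_list enc_entry (foldl relax D F)) ((length F + 1) * (2 * T_relax1 M + 100 + 50)) \<and>
      relax_inv s (j * m + length F) (foldl relax D F)"
    proof (rule p_fold)
      fix i D e assume "e \<in> set F" "i < j * m + length F" "relax_inv s i D"
      moreover have "2 * i + s + 2 \<le> M" using \<open>i < _\<close> jm by (simp add: M_def m_def)
      ultimately show "computes p_relax (Node Leaf (Node (enc_list enc_entry D) (enc_edge e)))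
        (enc_list enc_entry (relax D e)) (2 * T_relax1 M + 100) \<and> relax_inv s (Suc i) (relax D e)"
        using F by (intro p_relax) (auto simp: small_edges_def)
    qed (rule D)
    moreover have "(length F + 1) * (2 * T_relax1 M + 100 + 50) + 20 \<le> T_round s"
      unfolding T_round_def M_def[symmetric] using m
      mult_le_mono1[of "length F + 1" "s + 1" "2 * T_relax1 M + 150"]
      by (auto simp: m_def add.commute intro!: mult_le_mono)
    ultimately show ?thesis
      by (intro conjI computesI[OF p_round_def]) (auto simp: computes_def m_def add.commute)
  qed
  have "computes (p_fold p_round)
      (Node (enc_list enc_edge F) (Node (enc_list enc_entry [(u, 0)]) (enc_list enc_edge F)))
      (enc_list enc_entry (bellman_ford F u)) ((length F + 1) * (T_round s + 50)) \<and>
      relax_inv s ((0 + length F) * m) (bellman_ford F u)"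
    unfolding bellman_ford_def
    by (rule p_fold[where P = "\<lambda>j. relax_inv s (j * m)"])
      (use round in \<open>auto simp: m_def relax_inv_def\<close>)
  note bf = conjunct1[OF this] conjunct2[OF this]
  have "m * m \<le> s * s" using m by (intro mult_le_mono)
  then have inv: "length (bellman_ford F u) \<le> 2 * (s * s) + 1"
    "\<forall>(y, d) \<in> set (bellman_ford F u). bl d \<le> 2 * (s * s) + s"
    using bf(2) by (fastforce simp: relax_inv_def m_def)+
  then have st: "small_table M (bellman_ford F u)"
    unfolding small_table_def M_def by fastforce
  have "size (enc_nat v) \<le> M" using v by (simp add: M_def)
  note min = p_min[OF st this]
  have "computes p_dist (Node (enc_list enc_edge F) (Node (enc_nat u) (enc_nat v)))
    (enc_opt (distl F u v)) (T_dist s)"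
    using computes_length_mono[OF bf(1) m[unfolded m_def]] min
    by (intro computesI[OF p_dist_def]) (simp add: computes_def distl_def T_dist_def M_def)
  moreover have "bl d \<le> 2 * (s * s) + s" if "distl F u v = Some d" for d
    using inv(2) minl_Some that by (fastforce simp: distl_def)
  ultimately show ?thesis by blast
qed

section \<open>The removal program\<close>

text \<open>The default 0 mirrors \<open>right Leaf = Leaf\<close>, so a program projects an encoded
  option without testing it.\<close>

definition the0 :: "nat option \<Rightarrow> nat" where
  "the0 x = (case x of None \<Rightarrow> 0 | Some d \<Rightarrow> d)"

lemma the0_simps [simp]: "the0 None = 0" "the0 (Some d) = d"
  by (simp_all add: the0_def)

lemma right_enc_opt [simp]: "right (enc_opt x) = enc_nat (the0 x)"
  by (cases x) (auto simp: the0_def)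

lemma enc_opt_eq_Leaf [simp]: "enc_opt x = Leaf \<longleftrightarrow> x = None" "Leaf = enc_opt x \<longleftrightarrow> x = None"
  by (cases x; auto)+

lemma enc_edge_inject [simp]: "enc_edge e = enc_edge e' \<longleftrightarrow> e = e'"
  by (cases e; cases e') auto

text \<open>Number of vertices and weight bound are arbitrary trees here: the programs for removal
  pass them on unread. The pair \<open>a\<close>, \<open>b\<close> is the stretch factor as a
  fraction.\<close>

abbreviation enc_inst :: "val \<Rightarrow> edge list \<Rightarrow> nat \<Rightarrow> nat \<Rightarrow> val \<Rightarrow> val" where
  "enc_inst n E a b W \<equiv>
    Node n (Node (enc_list enc_edge E) (Node (Node (enc_nat a) (enc_nat b)) W))"

definition small_inst :: "nat \<Rightarrow> edge list \<Rightarrow> nat \<Rightarrow> nat \<Rightarrow> bool" where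
  "small_inst s E a b \<longleftrightarrow> small_edges s E \<and> bl a \<le> s \<and> bl b \<le> s"

text \<open>There is no division: a comparison with the factor \<open>a / b\<close> is done by
  cross-multiplication.\<close>

definition p_cmp :: prog where
  "p_cmp = Call p_le (NodeE TrueE (NodeE (Call p_mul (Left (Var 0))) (Call p_mul (Right (Var 0)))))"

definition T_cmp :: "nat \<Rightarrow> nat" where
  "T_cmp s = 2 * ((s + 1) * (300 * s + 200)) + 100 * s + 200"

lemma p_cmp:
  assumes "bl w \<le> s" "bl x \<le> s" "bl y \<le> s" "bl z \<le> s"
  shows "computes p_cmp (Node (Node (enc_nat w) (enc_nat x)) (Node (enc_nat y) (enc_nat z)))
    (enc_bool (w * x \<le> y * z)) (T_cmp s)"
proof -
  have mul: "computes p_mul (Node (enc_nat u) (enc_nat v)) (enc_nat (u * v))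
      ((s + 1) * (300 * s + 200))" if "bl u \<le> s" "bl v \<le> s" for u v
    using that by (intro computes_mono[OF p_mul] mult_le_mono) auto
  have "bl (w * x) \<le> 2 * s" using bl_mult[of w x] assms by simp
  then show ?thesis
    using p_le_True[of "w * x" "y * z"] mul[OF assms(1,2)] mul[OF assms(3,4)]
    by (intro computesI[OF p_cmp_def]) (simp add: computes_def T_cmp_def)
qed

section \<open>Testing whether a subgraph is a spanner\<close>

definition dist_bits :: "nat \<Rightarrow> nat" where
  "dist_bits s = 2 * (s * s) + s"

fun settles_edge :: "edge list \<Rightarrow> nat \<Rightarrow> nat \<Rightarrow> edge \<Rightarrow> bool" where
  "settles_edge E a b (u, v, w, l) \<longleftrightarrow> l * b \<le> a * the0 (distl E u v)"

definition p_settles :: prog where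
  "p_settles = Call p_cmp (NodeE
    (NodeE (Right (Right (Right (Right (Var 0))))) (Right (Left (Right (Right (Left (Var 0)))))))
    (NodeE (Left (Left (Right (Right (Left (Var 0))))))
      (Right (Call p_dist (NodeE (Left (Right (Left (Var 0))))
        (NodeE (Left (Right (Var 0))) (Left (Right (Right (Var 0))))))))))"

definition T_settles :: "nat \<Rightarrow> nat" where
  "T_settles s = T_cmp (dist_bits s) + T_dist s + 100"

lemma p_dist_the0:
  assumes "small_edges s F" "size (enc_nat u) \<le> s" "size (enc_nat v) \<le> s"
  shows "bl (the0 (distl F u v)) \<le> dist_bits s"
  using p_dist[OF assms] by (cases "distl F u v") (auto simp: the0_def dist_bits_def)

lemma small_inst_edge:
  assumes "small_inst s E a b" "(u, v, w, l) \<in> set E"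
  shows "size (enc_nat u) \<le> s" "size (enc_nat v) \<le> s" "bl l \<le> dist_bits s"
    "bl a \<le> dist_bits s" "bl b \<le> dist_bits s"
  using assms size_enc_nat(1)[of l] by (fastforce simp: small_inst_def small_edges_def dist_bits_def)+

lemma p_settles:
  assumes I: "small_inst s E a b" and e: "e \<in> set E"
  shows "computes p_settles (Node (enc_inst n E a b W) (enc_edge e))
    (enc_bool (settles_edge E a b e)) (T_settles s)"
proof -
  obtain u v w l where e': "e = (u, v, w, l)" by (cases e)
  note sm = small_inst_edge[OF I e[unfolded e']]
  have E: "small_edges s E" using I by (simp add: small_inst_def)
  show ?thesis
    using p_dist[OF E sm(1,2)] p_cmp[OF sm(3,5,4) p_dist_the0[OF E sm(1,2)]]
    by (intro computesI[OF p_settles_def]) (simp add: computes_def e' T_settles_def)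
qed

text \<open>Disconnected endpoints have to be rejected explicitly, as \<open>the0\<close> would read
  them as being at distance 0.\<close>

fun stretch_ok :: "edge list \<Rightarrow> nat \<Rightarrow> nat \<Rightarrow> edge list \<Rightarrow> edge \<Rightarrow> bool" where
  "stretch_ok E a b F (u, v, w, l) \<longleftrightarrow>
    distl F u v \<noteq> None \<and> the0 (distl F u v) * b \<le> a * the0 (distl E u v)"

definition p_stretch :: prog where
  "p_stretch = exp.Let (NodeE (Left (Right (Var 0))) (Left (Right (Right (Var 0)))))
    (exp.Let (Call p_dist (NodeE (Left (Left (Var 1))) (Var 0)))
      (exp.If (Var 0)
        (Call p_cmp (NodeE
          (NodeE (Right (Var 0)) (Right (Left (Right (Right (Right (Left (Var 2))))))))
          (NodeE (Left (Left (Right (Right (Right (Left (Var 2)))))))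
            (Right (Call p_dist (NodeE (Left (Right (Right (Left (Var 2))))) (Var 1)))))))
        LeafE))"

definition T_stretch :: "nat \<Rightarrow> nat" where
  "T_stretch s = T_cmp (dist_bits s) + 2 * T_dist s + 100"

lemma p_stretch:
  assumes I: "small_inst s E a b" and F: "small_edges s F" and e: "e \<in> set E"
  shows "computes p_stretch (Node (Node (enc_list enc_edge F) (enc_inst n E a b W)) (enc_edge e))
    (enc_bool (stretch_ok E a b F e)) (T_stretch s)"
proof -
  obtain u v w l where e': "e = (u, v, w, l)" by (cases e)
  note sm = small_inst_edge[OF I e[unfolded e']]
  have E: "small_edges s E" using I by (simp add: small_inst_def)
  show ?thesis
    using p_dist[OF E sm(1,2)] p_dist[OF F sm(1,2)]
      p_cmp[OF p_dist_the0[OF F sm(1,2)] sm(5,4) p_dist_the0[OF E sm(1,2)]]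
    by (intro computesI[OF p_stretch_def]; cases "distl F u v")
      (simp_all add: computes_def e' T_stretch_def)
qed

definition p_neq :: prog where
  "p_neq = exp.If (Call p_eq (Var 0)) LeafE TrueE"

definition p_notin :: prog where
  "p_notin = Call (p_all p_neq) (NodeE (Right (Var 0)) (Left (Var 0)))"

definition T_notin :: "nat \<Rightarrow> nat" where
  "T_notin s = (s + 1) * (150 + 80 * s) + 20"

lemma p_notin:
  assumes e: "size (enc_edge e) \<le> s" and R: "length R \<le> s"
  shows "computes p_notin (Node (enc_list enc_edge R) (enc_edge e)) (enc_bool (e \<notin> set R)) (T_notin s)"
proof -
  have neq: "computes p_neq (Node (enc_edge e) (enc_edge r)) (enc_bool (e \<noteq> r)) (80 * s + 100)" for r
    using e p_eq[of "enc_edge e" "enc_edge r"]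
    by (intro computesI[OF p_neq_def]; cases "e = r") (simp_all add: computes_def)
  have "list_all (\<lambda>r. e \<noteq> r) R \<longleftrightarrow> e \<notin> set R" by (auto simp: list_all_iff)
  then show ?thesis
    using computes_length_mono[OF p_all[of R p_neq "enc_edge e" enc_edge "\<lambda>r. e \<noteq> r", OF neq] R]
    by (intro computesI[OF p_notin_def]) (simp add: computes_def T_notin_def)
qed

definition spans_without :: "edge list \<Rightarrow> nat \<Rightarrow> nat \<Rightarrow> edge list \<Rightarrow> bool" where
  "spans_without E a b R \<longleftrightarrow> list_all (stretch_ok E a b (filter (\<lambda>e. e \<notin> set R) E)) E"

definition p_spans :: prog where
  "p_spans = Call (p_all p_stretch) (NodeE
    (NodeE (Call (p_filter p_notin) (NodeE (Left (Var 0)) (Left (Right (Right (Var 0))))))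
      (Right (Var 0)))
    (Left (Right (Right (Var 0)))))"

definition T_spans :: "nat \<Rightarrow> nat" where
  "T_spans s = (s + 1) * (T_stretch s + 50) + (s + 1) * (T_notin s + 50) + 50"

lemma p_spans:
  assumes I: "small_inst s E a b" and R: "length R \<le> s"
  shows "computes p_spans (Node (enc_list enc_edge R) (enc_inst n E a b W))
    (enc_bool (spans_without E a b R)) (T_spans s)"
proof -
  let ?F = "filter (\<lambda>e. e \<notin> set R) E"
  have E: "small_edges s E" using I by (simp add: small_inst_def)
  then have F: "small_edges s ?F"
    by (auto simp: small_edges_def intro: le_trans[OF length_filter_le])
  have len: "length E \<le> s" using E by (simp add: small_edges_def)
  have "computes (p_filter p_notin) (Node (enc_list enc_edge R) (enc_list enc_edge E))
    (enc_list enc_edge ?F) ((s + 1) * (T_notin s + 50))"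
    using E R by (intro computes_length_mono[OF _ len] p_filter p_notin) (auto simp: small_edges_def)
  moreover have "computes (p_all p_stretch)
    (Node (Node (enc_list enc_edge ?F) (enc_inst n E a b W)) (enc_list enc_edge E))
    (enc_bool (list_all (stretch_ok E a b ?F) E)) ((s + 1) * (T_stretch s + 50))"
    using p_stretch[OF I F] by (intro computes_length_mono[OF _ len] p_all) auto
  ultimately show ?thesis
    by (intro computesI[OF p_spans_def]) (simp add: computes_def spans_without_def T_spans_def)
qed

definition p_nontrivial :: prog where
  "p_nontrivial = Call p_spans (NodeE (NodeE (Right (Var 0)) LeafE) (Left (Var 0)))"

definition nontrivial_list :: "edge list \<Rightarrow> nat \<Rightarrow> nat \<Rightarrow> edge list" where
  "nontrivial_list E a b = filter (\<lambda>e. spans_without E a b [e]) E"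

definition T_nontrivial :: "nat \<Rightarrow> nat" where
  "T_nontrivial s = (s + 1) * (T_spans s + 100)"

lemma p_nontrivial:
  assumes I: "small_inst s E a b"
  shows "computes (p_filter p_nontrivial) (Node (enc_inst n E a b W) (enc_list enc_edge E))
    (enc_list enc_edge (nontrivial_list E a b)) (T_nontrivial s)"
proof -
  have E: "length E \<le> s" using I by (simp add: small_inst_def small_edges_def)
  have *: "computes p_nontrivial (Node (enc_inst n E a b W) (enc_edge e))
    (enc_bool (spans_without E a b [e])) (T_spans s + 50)" if "e \<in> set E" for e
  proof -
    have "length [e] \<le> s" using that E by (cases E) auto
    then show ?thesis using p_spans[OF I, of "[e]" n W]
      by (intro computesI[OF p_nontrivial_def]) (simp add: computes_def)
  qed
  have "computes (p_filter p_nontrivial) (Node (enc_inst n E a b W) (enc_list enc_edge E))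
    (enc_list enc_edge (nontrivial_list E a b)) ((length E + 1) * (T_spans s + 50 + 50))"
    unfolding nontrivial_list_def by (rule p_filter) (rule *)
  then show ?thesis unfolding T_nontrivial_def
    by (rule computes_mono[OF computes_length_mono[OF _ E]]) simp
qed

section \<open>Exhaustive search through subsets of prefixes\<close>

fun some_subset :: "(edge list \<Rightarrow> bool) \<Rightarrow> edge list \<Rightarrow> edge list \<Rightarrow> bool" where
  "some_subset t R [] \<longleftrightarrow> t R"
| "some_subset t R (x # P) \<longleftrightarrow> some_subset t (x # R) P \<or> some_subset t R P"

fun some_prefix :: "(edge list \<Rightarrow> bool) \<Rightarrow> edge list \<Rightarrow> edge list \<Rightarrow> bool" where
  "some_prefix t P [] \<longleftrightarrow> some_subset t [] P"
| "some_prefix t P (x # N) \<longleftrightarrow> some_subset t [] P \<or> some_prefix t (x # P) N"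

definition removal_test :: "edge list \<Rightarrow> nat \<Rightarrow> nat \<Rightarrow> nat \<Rightarrow> edge list \<Rightarrow> bool" where
  "removal_test E a b \<rho> R \<longleftrightarrow> \<rho> \<le> length R \<and> spans_without E a b R"

definition p_subset :: prog where
  "p_subset = exp.If (Right (Right (Var 0)))
    (exp.If (Rec (NodeE (Left (Var 0)) (NodeE
        (NodeE (Left (Right (Right (Var 0)))) (Left (Right (Var 0))))
        (Right (Right (Right (Var 0)))))))
      TrueE
      (Rec (NodeE (Left (Var 0)) (NodeE (Left (Right (Var 0))) (Right (Right (Right (Var 0))))))))
    (exp.If (Call p_le (NodeE TrueE (NodeE (Left (Left (Var 0))) (Call p_len (Left (Right (Var 0)))))))
      (Call p_spans (NodeE (Left (Right (Var 0))) (Right (Left (Var 0)))))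
      LeafE)"

definition T_test :: "nat \<Rightarrow> nat" where
  "T_test s = T_spans s + (s + 1) * (20 * s + 50) + 50 * s + 300"

text \<open>The recursion tree has \<open>2 ^ (length P + 1) - 1\<close> nodes, and
  \<open>T_test s\<close> pays for each of them, leaf or not.\<close>

lemma p_subset:
  assumes I: "small_inst s E a b" and \<rho>: "bl \<rho> \<le> s" and "length R + length P \<le> s"
  shows "computes p_subset
    (Node (Node (enc_nat \<rho>) (enc_inst n E a b W)) (Node (enc_list enc_edge R) (enc_list enc_edge P)))
    (enc_bool (some_subset (removal_test E a b \<rho>) R P)) (2 ^ (length P + 1) * T_test s - T_test s)"
  using assms(3)
proof (induction P arbitrary: R)
  case Nil
  then have R: "length R \<le> s" by simp
  show ?case
    using p_spans[OF I R, of n W] computes_length_mono[OF p_len[OF R, of enc_edge] R] p_le_True[of \<rho> "length R"] \<rho>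
    by (intro computesI[OF p_subset_def])
      (auto simp: computes_def removal_test_def T_test_def)
next
  case (Cons x P)
  define X where "X = 2 ^ (length P + 1) * T_test s"
  have X: "T_test s \<le> X" "2 ^ (length (x # P) + 1) * T_test s - T_test s = 2 * X - T_test s"
    "100 \<le> T_test s" by (simp_all add: X_def T_test_def)
  show ?case unfolding X(2)
    using Cons.IH[of R] Cons.IH[of "x # R"] Cons.prems X(1,3) unfolding X_def[symmetric]
    by (intro computesI[OF p_subset_def]) (auto simp: computes_def)
qed

definition p_prefix :: prog where
  "p_prefix = exp.If (Call p_subset (NodeE (Left (Var 0)) (NodeE LeafE (Left (Right (Var 0))))))
    TrueE
    (exp.If (Right (Right (Var 0)))
      (Rec (NodeE (Left (Var 0)) (NodeE
        (NodeE (Left (Right (Right (Var 0)))) (Left (Right (Var 0))))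
        (Right (Right (Right (Var 0)))))))
      LeafE)"

text \<open>All subsets of the first \<open>k\<close> edges are tried before any other edge is considered, so that a
  solution among them bounds the number of tests.\<close>

lemma p_prefix:
  assumes I: "small_inst s E a b" and \<rho>: "bl \<rho> \<le> s" and "length P + length N \<le> s"
    and "length P \<le> k"
    and "length P + length N \<le> k \<or>
      (\<exists>P'. some_subset (removal_test E a b \<rho>) [] P' \<and> P' = rev (take (k - length P) N) @ P)"
  shows "computes p_prefix
    (Node (Node (enc_nat \<rho>) (enc_inst n E a b W)) (Node (enc_list enc_edge P) (enc_list enc_edge N)))
    (enc_bool (some_prefix (removal_test E a b \<rho>) P N))
    (2 ^ (k + 2) * T_test s - 2 ^ (length P + 1) * T_test s)"
proof -
  \<comment> \<open>The prefixes of lengths \<open>length P\<close> to \<open>k\<close> cost at most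
    \<open>2 ^ (length P + 1) + ... + 2 ^ (k + 1)\<close> times \<open>T_test s\<close>, which
    telescopes to \<open>2 ^ (k + 2) - 2 ^ (length P + 1)\<close> times that.\<close>
  define Y where "Y = 2 ^ (k + 2) * T_test s"
  show ?thesis using assms(3-5) unfolding Y_def[symmetric]
  proof (induction N arbitrary: P)
    case Nil
    define X where "X = 2 ^ (length P + 1) * T_test s"
    have "2 * X \<le> Y"
      using power_increasing[of "length P + 2" "k + 2" "2::nat"] Nil by (simp add: X_def Y_def)
    moreover have "100 \<le> T_test s" "T_test s \<le> X" by (simp_all add: T_test_def X_def)
    moreover have "computes p_subset
      (Node (Node (enc_nat \<rho>) (enc_inst n E a b W)) (Node Leaf (enc_list enc_edge P)))
      (enc_bool (some_subset (removal_test E a b \<rho>) [] P)) (X - T_test s)"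
      using p_subset[OF I \<rho>, of "[]" P n W] Nil by (simp add: X_def)
    ultimately show ?case unfolding X_def[symmetric]
      by (intro computesI[OF p_prefix_def]) (auto simp: computes_def)
  next
    case (Cons x N)
    define X where "X = 2 ^ (length P + 1) * T_test s"
    have T: "100 \<le> T_test s" by (simp add: T_test_def)
    have X: "2 * X \<le> Y" "2 ^ (length (x # P) + 1) * T_test s = 2 * X"
      using power_increasing[of "length P + 2" "k + 2" "2::nat"] Cons.prems by (simp_all add: X_def Y_def)
    have X_ge: "T_test s \<le> X" by (simp add: X_def)
    have sub: "computes p_subset
      (Node (Node (enc_nat \<rho>) (enc_inst n E a b W)) (Node Leaf (enc_list enc_edge P)))
      (enc_bool (some_subset (removal_test E a b \<rho>) [] P)) (X - T_test s)"
      using p_subset[OF I \<rho>, of "[]" P n W] Cons.prems by (simp add: X_def)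
    show ?case
    proof (cases "some_subset (removal_test E a b \<rho>) [] P")
      case True
      then show ?thesis using sub X(1) T X_ge unfolding X_def[symmetric]
        by (intro computesI[OF p_prefix_def]) (auto simp: computes_def)
    next
      case False
      \<comment> \<open>At \<open>length P = k\<close> the solution promised for the prefix of
        length \<open>k\<close> would lie in \<open>P\<close> itself, contradicting the failure just
        seen.\<close>
      then have k: "length P < k" using Cons.prems by (cases "length P = k") auto
      then have "k - length P = Suc (k - length (x # P))" by simp
      then have IH: "computes p_prefix
        (Node (Node (enc_nat \<rho>) (enc_inst n E a b W))
          (Node (enc_list enc_edge (x # P)) (enc_list enc_edge N)))
        (enc_bool (some_prefix (removal_test E a b \<rho>) (x # P) N)) (Y - 2 * X)"
        unfolding X(2)[symmetric] using Cons.prems k by (intro Cons.IH) auto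
      then show ?thesis using False sub X(1) T X_ge unfolding X_def[symmetric]
        by (intro computesI[OF p_prefix_def]) (auto simp: computes_def)
    qed
  qed
qed

definition p_removal :: prog where
  "p_removal = Call p_prefix (NodeE (Var 0) (NodeE LeafE
    (Call (p_filter p_nontrivial) (NodeE (Right (Var 0)) (Left (Right (Right (Var 0))))))))"

definition T_removal :: "nat \<Rightarrow> nat" where
  "T_removal s = 4 * T_test s + T_nontrivial s + 50"

text \<open>The program does not know \<open>k\<close>. Every \<open>k\<close> that bounds the list,
  or at which the search succeeds, yields a bound on its time.\<close>

lemma p_removal:
  assumes I: "small_inst s E a b" and \<rho>: "bl \<rho> \<le> s"
    and k: "length (nontrivial_list E a b) \<le> k \<or>
      some_subset (removal_test E a b \<rho>) [] (rev (take k (nontrivial_list E a b)))"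
  shows "computes p_removal (Node (enc_nat \<rho>) (enc_inst n E a b W))
    (enc_bool (some_prefix (removal_test E a b \<rho>) [] (nontrivial_list E a b)))
    (2 ^ k * T_removal s)"
proof -
  let ?N = "nontrivial_list E a b"
  have "length ?N \<le> s"
    using I by (auto simp: small_inst_def small_edges_def nontrivial_list_def
      intro: le_trans[OF length_filter_le])
  then have "computes p_prefix
    (Node (Node (enc_nat \<rho>) (enc_inst n E a b W)) (Node Leaf (enc_list enc_edge ?N)))
    (enc_bool (some_prefix (removal_test E a b \<rho>) [] ?N)) (2 ^ (k + 2) * T_test s)"
    using p_prefix[OF I \<rho>, of "[]" ?N k n W] k by (auto intro: computes_mono)
  moreover define X where "X = 2 ^ k * T_removal s"
  moreover have "T_nontrivial s + 50 \<le> 2 ^ k * (T_nontrivial s + 50)" by simp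
  then have "2 ^ (k + 2) * T_test s + (T_nontrivial s + 50) \<le> X"
    by (simp add: T_removal_def X_def algebra_simps)
  ultimately show ?thesis unfolding X_def[symmetric] using p_nontrivial[OF I, of n W]
    by (intro computesI[OF p_removal_def]) (simp add: computes_def)
qed

section \<open>The spanner program\<close>

lemma evI: "p = b \<Longrightarrow> ev p [x] b Q \<Longrightarrow> halts p x \<and> Q (res p x) (time p x) (calls p x)"
  using ev_unfold by blast

lemma bl_add: "bl a \<le> k \<Longrightarrow> bl b \<le> k \<Longrightarrow> bl (a + b) \<le> Suc k"
  unfolding bl_le_iff by simp

text \<open>Programs smaller than \<open>p_removal\<close> differ from it and, as they call only
  smaller ones, never call it. This keeps the traces of the helpers out of the count.\<close>

lemma size_p_removal:
  "size p_le < size p_removal" "size p_inc < size p_removal" "size p_len < size p_removal"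
  "size (p_filter p_settles) < size p_removal"
  by (simp_all add: p_removal_def p_prefix_def p_subset_def p_nontrivial_def p_spans_def
      p_stretch_def p_filter_def p_all_def p_len_def p_settles_def)

lemma p_removal_notin_calls:
  "size q \<le> size p_removal \<Longrightarrow> halts q x \<Longrightarrow> (p_removal, y) \<notin> set (calls q x)"
  using calls_smaller[of q x p_removal y] by auto

lemma p_removal_neq: "size q < size p_removal \<Longrightarrow> p_removal \<noteq> q"
  by auto

section \<open>Preprocessing, the loop over the numbers of removed edges, and the answer\<close>

definition p_preprocess :: prog where
  "p_preprocess = NodeE (Left (Var 0)) (NodeE
    (Call (p_filter p_settles) (NodeE (Var 0) (Left (Right (Var 0)))))
    (Right (Right (Var 0))))"

definition T_preprocess :: "nat \<Rightarrow> nat" where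
  "T_preprocess s = (s + 1) * (T_settles s + 50) + 50"

lemma p_preprocess:
  assumes I: "small_inst s E a b"
  shows "computes p_preprocess (enc_inst n E a b W)
    (enc_inst n (filter (settles_edge E a b) E) a b W) (T_preprocess s)"
    "(p_removal, y) \<notin> set (calls p_preprocess (enc_inst n E a b W))"
proof -
  have E: "length E \<le> s" using I by (simp add: small_inst_def small_edges_def)
  have *: "computes (p_filter p_settles) (Node (enc_inst n E a b W) (enc_list enc_edge E))
    (enc_list enc_edge (filter (settles_edge E a b) E)) ((s + 1) * (T_settles s + 50))"
    using p_settles[OF I] by (intro computes_length_mono[OF p_filter E]) auto
  have "halts p_preprocess (enc_inst n E a b W) \<and>
    res p_preprocess (enc_inst n E a b W) = enc_inst n (filter (settles_edge E a b) E) a b W \<and>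
    time p_preprocess (enc_inst n E a b W) \<le> T_preprocess s \<and>
    (p_removal, y) \<notin> set (calls p_preprocess (enc_inst n E a b W))"
    using * p_removal_neq[OF size_p_removal(4)] p_removal_notin_calls[OF less_imp_le[OF size_p_removal(4)]]
    by (intro evI[OF p_preprocess_def]) (simp add: computes_def T_preprocess_def)
  then show "computes p_preprocess (enc_inst n E a b W)
    (enc_inst n (filter (settles_edge E a b) E) a b W) (T_preprocess s)"
    "(p_removal, y) \<notin> set (calls p_preprocess (enc_inst n E a b W))"
    by (simp_all add: computes_def)
qed

text \<open>With \<open>n\<close> vertices and \<open>m\<close> edges the loop carries \<open>\<rho>\<close>, \<open>n + \<rho>\<close> and \<open>W + \<rho>\<close>, so that both
  \<open>\<rho> \<le> m + 1 - n\<close> and \<open>m - \<rho> \<le> W\<close> are tested without subtraction.\<close>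

definition p_loop :: prog where
  "p_loop = exp.If (Call p_le (NodeE TrueE
      (NodeE (Left (Right (Right (Var 0)))) (Right (Right (Left (Var 0)))))))
    (exp.Let (Rec (NodeE (Left (Var 0)) (NodeE (Call p_inc (Left (Right (Var 0))))
        (NodeE (Call p_inc (Left (Right (Right (Var 0)))))
          (Call p_inc (Right (Right (Right (Var 0)))))))))
      (exp.If (Call p_removal (NodeE (Left (Right (Var 1))) (Left (Left (Var 1)))))
        (exp.If (Call p_le (NodeE TrueE
            (NodeE (Left (Right (Left (Var 1)))) (Right (Right (Right (Var 1)))))))
          TrueE (Var 0))
        (Var 0)))
    LeafE"

text \<open>The recursive call is evaluated before the answer for \<rho> is inspected. Without an
  early exit the trace is the same whatever the answers \<open>Rm\<close> are. The admissible value
  \<open>n + \<rho> = m + 2\<close> is the final round, in which the test fails.\<close>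

lemma p_loop:
  assumes rem: "\<And>\<rho>. 1 \<le> \<rho> \<Longrightarrow> \<rho> \<le> Suc m - n \<Longrightarrow>
      computes p_removal (Node (enc_nat \<rho>) J) (enc_bool (Rm \<rho>)) T"
    and "1 \<le> \<rho>" "n + \<rho> \<le> m + 2" "m \<le> s" "bl W \<le> s"
  shows "halts p_loop (Node (Node J (Node (enc_nat m) (enc_nat (Suc m))))
      (Node (enc_nat \<rho>) (Node (enc_nat (n + \<rho>)) (enc_nat (W + \<rho>))))) \<and>
    (\<lambda>v t cs. v = enc_bool (\<exists>r\<in>{\<rho>..Suc m - n}. Rm r \<and> m \<le> W + r) \<and>
      t \<le> (Suc (Suc m) - (n + \<rho>)) * (T + 300 * s + 1500) + 300 * s + 1500 \<and>
      {x. (p_removal, x) \<in> set cs} = (\<lambda>r. Node (enc_nat r) J) ` {\<rho>..Suc m - n})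
    (res p_loop (Node (Node J (Node (enc_nat m) (enc_nat (Suc m))))
      (Node (enc_nat \<rho>) (Node (enc_nat (n + \<rho>)) (enc_nat (W + \<rho>))))))
    (time p_loop (Node (Node J (Node (enc_nat m) (enc_nat (Suc m))))
      (Node (enc_nat \<rho>) (Node (enc_nat (n + \<rho>)) (enc_nat (W + \<rho>))))))
    (calls p_loop (Node (Node J (Node (enc_nat m) (enc_nat (Suc m))))
      (Node (enc_nat \<rho>) (Node (enc_nat (n + \<rho>)) (enc_nat (W + \<rho>))))))"
  using assms(2,3)
proof (induction "Suc (Suc m) - (n + \<rho>)" arbitrary: \<rho>)
  case 0
  then have \<rho>: "n + \<rho> = Suc (Suc m)" by simp
  then have emp: "{\<rho>..Suc m - n} = {}" using 0 by auto
  have "bl (n + \<rho>) \<le> s + 2" unfolding \<rho> using bl_le_self[of "Suc (Suc m)"] assms(4) by simp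
  then show ?case unfolding emp
    using p_le_True[of "n + \<rho>" "Suc m"] \<rho> p_removal_neq[OF size_p_removal(1)]
      p_removal_notin_calls[OF less_imp_le[OF size_p_removal(1)]]
    by (intro evI[OF p_loop_def]) (simp add: computes_def)
next
  case (Suc k)
  then have \<rho>: "n + \<rho> \<le> Suc m" "\<rho> \<le> Suc m - n" by simp_all
  define k' where "k' = k * (T + 300 * s + 1500)"
  have k: "Suc k * (T + 300 * s + 1500) = k' + (T + 300 * s + 1500)" by (simp add: k'_def)
  have int: "{\<rho>..Suc m - n} = insert \<rho> {Suc \<rho>..Suc m - n}" using \<rho>(2) by auto
  have kk: "k = Suc (Suc m) - (n + Suc \<rho>)" using Suc.hyps(2) by simp
  have IH: "halts p_loop (Node (Node J (Node (enc_nat m) (enc_nat (Suc m))))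
      (Node (enc_nat (Suc \<rho>)) (Node (enc_nat (Suc (n + \<rho>))) (enc_nat (Suc (W + \<rho>)))))) \<and>
    (\<lambda>v t cs. v = enc_bool (\<exists>r\<in>{Suc \<rho>..Suc m - n}. Rm r \<and> m \<le> W + r) \<and>
      t \<le> k' + 300 * s + 1500 \<and>
      {x. (p_removal, x) \<in> set cs} = (\<lambda>r. Node (enc_nat r) J) ` {Suc \<rho>..Suc m - n})
    (res p_loop (Node (Node J (Node (enc_nat m) (enc_nat (Suc m))))
      (Node (enc_nat (Suc \<rho>)) (Node (enc_nat (Suc (n + \<rho>))) (enc_nat (Suc (W + \<rho>)))))))
    (time p_loop (Node (Node J (Node (enc_nat m) (enc_nat (Suc m))))
      (Node (enc_nat (Suc \<rho>)) (Node (enc_nat (Suc (n + \<rho>))) (enc_nat (Suc (W + \<rho>)))))))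
    (calls p_loop (Node (Node J (Node (enc_nat m) (enc_nat (Suc m))))
      (Node (enc_nat (Suc \<rho>)) (Node (enc_nat (Suc (n + \<rho>))) (enc_nat (Suc (W + \<rho>)))))))"
    using Suc.hyps(1)[OF kk] \<rho>(1) unfolding kk[symmetric] k'_def by simp
  have bits: "bl \<rho> \<le> s + 1" "bl (n + \<rho>) \<le> s + 1" "bl m \<le> s" "bl (W + \<rho>) \<le> s + 2"
    using bl_le_self[of \<rho>] bl_le_self[of "n + \<rho>"] bl_le_self[of m] \<rho> assms(4)
      bl_add[of W "s + 1" \<rho>] assms(5) by simp_all
  note neq = size_p_removal(1,2)[THEN p_removal_neq]
    size_p_removal(1,2)[THEN less_imp_le, THEN p_removal_notin_calls]
    p_removal_notin_calls[OF order_refl]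
  have calls: "{x. x = y \<or> (p_removal, x) \<in> C} = insert y {x. (p_removal, x) \<in> C}" for y C
    by auto
  show ?case unfolding Suc.hyps(2)[symmetric] k int
    by (intro evI[OF p_loop_def])
      (use IH rem[OF Suc.prems(1) \<rho>(2)] p_le_True[of "n + \<rho>" "Suc m"] p_le_True[of m "W + \<rho>"] p_inc[of \<rho>]
        p_inc[of "n + \<rho>"] p_inc[of "W + \<rho>"] bits \<rho>(1)
       in \<open>auto simp: computes_def neq\<close>)
qed

text \<open>The comparison of \<open>m\<close> with \<open>W\<close> handles the removal of no edge
  at all. It comes after the loop, again so that all calls are made even when the answer is already
  clear.\<close>

definition p_spanner :: prog where
  "p_spanner = exp.Let (Call p_preprocess (Var 0)) (exp.Let (Call p_len (Left (Right (Var 0))))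
    (exp.Let (Call p_loop (NodeE (NodeE (Var 1) (NodeE (Var 0) (Call p_inc (Var 0))))
        (NodeE (NodeE TrueE LeafE) (NodeE (Call p_inc (Left (Var 2)))
          (Call p_inc (Right (Right (Right (Var 2)))))))))
      (exp.If (Call p_le (NodeE TrueE (NodeE (Var 1) (Right (Right (Right (Var 3)))))))
        TrueE (Var 0))))"

definition T_spanner :: "nat \<Rightarrow> nat" where
  "T_spanner s = T_preprocess s + (s + 1) * (20 * s + 50) + (s + 3) * (300 * s + 1500) + 200 * s + 500"

lemma p_spanner:
  fixes E0 :: "edge list" and a b n W :: nat
  defines "E \<equiv> filter (settles_edge E0 a b) E0"
  defines "J \<equiv> enc_inst (enc_nat n) E a b (enc_nat W)"
  defines "x \<equiv> enc_inst (enc_nat n) E0 a b (enc_nat W)"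
  defines "\<phi> \<equiv> Suc (length E) - n"
  assumes I: "small_inst s E0 a b" and n: "bl n \<le> s" "n \<le> Suc (length E)" and W: "bl W \<le> s"
    and rem: "\<And>\<rho>. 1 \<le> \<rho> \<Longrightarrow> \<rho> \<le> \<phi> \<Longrightarrow>
      computes p_removal (Node (enc_nat \<rho>) J) (enc_bool (Rm \<rho>)) T"
  shows "computes p_spanner x
      (enc_bool (length E \<le> W \<or> (\<exists>r\<in>{1..\<phi>}. Rm r \<and> length E \<le> W + r))) ((s + 2) * T + T_spanner s)"
    "{y. (p_removal, y) \<in> set (calls p_spanner x)} = (\<lambda>r. Node (enc_nat r) J) ` {1..\<phi>}"
proof -
  let ?m = "length E"
  have m: "?m \<le> s"
    using I by (auto simp: small_inst_def small_edges_def E_def intro: le_trans[OF length_filter_le])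
  have pre: "computes p_preprocess x J (T_preprocess s)"
    "(p_removal, y) \<notin> set (calls p_preprocess x)" for y
    unfolding E_def J_def x_def by (rule p_preprocess(1)[OF I], rule p_preprocess(2)[OF I])
  note len = computes_length_mono[OF p_len[OF m, of enc_edge] m]
  have rem': "1 \<le> \<rho> \<Longrightarrow> \<rho> \<le> Suc ?m - n \<Longrightarrow>
    computes p_removal (Node (enc_nat \<rho>) J) (enc_bool (Rm \<rho>)) T" for \<rho>
    using rem by (simp add: \<phi>_def)
  define X where "X = (s + 2) * (T + 300 * s + 1500) + 300 * s + 1500"
  have X: "(Suc (Suc ?m) - (n + 1)) * (T + 300 * s + 1500) + 300 * s + 1500 \<le> X"
    unfolding X_def using m by (intro add_le_mono mult_le_mono) auto
  define S where "S = Node (Node J (Node (enc_nat ?m) (enc_nat (Suc ?m))))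
    (Node (enc_nat 1) (Node (enc_nat (Suc n)) (enc_nat (Suc W))))"
  have one: "enc_nat 1 = Node (Node Leaf Leaf) Leaf" by (simp add: enc_nat_pos)
  have loop: "halts p_loop S" "res p_loop S = enc_bool (\<exists>r\<in>{1..\<phi>}. Rm r \<and> ?m \<le> W + r)"
    "time p_loop S \<le> X"
    "{x. (p_removal, x) \<in> set (calls p_loop S)} = (\<lambda>r. Node (enc_nat r) J) ` {1..\<phi>}"
  proof -
    note L = p_loop[where n = n and m = ?m and \<rho> = 1 and s = s and W = W and J = J and T = T
        and Rm = Rm, OF rem' order_refl _ m W]
    have S: "Node (Node J (Node (enc_nat ?m) (enc_nat (Suc ?m))))
      (Node (enc_nat 1) (Node (enc_nat (n + 1)) (enc_nat (W + 1)))) = S" by (simp add: S_def)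
    have "n + 1 \<le> ?m + 2" using n by simp
    note L = L[OF _ _ this, unfolded S]
    show "halts p_loop S" "res p_loop S = enc_bool (\<exists>r\<in>{1..\<phi>}. Rm r \<and> ?m \<le> W + r)"
      "{x. (p_removal, x) \<in> set (calls p_loop S)} = (\<lambda>r. Node (enc_nat r) J) ` {1..\<phi>}"
      using L unfolding \<phi>_def by blast+
    show "time p_loop S \<le> X" using L X by (meson le_trans)
  qed
  have bits: "bl ?m \<le> s" using bl_le_self[of ?m] m by simp
  \<comment> \<open>\<open>p_loop\<close> contains \<open>p_removal\<close> and is larger, so a size
    comparison cannot tell them apart in the usual direction; the outermost constructors do.\<close>
  have neq_loop: "p_removal \<noteq> p_loop" "p_removal \<noteq> p_preprocess"
    using size_p_removal by (auto simp: p_loop_def p_preprocess_def p_removal_def)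
  note neq = size_p_removal(1,2,3)[THEN p_removal_neq] neq_loop
    size_p_removal(1,2,3)[THEN less_imp_le, THEN p_removal_notin_calls]
    p_removal_notin_calls[OF order_refl]
  have parts: "left J = enc_nat n" "left (right J) = enc_list enc_edge E"
    "right (right (right J)) = enc_nat W" "right (right (right x)) = enc_nat W"
    "left x = enc_nat n"
    by (simp_all add: J_def x_def)
  have "X + T_preprocess s + (s + 1) * (20 * s + 50) + 200 * s + 500 \<le> (s + 2) * T + T_spanner s"
    by (simp add: X_def T_spanner_def algebra_simps)
  then have "halts p_spanner x \<and> (\<lambda>v t cs.
    v = enc_bool (length E \<le> W \<or> (\<exists>r\<in>{1..\<phi>}. Rm r \<and> length E \<le> W + r)) \<and>
    t \<le> (s + 2) * T + T_spanner s \<and>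
    {y. (p_removal, y) \<in> set cs} = (\<lambda>r. Node (enc_nat r) J) ` {1..\<phi>})
    (res p_spanner x) (time p_spanner x) (calls p_spanner x)"
    using pre len loop p_inc[of ?m] p_inc[of n] p_inc[of W] p_le_True[of ?m W] n W bits
    unfolding S_def one
    by (intro evI[OF p_spanner_def]; cases "length E \<le> W") (simp_all add: computes_def neq parts)
  then show "computes p_spanner x
      (enc_bool (length E \<le> W \<or> (\<exists>r\<in>{1..\<phi>}. Rm r \<and> length E \<le> W + r))) ((s + 2) * T + T_spanner s)"
    "{y. (p_removal, y) \<in> set (calls p_spanner x)} = (\<lambda>r. Node (enc_nat r) J) ` {1..\<phi>}"
    by (simp_all add: computes_def)
qed

section \<open>Paths\<close>

abbreviation plen :: "(nat set \<Rightarrow> nat) \<Rightarrow> nat list \<Rightarrow> nat" where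
  "plen l p \<equiv> sum_list (map l (path_edges p))"

lemma path_edges_Cons: "p \<noteq> [] \<Longrightarrow> path_edges (u # p) = {u, hd p} # path_edges p"
  by (cases p) auto

lemma path_edges_append:
  "p \<noteq> [] \<Longrightarrow> q \<noteq> [] \<Longrightarrow> path_edges (p @ q) = path_edges p @ {last p, hd q} # path_edges q"
  by (induction p rule: path_edges.induct) (auto simp: path_edges_Cons)

lemma is_path_refl: "is_path F u u [u]"
  by (simp add: is_path_def)

lemma is_path_edge: "{u, v} \<in> F \<Longrightarrow> u \<noteq> v \<Longrightarrow> is_path F u v [u, v]"
  by (simp add: is_path_def)

lemma is_path_mono: "is_path F u v p \<Longrightarrow> set (path_edges p) \<subseteq> G \<Longrightarrow> is_path G u v p"
  by (simp add: is_path_def)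

lemma is_path_snoc:
  assumes "is_path F u v p" "{v, w} \<in> F" "w \<notin> set p"
  shows "is_path F u w (p @ [w])" "plen l (p @ [w]) = plen l p + l {v, w}"
  using assms by (auto simp: is_path_def path_edges_append)

lemma is_path_appendD:
  assumes "is_path F u v (p @ w # q)"
  shows "is_path F u w (p @ [w])" "plen l (p @ [w]) \<le> plen l (p @ w # q)" "is_path F w v (w # q)"
  using assms by (cases "p = []"; auto simp: is_path_def path_edges_append path_edges_Cons hd_append)+

lemma is_path_snocD:
  assumes "is_path F u v (p @ [v])" "p \<noteq> []"
  shows "is_path F u (last p) p" "{last p, v} \<in> F" "last p \<noteq> v"
    "plen l (p @ [v]) = plen l p + l {last p, v}"
  using assms by (auto simp: is_path_def path_edges_append)

text \<open>Paths are taken apart at their far end, where relaxation and extension act. The length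
  equation holds for all length functions at once.\<close>

lemma is_path_snoc_cases:
  assumes "is_path F u v p"
  obtains "u = v" "p = [u]" | q w where "p = q @ [v]" "is_path F u w q" "{w, v} \<in> F" "w \<noteq> v"
    "\<And>l. plen l p = plen l q + l {w, v}"
proof (cases "butlast p = []")
  case True
  then have "p = [u]" "u = v" using assms
    by (metis append_butlast_last_id append_self_conv2 is_path_def list.sel(1))+
  then show ?thesis using that(1) by blast
next
  case False
  have p: "p = butlast p @ [v]" using assms by (metis append_butlast_last_id is_path_def)
  show ?thesis using that(2)[OF p, of "last (butlast p)"] is_path_snocD[of F u v "butlast p"] assms p False
    by metis
qed

text \<open>If the new vertex already lies on the path, stop there: lengths are natural numbers, so
  a prefix is no longer than the whole.\<close>

lemma is_path_extend:
  assumes "is_path F u v p" "{v, w} \<in> F"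
  obtains q where "is_path F u w q" "plen l q \<le> plen l p + l {v, w}"
proof (cases "w \<in> set p")
  case True
  then obtain p1 p2 where "p = p1 @ w # p2" by (meson split_list)
  then have p: "is_path F u v (p1 @ w # p2)" using assms by simp
  show ?thesis
      by (rule that[OF is_path_appendD(1)[OF p]])
        (simp add: \<open>p = _\<close> trans_le_add1[OF is_path_appendD(2)[OF p]])
next
  case False
  then show ?thesis using that[of "p @ [w]"] is_path_snoc[OF assms] by simp
qed

text \<open>The concatenation of simple paths need not be simple. Appending the second one vertex by
  vertex cuts off each loop as it arises.\<close>

lemma is_path_trans:
  assumes "is_path F u v p" "is_path F v w q"
  shows "\<exists>r. is_path F u w r \<and> plen l r \<le> plen l p + plen l q"
  using assms(2)
proof (induction q arbitrary: w rule: length_induct)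
  case (1 q)
  from 1(2) show ?case
  proof (cases rule: is_path_snoc_cases)
    case 1
    then show ?thesis using assms(1) by auto
  next
    case (2 q' w')
    then obtain r where r: "is_path F u w' r" "plen l r \<le> plen l p + plen l q'"
      using 1(1)[rule_format, of q' w'] by auto
    obtain r' where "is_path F u w r'" "plen l r' \<le> plen l r + l {w', w}"
      using is_path_extend[OF r(1) 2(3)] .
    then show ?thesis using r(2) 2(5)[of l] by (intro exI[of _ r']) simp
  qed
qed

lemma is_path_rev:
  assumes "is_path F u v p"
  shows "is_path F v u (rev p)" "plen l (rev p) = plen l p"
proof -
  have e: "path_edges (rev p) = rev (path_edges p)" for p
  proof (induction p)
    case (Cons u p)
    then show ?case
      by (cases "p = []") (simp_all add: path_edges_append path_edges_Cons last_rev insert_commute)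
  qed simp
  show "is_path F v u (rev p)" using assms by (auto simp: is_path_def hd_rev last_rev e)
  show "plen l (rev p) = plen l p" by (simp add: e rev_map[symmetric])
qed

text \<open>Serves with three values of \<open>c\<close>: the stretch factor for spanners, 1 for
  detours around deleted edges, and 0 with zero lengths for mere connectivity.\<close>

lemma is_path_replace:
  fixes c :: real
  assumes "is_path E u v p"
    and "\<And>x y. {x, y} \<in> set (path_edges p) \<Longrightarrow>
      \<exists>q. is_path F x y q \<and> real (plen l q) \<le> c * real (l {x, y})"
  shows "\<exists>q. is_path F u v q \<and> real (plen l q) \<le> c * real (plen l p)"
  using assms
proof (induction p arbitrary: v rule: length_induct)
  case (1 p)
  from 1(2) show ?case
  proof (cases rule: is_path_snoc_cases)
    case 1
    then show ?thesis by (auto intro!: exI[of _ "[u]"] is_path_refl)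
  next
    case (2 q w)
    have q: "q \<noteq> []" "last q = w" using 2(2) by (auto simp: is_path_def)
    then have pe: "path_edges p = path_edges q @ [{w, v}]" unfolding 2(1) by (simp add: path_edges_append)
    have "length q < length p" by (simp add: 2(1))
    then obtain r where r: "is_path F u w r" "real (plen l r) \<le> c * real (plen l q)"
      using 1(1)[rule_format, of q w] 2(2) 1(3) pe by auto
    obtain s where s: "is_path F w v s" "real (plen l s) \<le> c * real (l {w, v})"
      using 1(3)[of w v] pe by auto
    obtain t where "is_path F u v t" "plen l t \<le> plen l r + plen l s"
      using is_path_trans[OF r(1) s(1)] by blast
    then show ?thesis using r s 2(5)[of l] by (intro exI[of _ t]) (auto simp: algebra_simps)
  qed
qed

section \<open>Connected graphs, forests and the feedback edge set number\<close>

definition connected_on :: "nat set \<Rightarrow> nat set set \<Rightarrow> bool" where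
  "connected_on V F \<longleftrightarrow> (\<forall>u\<in>V. \<forall>v\<in>V. \<exists>p. is_path F u v p)"

definition edges_on :: "nat set \<Rightarrow> nat set set \<Rightarrow> bool" where
  "edges_on V F \<longleftrightarrow> (\<forall>e\<in>F. \<exists>u\<in>V. \<exists>v\<in>V. u \<noteq> v \<and> e = {u, v})"

lemma finite_edges_on: "finite V \<Longrightarrow> edges_on V F \<Longrightarrow> finite F"
  by (rule finite_subset[of _ "Pow V"]) (auto simp: edges_on_def)

text \<open>Every vertex but the root has an edge to its predecessor on a shortest path from the root.\<close>

lemma connected_on_card:
  assumes V: "finite V" and F: "finite F" and con: "connected_on V F"
  shows "card V \<le> Suc (card F)"
proof (cases "V = {}")
  case False
  then obtain r where r: "r \<in> V" by blast
  define d where "d v = (LEAST k. \<exists>p. is_path F r v p \<and> length p = k)" for v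
  have d: "\<exists>p. is_path F r v p \<and> length p = d v" if "v \<in> V" for v
    unfolding d_def by (rule LeastI_ex) (use con r that in \<open>auto simp: connected_on_def\<close>)
  have dle: "d v \<le> length p" if "is_path F r v p" for v p
    unfolding d_def by (rule Least_le) (use that in blast)
  have "\<exists>w. {w, v} \<in> F \<and> Suc (d w) \<le> d v" if v: "v \<in> V - {r}" for v
  proof -
    obtain p where p: "is_path F r v p" "length p = d v" using d v by blast
    from p(1) show ?thesis
    proof (cases rule: is_path_snoc_cases)
      case (2 q w)
      then show ?thesis using dle[OF 2(2)] p(2) by (intro exI[of _ w]) simp
    qed (use v in simp)
  qed
  then obtain w where w: "\<And>v. v \<in> V - {r} \<Longrightarrow> {w v, v} \<in> F \<and> Suc (d (w v)) \<le> d v" by metis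
  have "inj_on (\<lambda>v. {w v, v}) (V - {r})"
  proof (rule inj_onI)
    fix x y assume xy: "x \<in> V - {r}" "y \<in> V - {r}" and eq: "{w x, x} = {w y, y}"
    show "x = y"
    proof (rule ccontr)
      assume "x \<noteq> y"
      \<comment> \<open>Each vertex would be the predecessor of the other, and so strictly closer to
        the root than the other.\<close>
      then have "w x = y" "w y = x" using eq by (auto simp: doubleton_eq_iff)
      then show False using w[OF xy(1)] w[OF xy(2)] by simp
    qed
  qed
  then have "card (V - {r}) \<le> card F"
    by (rule card_inj_on_le) (use w F in auto)
  then show ?thesis using r V by (simp add: card_Diff_singleton)
qed simp

text \<open>Take an end of a longest path: a second edge there would either prolong the path or
  close a cycle.\<close>

lemma acyclic_leaf:
  assumes V: "finite V" "V \<noteq> {}" and F: "edges_on V F" and ac: "\<nexists>p. is_cycle F p"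
  shows "\<exists>v\<in>V. card {e \<in> F. v \<in> e} \<le> 1"
proof (rule ccontr)
  assume no: "\<not> ?thesis"
  have fin: "finite F" using finite_edges_on[OF V(1) F] .
  define Q where "Q p \<longleftrightarrow> p \<noteq> [] \<and> distinct p \<and> set p \<subseteq> V \<and> set (path_edges p) \<subseteq> F" for p
  have len: "length p \<le> card V" if "Q p" for p
    using that card_mono[OF V(1), of "set p"] distinct_card[of p] by (simp add: Q_def)
  obtain v where "v \<in> V" using V by blast
  then have "Q [v]" by (simp add: Q_def)
  then have "\<exists>p. Q p \<and> (\<forall>q. Q q \<longrightarrow> length q \<le> length p)"
    by (rule ex_has_greatest_nat[of Q "[v]" length "Suc (card V)"]) (simp add: len less_Suc_eq_le)
  then obtain p where p: "Q p" and max: "\<And>q. Q q \<Longrightarrow> length q \<le> length p" by blast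
  define u where "u = hd p"
  define rest where "rest = tl p"
  have pu: "p = u # rest" using p by (simp add: Q_def u_def rest_def)
  define S where "S = {e \<in> F. u \<in> e}"
  have "u \<in> V" using p pu by (simp add: Q_def)
  then have "\<not> card S \<le> 1" using no S_def by blast
  moreover have "finite S" using fin by (simp add: S_def)
  ultimately have "\<exists>e1\<in>S. \<exists>e2\<in>S. e1 \<noteq> e2"
    using card_le_Suc0_iff_eq[of S] by (metis One_nat_def)
  then obtain e1 e2 where "e1 \<in> S" "e2 \<in> S" "e1 \<noteq> e2" by blast
  \<comment> \<open>If the path is a single vertex, \<open>hd rest\<close> is unspecified; of two
    different edges one still differs from this set.\<close>
  then have "\<exists>e\<in>S. e \<noteq> {u, hd rest}" by metis
  then obtain e where e: "e \<in> S" "e \<noteq> {u, hd rest}" by blast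
  from e(1) F obtain x y where xy: "x \<in> V" "y \<in> V" "x \<noteq> y" "e = {x, y}"
    unfolding S_def edges_on_def by blast
  have eF: "e \<in> F" "u \<in> e" using e(1) by (simp_all add: S_def)
  define w where "w = (if u = x then y else x)"
  have w: "e = {u, w}" "u \<noteq> w" "w \<in> V" "{u, w} \<in> F"
    using xy eF by (auto simp: w_def insert_commute split: if_splits)
  show False
  proof (cases "w \<in> set p")
    case False
    moreover have "{w, u} \<in> F" using w(4) by (simp add: insert_commute)
    ultimately have "Q (w # p)" using p w(3) pu by (simp add: Q_def)
    then show False using max[of "w # p"] by simp
  next
    case True
    then have "w \<in> set rest" using w pu by simp
    then obtain r1 r2 where r: "rest = r1 @ w # r2" by (meson split_list)
    \<comment> \<open>The edge is not the first one of the path, so the cycle it closes has at least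
      three vertices.\<close>
    then have "r1 \<noteq> []" using e(2) w by auto
    moreover have "is_path F u (last p) ((u # r1) @ w # r2)"
      using p pu r by (simp add: Q_def is_path_def)
    note is_path_appendD(1)[OF this]
    moreover have "{w, u} \<in> F" using w(4) by (simp add: insert_commute)
    ultimately have "is_cycle F (u # r1 @ [w])"
      by (cases r1) (simp_all add: is_cycle_def is_path_def)
    then show False using ac by blast
  qed
qed

text \<open>Deleting a vertex of degree at most one loses at most one edge.\<close>

lemma acyclic_card:
  "finite V \<Longrightarrow> V \<noteq> {} \<Longrightarrow> edges_on V F \<Longrightarrow> \<nexists>p. is_cycle F p \<Longrightarrow> Suc (card F) \<le> card V"
proof (induction "card V" arbitrary: V F)
  case (Suc k)
  obtain v where v: "v \<in> V" "card {e \<in> F. v \<in> e} \<le> 1"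
    using acyclic_leaf[OF Suc.prems] by blast
  have fin: "finite F" using finite_edges_on[OF Suc.prems(1,3)] .
  let ?F = "{e \<in> F. v \<notin> e}"
  have k: "card (V - {v}) = k" using Suc v by simp
  show ?case
  proof (cases "V = {v}")
    case True
    then have "F = {}" using Suc.prems(3) by (auto simp: edges_on_def)
    then show ?thesis using True by simp
  next
    case False
    have "edges_on (V - {v}) ?F"
      using Suc.prems(3) by (fastforce simp: edges_on_def)
    moreover have "\<nexists>p. is_cycle ?F p" using Suc.prems(4) by (auto simp: is_cycle_def)
    ultimately have "Suc (card ?F) \<le> card (V - {v})"
      using Suc.hyps(1)[of "V - {v}" ?F] k Suc.prems False v by auto
    moreover have "card F = card ?F + card {e \<in> F. v \<in> e}"
      using fin by (subst card_Un_disjoint[symmetric]) (auto intro!: arg_cong[where f = card])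
    ultimately show ?thesis using v(2) k Suc.hyps(2) by simp
  qed
qed simp

text \<open>The rest of the cycle bridges the closing edge wherever a path uses it. Having three
  vertices ensures that the rest does not contain this edge.\<close>

lemma cycle_edge_redundant:
  assumes c: "is_cycle F p" and con: "connected_on V F"
  shows "connected_on V (F - {{last p, hd p}})" (is "connected_on V ?G")
proof -
  have p: "length p \<ge> 3" "distinct p" "set (path_edges p) \<subseteq> F" using c by (auto simp: is_cycle_def)
  obtain a b q where p': "p = a # b # q" "q \<noteq> []"
    using p(1) by (cases p; cases "tl p"; cases "tl (tl p)") auto
  have "{last p, hd p} \<notin> set (path_edges p)"
  proof
    have sub: "e \<in> set (path_edges r) \<Longrightarrow> e \<subseteq> set r" for e r
      by (induction r rule: path_edges.induct) auto
    assume "{last p, hd p} \<in> set (path_edges p)"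
    then have "{last q, a} = {a, b} \<or> {last q, a} \<in> set (path_edges (b # q))" using p' by simp
    moreover have "a \<notin> set (b # q)" "last q \<noteq> b" using p(2) p' last_in_set[OF p'(2)] by auto
    ultimately show False using sub[of "{last q, a}" "b # q"] by (auto simp: doubleton_eq_iff)
  qed
  then have path: "is_path ?G (hd p) (last p) p"
    using p p' by (auto simp: is_path_def)
  have "\<exists>q. is_path ?G u v q" if "is_path F u v r" for u v r
  proof -
    \<comment> \<open>All lengths are 0 here, so that replacement is used for connectivity
      only.\<close>
    have "\<exists>q. is_path ?G u v q \<and> real (plen (\<lambda>_. 0) q) \<le> 0 * real (plen (\<lambda>_. 0) r)"
    proof (rule is_path_replace[OF that])
      fix x y assume xy: "{x, y} \<in> set (path_edges r)"
      have "x \<noteq> y"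
      proof -
        have "distinct r" using that by (simp add: is_path_def)
        then show ?thesis using xy
          by (induction r rule: path_edges.induct) (auto simp: doubleton_eq_iff)
      qed
      moreover have "{x, y} \<in> F" using xy that by (auto simp: is_path_def)
      moreover have "\<exists>q. is_path ?G x y q" if "{x, y} = {last p, hd p}"
        using that path is_path_rev(1)[OF path] by (auto simp: doubleton_eq_iff)
      ultimately have "\<exists>q. is_path ?G x y q"
        using is_path_edge[of x y ?G] by (cases "{x, y} = {last p, hd p}") auto
      then show "\<exists>q. is_path ?G x y q \<and> real (plen (\<lambda>_. 0) q) \<le> 0 * real 0"
        by simp
    qed
    then show ?thesis by blast
  qed
  then show ?thesis using con unfolding connected_on_def by blast
qed

text \<open>Delete closing edges while there are cycles. At the end the lower bound for connected
  graphs and the upper bound for forests meet.\<close>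

lemma spanning_tree:
  assumes V: "finite V" "V \<noteq> {}" and F: "edges_on V F" and con: "connected_on V F"
  shows "\<exists>T\<subseteq>F. (\<nexists>p. is_cycle T p) \<and> Suc (card T) = card V"
  using F con
proof (induction "card F" arbitrary: F rule: less_induct)
  case less
  have fin: "finite F" using finite_edges_on[OF V(1) less.prems(1)] .
  show ?case
  proof (cases "\<exists>p. is_cycle F p")
    case True
    then obtain p where p: "is_cycle F p" by blast
    let ?e = "{last p, hd p}"
    have "?e \<in> F" using p by (simp add: is_cycle_def)
    then have "card (F - {?e}) < card F" using fin by (intro psubset_card_mono) auto
    moreover have "edges_on V (F - {?e})" using less.prems(1) by (auto simp: edges_on_def)
    ultimately show ?thesis
      using less.hyps[of "F - {?e}"] cycle_edge_redundant[OF p less.prems(2)] by (meson Diff_subset subset_trans)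
  next
    case False
    then have "Suc (card F) = card V"
      using acyclic_card[OF V less.prems(1)] connected_on_card[OF V(1) fin less.prems(2)]
      by (simp add: le_antisym)
    then show ?thesis using False by blast
  qed
qed

lemma finite_edges [simp]: "finite (edges I)"
  by (simp add: edges_def)

lemma valid_instanceD:
  assumes "valid_instance I"
  shows "edges_on (verts I) (edges I)" "connected_on (verts I) (edges I)" "finite (verts I)"
    "verts I \<noteq> {}" "card (verts I) = num_verts I" "distinct (map (\<lambda>(u, v, w, l). {u, v}) (edge_list I))"
    "card (edges I) = length (edge_list I)"
proof -
  show "edges_on (verts I) (edges I)"
    using assms unfolding valid_instance_def edges_def edges_on_def by fastforce
  show d: "distinct (map (\<lambda>(u, v, w, l). {u, v}) (edge_list I))"
    using assms by (simp add: valid_instance_def)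
  show "card (edges I) = length (edge_list I)"
    unfolding edges_def set_map[symmetric] using distinct_card[OF d] by simp
  have "num_verts I \<ge> 1" using assms by (simp add: valid_instance_def)
  then show "verts I \<noteq> {}" by (auto simp: verts_def lessThan_empty_iff)
qed (use assms in \<open>auto simp: valid_instance_def verts_def connected_on_def\<close>)

text \<open>The complement of a spanning tree is a feedback edge set. Conversely, what any feedback
  edge set leaves is a forest and has no more edges than the tree.\<close>

lemma feedback_number_eq:
  assumes I: "valid_instance I"
  shows "feedback_number I + card (verts I) = card (edges I) + 1"
proof -
  note v = valid_instanceD[OF I]
  obtain T where T: "T \<subseteq> edges I" "\<nexists>p. is_cycle T p" "Suc (card T) = card (verts I)"
    using spanning_tree[OF v(3,4,1,2)] by blast
  have fT: "finite T" using finite_subset[OF T(1) finite_edges] .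
  have "feedback_number I = card (edges I - T)"
    unfolding feedback_number_def
  proof (rule Least_equality)
    have "edges I - (edges I - T) = T" using T by blast
    then have "feedback_edge_set I (edges I - T)"
      unfolding feedback_edge_set_def using T(2) by simp
    then show "\<exists>R. feedback_edge_set I R \<and> card R = card (edges I - T)" by blast
  next
    fix k assume "\<exists>R. feedback_edge_set I R \<and> card R = k"
    then obtain R where R: "R \<subseteq> edges I" "\<nexists>p. is_cycle (edges I - R) p" "card R = k"
      unfolding feedback_edge_set_def by blast
    have "edges_on (verts I) (edges I - R)" using v(1) by (auto simp: edges_on_def)
    from acyclic_card[OF v(3,4) this R(2)] have "Suc (card (edges I - R)) \<le> Suc (card T)"
      using T by simp
    then show "card (edges I - T) \<le> k"
      using R(3) card_Diff_subset[OF fT T(1)] card_Diff_subset[OF finite_subset[OF R(1) finite_edges] R(1)]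
      by linarith
  qed
  then show ?thesis using T fT card_mono[OF finite_edges T(1)] by (simp add: card_Diff_subset)
qed

section \<open>Distances and spanners\<close>

lemma path_len_eq: "path_len I p = plen (len I) p"
  by (simp add: path_len_def)

lemma path_dist_attained:
  assumes "is_path F u v p"
  shows "\<exists>p. is_path F u v p \<and> path_dist I F u v = ereal (real (path_len I p)) \<and>
    (\<forall>q. is_path F u v q \<longrightarrow> path_len I p \<le> path_len I q)"
proof -
  obtain p where p: "is_path F u v p" "\<forall>q. is_path F u v q \<longrightarrow> path_len I p \<le> path_len I q"
    using ex_has_least_nat[of "is_path F u v", OF assms] by blast
  have "path_dist I F u v = ereal (real (path_len I p))"
    unfolding path_dist_def
    by (intro antisym INF_lower INF_greatest) (use p in auto)
  then show ?thesis using p by blast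
qed

lemma path_dist_le_iff:
  "path_dist I F u v \<le> ereal r \<longleftrightarrow> (\<exists>p. is_path F u v p \<and> real (path_len I p) \<le> r)"
proof
  assume le: "path_dist I F u v \<le> ereal r"
  have "\<exists>p. is_path F u v p"
  proof (rule ccontr)
    assume "\<not> ?thesis"
    then have "path_dist I F u v = \<infinity>" by (simp add: path_dist_def top_ereal_def)
    then show False using le by simp
  qed
  then obtain p where "is_path F u v p" "path_dist I F u v = ereal (real (path_len I p))"
    using path_dist_attained by metis
  then show "\<exists>p. is_path F u v p \<and> real (path_len I p) \<le> r" using le by auto
next
  assume "\<exists>p. is_path F u v p \<and> real (path_len I p) \<le> r"
  then obtain p where p: "is_path F u v p" "real (path_len I p) \<le> r" by blast
  have "path_dist I F u v \<le> ereal (real (path_len I p))"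
    unfolding path_dist_def by (rule INF_lower) (simp add: p)
  also have "\<dots> \<le> ereal r" using p by simp
  finally show "path_dist I F u v \<le> ereal r" .
qed

definition stretch_real :: "spanner_instance \<Rightarrow> real" where
  "stretch_real I = of_rat (stretch I)"

lemma stretch_real_ge: "valid_instance I \<Longrightarrow> 1 \<le> stretch_real I"
  unfolding valid_instance_def stretch_real_def by simp

text \<open>The spanner condition for one pair without infima: a bound relative to every path
  amounts to a bound relative to a shortest one.\<close>

definition connects :: "spanner_instance \<Rightarrow> nat set set \<Rightarrow> nat \<Rightarrow> nat \<Rightarrow> bool" where
  "connects I F u v \<longleftrightarrow> (\<forall>q. is_path (edges I) u v q \<longrightarrow>
    (\<exists>p. is_path F u v p \<and> real (path_len I p) \<le> stretch_real I * real (path_len I q)))"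

lemma connects_mono: "connects I F u v \<Longrightarrow> F \<subseteq> G \<Longrightarrow> connects I G u v"
  unfolding connects_def using is_path_mono[of F _ _ _ G] by (meson is_path_def subset_trans)

lemma connects_iff:
  assumes "valid_instance I" "u \<in> verts I" "v \<in> verts I"
  shows "path_dist I F u v \<le> ereal (of_rat (stretch I)) * path_dist I (edges I) u v \<longleftrightarrow>
    connects I F u v"
proof -
  obtain p0 where "is_path (edges I) u v p0" using assms unfolding valid_instance_def by blast
  then obtain q where q: "is_path (edges I) u v q"
    "path_dist I (edges I) u v = ereal (real (path_len I q))"
    "\<And>q'. is_path (edges I) u v q' \<Longrightarrow> path_len I q \<le> path_len I q'"
    using path_dist_attained by metis
  have a: "0 \<le> stretch_real I" using stretch_real_ge[OF assms(1)] by simp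
  have "path_dist I F u v \<le> ereal (of_rat (stretch I)) * path_dist I (edges I) u v \<longleftrightarrow>
    (\<exists>p. is_path F u v p \<and> real (path_len I p) \<le> stretch_real I * real (path_len I q))"
    unfolding q(2) times_ereal.simps path_dist_le_iff stretch_real_def ..
  also have "\<dots> \<longleftrightarrow> connects I F u v"
  proof
    assume "\<exists>p. is_path F u v p \<and> real (path_len I p) \<le> stretch_real I * real (path_len I q)"
    then obtain p where p: "is_path F u v p" "real (path_len I p) \<le> stretch_real I * real (path_len I q)"
      by blast
    show "connects I F u v" unfolding connects_def
    proof (intro allI impI exI[of _ p] conjI)
      fix q' assume "is_path (edges I) u v q'"
      then have "stretch_real I * real (path_len I q) \<le> stretch_real I * real (path_len I q')"
        using q(3) a by (intro mult_left_mono) simp_all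
      then show "real (path_len I p) \<le> stretch_real I * real (path_len I q')" using p(2) by linarith
    qed (rule p(1))
  qed (use q(1) in \<open>simp add: connects_def\<close>)
  finally show ?thesis .
qed

lemma is_spanner_iff_all:
  assumes "valid_instance I"
  shows "is_spanner I F \<longleftrightarrow> F \<subseteq> edges I \<and> (\<forall>u\<in>verts I. \<forall>v\<in>verts I. connects I F u v)"
  unfolding is_spanner_def using connects_iff[OF assms] by simp

lemma edge_list_edge: "(u, v, w, l) \<in> set (edge_list I) \<Longrightarrow> {u, v} \<in> edges I"
  unfolding edges_def by force

lemma edges_edge_list:
  assumes "e \<in> edges I"
  obtains u v w l where "(u, v, w, l) \<in> set (edge_list I)" "e = {u, v}"
  using assms unfolding edges_def by force

lemma entry_unique:
  assumes "valid_instance I" "(u, v, w, l) \<in> set (edge_list I)" "(u', v', w', l') \<in> set (edge_list I)"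
    "{u, v} = {u', v'}"
  shows "u' = u" "v' = v" "w' = w" "l' = l"
proof -
  have "inj_on (\<lambda>(u, v, w, l). {u, v}) (set (edge_list I))"
    using valid_instanceD(6)[OF assms(1)] by (simp add: distinct_map)
  from inj_onD[OF this _ assms(2,3)] assms(4) show "u' = u" "v' = v" "w' = w" "l' = l" by simp_all
qed

lemma valid_entry:
  assumes "valid_instance I" "(u, v, w, l) \<in> set (edge_list I)"
  shows "u \<in> verts I" "v \<in> verts I" "u \<noteq> v" "is_path (edges I) u v [u, v]"
proof -
  show "u \<in> verts I" "v \<in> verts I" "u \<noteq> v"
    using assms unfolding valid_instance_def by fastforce+
  then show "is_path (edges I) u v [u, v]" using edge_list_edge[OF assms(2)] by (simp add: is_path_edge)
qed

lemma connects_sym: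
  assumes "connects I F u v" shows "connects I F v u"
  unfolding connects_def path_len_eq
proof (intro allI impI)
  fix q assume "is_path (edges I) v u q"
  from is_path_rev[OF this] obtain p where
    p: "is_path F u v p" "real (plen (len I) p) \<le> stretch_real I * real (plen (len I) q)"
    using assms unfolding connects_def path_len_eq by metis
  then show "\<exists>p. is_path F v u p \<and> real (plen (len I) p) \<le> stretch_real I * real (plen (len I) q)"
    using is_path_rev[OF p(1)] by metis
qed

text \<open>A path of the graph is stretched edge by edge, and each edge is itself a path to which
  \<open>connects\<close> applies. Hence the program tests the edges only.\<close>

lemma is_spanner_iff:
  assumes I: "valid_instance I"
  shows "is_spanner I F \<longleftrightarrow> F \<subseteq> edges I \<and> (\<forall>(u, v, w, l)\<in>set (edge_list I). connects I F u v)"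
proof
  assume "is_spanner I F"
  then show "F \<subseteq> edges I \<and> (\<forall>(u, v, w, l)\<in>set (edge_list I). connects I F u v)"
    unfolding is_spanner_iff_all[OF I] using valid_entry[OF I] by blast
next
  assume F: "F \<subseteq> edges I \<and> (\<forall>(u, v, w, l)\<in>set (edge_list I). connects I F u v)"
  have "connects I F u v" for u v
    unfolding connects_def path_len_eq
  proof (intro allI impI, rule is_path_replace, assumption)
    fix q x y assume q: "is_path (edges I) u v q" and xy: "{x, y} \<in> set (path_edges q)"
    then have "{x, y} \<in> edges I" unfolding is_path_def by blast
    then obtain u' v' w l where e: "(u', v', w, l) \<in> set (edge_list I)" "{x, y} = {u', v'}"
      by (rule edges_edge_list)
    then have "connects I F u' v'" using F by blast
    then have "connects I F x y" using e(2) connects_sym by (auto simp: doubleton_eq_iff)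
    moreover have "x \<noteq> y" using valid_entry(3)[OF I e(1)] e(2) by (auto simp: doubleton_eq_iff)
    then have "is_path (edges I) x y [x, y]" using \<open>{x, y} \<in> edges I\<close> by (simp add: is_path_edge)
    ultimately show "\<exists>p. is_path F x y p \<and>
      real (plen (len I) p) \<le> stretch_real I * real (len I {x, y})"
      unfolding connects_def path_len_eq by fastforce
  qed
  then show "is_spanner I F" unfolding is_spanner_iff_all[OF I] using F by blast
qed

lemma is_spanner_mono:
  assumes "valid_instance I" "is_spanner I F" "F \<subseteq> G" "G \<subseteq> edges I"
  shows "is_spanner I G"
  using assms connects_mono unfolding is_spanner_iff_all[OF assms(1)] by blast

lemma settling_iff:
  assumes "valid_instance I" "u \<in> verts I" "v \<in> verts I"
  shows "settling I u v p \<longleftrightarrow> is_path (edges I) u v p \<and>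
    (\<forall>q. is_path (edges I) u v q \<longrightarrow> real (path_len I p) \<le> stretch_real I * real (path_len I q))"
proof -
  obtain p0 where "is_path (edges I) u v p0" using assms unfolding valid_instance_def by blast
  then obtain q where q: "is_path (edges I) u v q"
    "path_dist I (edges I) u v = ereal (real (path_len I q))"
    "\<And>q'. is_path (edges I) u v q' \<Longrightarrow> path_len I q \<le> path_len I q'"
    using path_dist_attained by metis
  have a: "0 \<le> stretch_real I" using stretch_real_ge[OF assms(1)] by simp
  have "real (path_len I p) \<le> stretch_real I * real (path_len I q) \<longleftrightarrow>
    (\<forall>q. is_path (edges I) u v q \<longrightarrow> real (path_len I p) \<le> stretch_real I * real (path_len I q))"
  proof (intro iffI allI impI)
    fix q' assume "is_path (edges I) u v q'"
    then have "stretch_real I * real (path_len I q) \<le> stretch_real I * real (path_len I q')"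
      using q(3) a by (intro mult_left_mono) simp_all
    moreover assume "real (path_len I p) \<le> stretch_real I * real (path_len I q)"
    ultimately show "real (path_len I p) \<le> stretch_real I * real (path_len I q')" by linarith
  qed (use q(1) in blast)
  then show ?thesis unfolding settling_def q(2) by (simp add: stretch_real_def)
qed

lemma is_spanner_removal:
  assumes I: "valid_instance I" and ss: "self_settling I"
    and R: "\<And>u v w l. (u, v, w, l) \<in> set (edge_list I) \<Longrightarrow> {u, v} \<in> R \<Longrightarrow>
      \<exists>p. settling I u v p \<and> set (path_edges p) \<inter> R = {}"
  shows "is_spanner I (edges I - R)"
proof -
  have "connects I (edges I - R) u v" if e: "(u, v, w, l) \<in> set (edge_list I)" for u v w l
  proof -
    note ve = valid_entry[OF I e]
    have s: "settling I u v [u, v]" using ss e unfolding self_settling_def by blast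
    have "\<exists>p. settling I u v p \<and> set (path_edges p) \<inter> R = {}"
    proof (cases "{u, v} \<in> R")
      case True
      then show ?thesis using R[OF e] by blast
    next
      case False
      then show ?thesis using s by (intro exI[of _ "[u, v]"]) simp
    qed
    then obtain p where p: "settling I u v p" "set (path_edges p) \<inter> R = {}" by blast
    have "is_path (edges I - R) u v p"
      using p unfolding settling_def is_path_def by blast
    then show ?thesis
      using p(1) unfolding settling_iff[OF I ve(1,2)] connects_def by blast
  qed
  then show ?thesis unfolding is_spanner_iff[OF I] by blast
qed

section \<open>Nontrivial edges under unit weights\<close>

lemma unit_trivial: "unit_weights I \<Longrightarrow> trivial_edges I = mandatory I"
  unfolding unit_weights_def trivial_edges_def by fastforce

lemma nontrivial_alternative:
  assumes "{u, v} \<in> nontrivial_edges I"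
  shows "\<exists>p. alternative I u v p"
  using assms unfolding nontrivial_edges_def trivial_edges_def mandatory_def by blast

text \<open>This reduces nontriviality to the spanner test. An alternative path is a detour for the
  one missing edge; conversely, a spanner without the edge supplies a path for its endpoints that
  settles them and avoids it.\<close>

lemma nontrivial_iff:
  assumes I: "valid_instance I" and ss: "self_settling I" and uw: "unit_weights I"
    and e: "e \<in> edges I"
  shows "e \<in> nontrivial_edges I \<longleftrightarrow> is_spanner I (edges I - {e})"
proof
  assume en: "e \<in> nontrivial_edges I"
  show "is_spanner I (edges I - {e})"
  proof (rule is_spanner_removal[OF I ss])
    fix u v w l assume "{u, v} \<in> {e}"
    then obtain p where "alternative I u v p" using nontrivial_alternative en by blast
    then show "\<exists>p. settling I u v p \<and> set (path_edges p) \<inter> {e} = {}"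
      using \<open>{u, v} \<in> {e}\<close> unfolding alternative_def by blast
  qed
next
  assume sp: "is_spanner I (edges I - {e})"
  have "e \<notin> mandatory I"
  proof
    assume "e \<in> mandatory I"
    then obtain u v where uv: "e = {u, v}" "\<nexists>p. alternative I u v p" unfolding mandatory_def by blast
    obtain u' v' w l where "(u', v', w, l) \<in> set (edge_list I)" "e = {u', v'}"
      using edges_edge_list[OF e] .
    then have "u \<in> verts I" "v \<in> verts I"
      using uv(1) valid_entry[OF I] by (metis doubleton_eq_iff)+
    note V = this
    obtain q0 where "is_path (edges I) u v q0" using I V unfolding valid_instance_def by blast
    then obtain q where q: "is_path (edges I) u v q"
      "\<And>q'. is_path (edges I) u v q' \<Longrightarrow> path_len I q \<le> path_len I q'"
      using path_dist_attained by metis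
    have "connects I (edges I - {e}) u v" using sp V unfolding is_spanner_iff_all[OF I] by blast
    then obtain p where p: "is_path (edges I - {e}) u v p"
      "real (path_len I p) \<le> stretch_real I * real (path_len I q)"
      using q(1) unfolding connects_def by blast
    have a: "0 \<le> stretch_real I" using stretch_real_ge[OF I] by simp
    have "settling I u v p" unfolding settling_iff[OF I V]
    proof (intro conjI allI impI)
      show "is_path (edges I) u v p" using p(1) unfolding is_path_def by blast
      fix q' assume "is_path (edges I) u v q'"
      then have "stretch_real I * real (path_len I q) \<le> stretch_real I * real (path_len I q')"
        using q(2) a by (intro mult_left_mono) simp_all
      then show "real (path_len I p) \<le> stretch_real I * real (path_len I q')" using p(2) by linarith
    qed
    then have "alternative I u v p"
      using p(1) uv(1) unfolding alternative_def is_path_def by blast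
    then show False using uv(2) by blast
  qed
  then show "e \<in> nontrivial_edges I"
    using e unit_trivial[OF uw] unfolding nontrivial_edges_def by blast
qed

section \<open>Independent sets of removable edges\<close>

text \<open>A digraph with out-degrees at most \<open>\<tau>\<close> has a vertex of in-degree at most \<open>\<tau>\<close>, which is
  selected while its at most \<open>2 \<tau>\<close> neighbours are discarded.\<close>

lemma independent_subset:
  fixes A :: "'a \<Rightarrow> 'a set"
  assumes "finite S" "\<rho> * (2 * \<tau> + 1) \<le> card S"
    and A: "\<And>e. e \<in> S \<Longrightarrow> finite (A e) \<and> card (A e) \<le> \<tau> \<and> e \<notin> A e"
  shows "\<exists>R\<subseteq>S. card R = \<rho> \<and> (\<forall>e\<in>R. A e \<inter> R = {})"
  using assms
proof (induction \<rho> arbitrary: S)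
  case 0
  then show ?case by (intro exI[of _ "{}"]) simp
next
  case (Suc \<rho>)
  have "\<exists>v\<in>S. card {e \<in> S. v \<in> A e} \<le> \<tau>"
  proof (rule ccontr)
    assume "\<not> ?thesis"
    \<comment> \<open>Arcs inside \<open>S\<close> are counted by heads and by tails: in-degrees all
      above \<tau> would add up to more than out-degrees of at most \<tau> allow, as
      \<open>S\<close> is not empty.\<close>
    then have "(\<Sum>v\<in>S. Suc \<tau>) \<le> (\<Sum>v\<in>S. card {e \<in> S. v \<in> A e})"
      by (intro sum_mono) (simp add: not_le Suc_le_eq)
    also have "\<dots> = (\<Sum>v\<in>S. \<Sum>e\<in>S. if v \<in> A e then 1 else 0)"
      using Suc.prems(1) by (simp add: sum.If_cases Int_def)
    also have "\<dots> = (\<Sum>e\<in>S. \<Sum>v\<in>S. if v \<in> A e then 1 else 0)" by (rule sum.swap)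
    also have "\<dots> = (\<Sum>e\<in>S. card (S \<inter> A e))"
      using Suc.prems(1) by (simp add: sum.If_cases Int_def)
    also have "\<dots> \<le> (\<Sum>e\<in>S. \<tau>)"
      using Suc.prems(3) by (intro sum_mono) (meson card_mono inf_le2 le_trans)
    finally have "card S * Suc \<tau> \<le> card S * \<tau>" by simp
    then show False using Suc.prems(2) by simp
  qed
  then obtain v where v: "v \<in> S" "card {e \<in> S. v \<in> A e} \<le> \<tau>" by blast
  define D where "D = insert v (A v \<union> {e \<in> S. v \<in> A e})"
  have "card D \<le> Suc (card (A v \<union> {e \<in> S. v \<in> A e}))"
    unfolding D_def by (rule card_insert_le_m1) simp_all
  also have "\<dots> \<le> Suc (card (A v) + card {e \<in> S. v \<in> A e})" using card_Un_le by blast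
  also have "\<dots> \<le> 2 * \<tau> + 1" using v Suc.prems(3)[OF v(1)] by simp
  finally have D: "card D \<le> 2 * \<tau> + 1" .
  have "finite D" unfolding D_def using Suc.prems(1,3) v(1) by simp
  then have "card S - card D \<le> card (S - D)" by (rule diff_card_le_card_Diff)
  then have "\<rho> * (2 * \<tau> + 1) \<le> card (S - D)" using D Suc.prems(2) by simp
  then obtain R where R: "R \<subseteq> S - D" "card R = \<rho>" "\<forall>e\<in>R. A e \<inter> R = {}"
    using Suc.IH[of "S - D"] Suc.prems(1,3) by (metis DiffD1 finite_Diff)
  have "finite R" using finite_subset[OF R(1)] Suc.prems(1) by simp
  moreover have "v \<notin> R" using R(1) D_def by blast
  ultimately have "card (insert v R) = Suc \<rho>" using R(2) by simp
  moreover have "\<forall>e\<in>insert v R. A e \<inter> insert v R = {}"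
    using R(1,3) Suc.prems(3)[OF v(1)] unfolding D_def by blast
  ultimately show ?case using R(1) v(1) by (intro exI[of _ "insert v R"]) blast
qed

lemma num_nontrivial_le_tightness:
  assumes "{u, v} \<in> critical I" "tightest_alternative I u v p"
  shows "num_nontrivial I p \<le> tightness I"
proof -
  let ?S = "{num_nontrivial I p | p u v. {u, v} \<in> critical I \<and> tightest_alternative I u v p}"
  \<comment> \<open>\<open>Max\<close> says something only about a finite set; finiteness comes from
    bounding the values, without counting paths.\<close>
  have "?S \<subseteq> {..card (nontrivial_edges I)}"
    by (auto simp: num_nontrivial_def nontrivial_edges_def intro!: card_mono)
  then have "finite ?S" by (rule finite_subset) simp
  then show ?thesis unfolding tightness_def using assms by (intro Max_ge) auto
qed

lemma nontrivial_settling_path: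
  assumes uv: "{u, v} \<in> nontrivial_edges I"
  shows "\<exists>p. settling I u v p \<and> {u, v} \<notin> set (path_edges p) \<and>
    card (set (path_edges p) \<inter> nontrivial_edges I) \<le> tightness I"
proof (cases "\<exists>p. settling I u v p \<and> set (path_edges p) \<subseteq> trivial_edges I")
  case True
  then obtain p where p: "settling I u v p" "set (path_edges p) \<subseteq> trivial_edges I" by blast
  then have "set (path_edges p) \<inter> nontrivial_edges I = {}" unfolding nontrivial_edges_def by blast
  then show ?thesis using p(1) uv by (intro exI[of _ p]) auto
next
  case False
  then have crit: "{u, v} \<in> critical I"
    using uv unfolding critical_def nontrivial_edges_def by blast
  obtain p0 where "alternative I u v p0" using nontrivial_alternative[OF uv] by blast
  then obtain p where p: "alternative I u v p"
    "\<forall>q. alternative I u v q \<longrightarrow> num_nontrivial I p \<le> num_nontrivial I q"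
    using ex_has_least_nat[of "alternative I u v" p0 "num_nontrivial I"] by blast
  then have "num_nontrivial I p \<le> tightness I"
    using num_nontrivial_le_tightness[OF crit] unfolding tightest_alternative_def by blast
  then show ?thesis using p(1) unfolding alternative_def num_nontrivial_def by blast
qed

lemma removable_subset:
  assumes I: "valid_instance I" and ss: "self_settling I"
    and S: "S \<subseteq> nontrivial_edges I" "\<rho> * (2 * tightness I + 1) \<le> card S"
  shows "\<exists>R\<subseteq>S. card R = \<rho> \<and> is_spanner I (edges I - R)"
proof -
  have fin: "finite (nontrivial_edges I)" unfolding nontrivial_edges_def by simp
  \<comment> \<open>A path is chosen for each edge as a set, whereas settling refers to an
    orientation; the unique entry of the edge list fixes it.\<close>
  have "\<forall>e\<in>nontrivial_edges I. \<exists>p.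
    (\<forall>u v w l. (u, v, w, l) \<in> set (edge_list I) \<and> {u, v} = e \<longrightarrow> settling I u v p) \<and>
    e \<notin> set (path_edges p) \<and> card (set (path_edges p) \<inter> nontrivial_edges I) \<le> tightness I"
  proof
    fix e assume e: "e \<in> nontrivial_edges I"
    then have "e \<in> edges I" unfolding nontrivial_edges_def by blast
    then obtain u v w l where uv: "(u, v, w, l) \<in> set (edge_list I)" "e = {u, v}"
      by (rule edges_edge_list)
    obtain p where p: "settling I u v p" "{u, v} \<notin> set (path_edges p)"
      "card (set (path_edges p) \<inter> nontrivial_edges I) \<le> tightness I"
      using nontrivial_settling_path e uv(2) by blast
    have "settling I u' v' p" if "(u', v', w', l') \<in> set (edge_list I)" "{u', v'} = e" for u' v' w' l'
      using entry_unique(1,2)[OF I uv(1) that(1)] that(2) uv(2) p(1) by simp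
    then show "\<exists>p. (\<forall>u v w l. (u, v, w, l) \<in> set (edge_list I) \<and> {u, v} = e \<longrightarrow> settling I u v p) \<and>
      e \<notin> set (path_edges p) \<and> card (set (path_edges p) \<inter> nontrivial_edges I) \<le> tightness I"
      using p(2,3) uv(2) by blast
  qed
  from bchoice[OF this] obtain P where
    P: "\<And>e u v w l. e \<in> nontrivial_edges I \<Longrightarrow> (u, v, w, l) \<in> set (edge_list I) \<Longrightarrow> {u, v} = e \<Longrightarrow>
      settling I u v (P e)"
    "\<And>e. e \<in> nontrivial_edges I \<Longrightarrow> e \<notin> set (path_edges (P e))"
    "\<And>e. e \<in> nontrivial_edges I \<Longrightarrow>
      card (set (path_edges (P e)) \<inter> nontrivial_edges I) \<le> tightness I"
    by blast
  define A where "A e = set (path_edges (P e)) \<inter> nontrivial_edges I" for e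
  obtain R where R: "R \<subseteq> S" "card R = \<rho>" "\<forall>e\<in>R. A e \<inter> R = {}"
    using independent_subset[OF finite_subset[OF S(1) fin] S(2), of A] P(2,3) S(1) fin
    unfolding A_def by blast
  have "is_spanner I (edges I - R)"
  proof (rule is_spanner_removal[OF I ss])
    fix u v w l assume uv: "(u, v, w, l) \<in> set (edge_list I)" "{u, v} \<in> R"
    then have N: "{u, v} \<in> nontrivial_edges I" using R(1) S(1) by blast
    have "set (path_edges (P {u, v})) \<inter> R = {}"
      using R(1,3) S(1) uv(2) unfolding A_def by blast
    then show "\<exists>p. settling I u v p \<and> set (path_edges p) \<inter> R = {}"
      using P(1)[OF N uv(1) refl] by blast
  qed
  then show ?thesis using R(1,2) by blast
qed

section \<open>Edges that do not settle themselves\<close>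

lemma map_of_entry:
  assumes "distinct (map (\<lambda>(u, v, w, l). {u, v}) es)" "(u, v, w, l) \<in> set es"
  shows "map_of (map (\<lambda>(u, v, w, l). ({u, v}, f w l)) es) {u, v} = Some (f w l)"
proof (rule map_of_is_SomeI)
  have e: "map fst (map (\<lambda>(u, v, w, l). ({u, v}, f w l)) es) = map (\<lambda>(u, v, w, l). {u, v}) es"
    by auto
  show "distinct (map fst (map (\<lambda>(u, v, w, l). ({u, v}, f w l)) es))"
    unfolding e by (rule assms(1))
  show "({u, v}, f w l) \<in> set (map (\<lambda>(u, v, w, l). ({u, v}, f w l)) es)" using assms(2) by force
qed

lemma len_entry: "valid_instance I \<Longrightarrow> (u, v, w, l) \<in> set (edge_list I) \<Longrightarrow> len I {u, v} = l"
  using map_of_entry[OF valid_instanceD(6), of I u v w l "\<lambda>w l. l"] by (simp add: len_def)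

lemma weight_entry: "valid_instance I \<Longrightarrow> (u, v, w, l) \<in> set (edge_list I) \<Longrightarrow> weight I {u, v} = w"
  using map_of_entry[OF valid_instanceD(6), of I u v w l "\<lambda>w l. w"] by (simp add: weight_def)

abbreviation "kept_edges I \<equiv> edges (preprocess I)"

lemma set_preprocess: "set (edge_list (preprocess I)) \<subseteq> set (edge_list I)"
  by (auto simp: preprocess_def)

lemma edges_preprocess: "kept_edges I \<subseteq> edges I"
  unfolding edges_def using set_preprocess by (rule image_mono)

lemma verts_preprocess [simp]: "verts (preprocess I) = verts I"
  by (simp add: verts_def preprocess_def)

lemma preprocess_simps [simp]: "stretch (preprocess I) = stretch I"
  "weight_bound (preprocess I) = weight_bound I" "num_verts (preprocess I) = num_verts I"
  by (simp_all add: preprocess_def)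

text \<open>Induction on the length of the edge. If the edge does not settle itself, some path
  between its ends has length below 1/\<alpha> of the edge; the spanner follows it within factor
  \<alpha>, so by edges that are all strictly shorter than the given one.\<close>

lemma spanner_detour:
  assumes I: "valid_instance I" and F: "is_spanner I F"
  shows "{x, y} \<in> F \<Longrightarrow> \<exists>p. is_path (F \<inter> kept_edges I) x y p \<and> plen (len I) p \<le> len I {x, y}"
proof (induction "len I {x, y}" arbitrary: x y rule: less_induct)
  case less
  have "{x, y} \<in> edges I" using less.prems F unfolding is_spanner_iff_all[OF I] by blast
  then obtain u v w l where e: "(u, v, w, l) \<in> set (edge_list I)" "{x, y} = {u, v}"
    by (rule edges_edge_list)
  note ve = valid_entry[OF I e(1)]
  have le: "len I {u, v} = l" "len I {x, y} = l" using len_entry[OF I e(1)] e(2) by simp_all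
  have "\<exists>p. is_path (F \<inter> kept_edges I) u v p \<and> plen (len I) p \<le> l"
  proof (cases "settling I u v [u, v]")
    case True
    then have "(u, v, w, l) \<in> set (edge_list (preprocess I))"
      using e(1) by (simp add: preprocess_def)
    then have "{u, v} \<in> F \<inter> kept_edges I" using less.prems e(2) edge_list_edge by force
    then show ?thesis using ve(3) le by (intro exI[of _ "[u, v]"]) (simp add: is_path_edge)
  next
    case False
    then obtain q where q: "is_path (edges I) u v q" "stretch_real I * real (path_len I q) < real l"
      using settling_iff[OF I ve(1,2), of "[u, v]"] ve(4) le by (auto simp: path_len_eq not_le)
    have "connects I F u v" using F ve unfolding is_spanner_iff_all[OF I] by blast
    then obtain p where p: "is_path F u v p" "real (path_len I p) \<le> stretch_real I * real (path_len I q)"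
      using q(1) unfolding connects_def by blast
    then have pl: "plen (len I) p < l" using q(2) by (simp add: path_len_eq)
    have "\<exists>r. is_path (F \<inter> kept_edges I) u v r \<and> real (plen (len I) r) \<le> 1 * real (plen (len I) p)"
    proof (rule is_path_replace[OF p(1)])
      fix x' y' assume xy: "{x', y'} \<in> set (path_edges p)"
      then have "{x', y'} \<in> F" using p(1) unfolding is_path_def by blast
      moreover have "len I {x', y'} \<le> plen (len I) p"
        using member_le_sum_list[of "len I {x', y'}" "map (len I) (path_edges p)"] xy by simp
      ultimately show "\<exists>r. is_path (F \<inter> kept_edges I) x' y' r \<and>
        real (plen (len I) r) \<le> 1 * real (len I {x', y'})"
        using less.hyps[of x' y'] pl le by auto
    qed
    then show ?thesis using pl by fastforce
  qed
  then obtain r where r: "is_path (F \<inter> kept_edges I) u v r" "plen (len I) r \<le> l" by blast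
  show ?case
  proof (cases "x = u")
    case True
    then have "y = v" using e(2) by (auto simp: doubleton_eq_iff)
    then show ?thesis using r True le by (intro exI[of _ r]) simp
  next
    case False
    then have "x = v" "y = u" using e(2) by (auto simp: doubleton_eq_iff)
    then show ?thesis using r le is_path_rev[OF r(1)] by (intro exI[of _ "rev r"]) simp
  qed
qed

lemma spanner_detour_path:
  assumes I: "valid_instance I" and F: "is_spanner I F" and q: "is_path F u v q"
  shows "\<exists>p. is_path (F \<inter> kept_edges I) u v p \<and> path_len I p \<le> path_len I q"
proof -
  have "\<exists>r. is_path (F \<inter> kept_edges I) u v r \<and> real (plen (len I) r) \<le> 1 * real (plen (len I) q)"
  proof (rule is_path_replace[OF q])
    fix x y assume "{x, y} \<in> set (path_edges q)"
    then have "{x, y} \<in> F" using q unfolding is_path_def by blast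
    then show "\<exists>r. is_path (F \<inter> kept_edges I) x y r \<and> real (plen (len I) r) \<le> 1 * real (len I {x, y})"
      using spanner_detour[OF I F] by simp
  qed
  then show ?thesis by (simp add: path_len_eq)
qed

lemma is_spanner_edges:
  assumes I: "valid_instance I"
  shows "is_spanner I (edges I)"
proof -
  have "connects I (edges I) u v" for u v
    unfolding connects_def
  proof (intro allI impI)
    fix q assume q: "is_path (edges I) u v q"
    have "1 * real (path_len I q) \<le> stretch_real I * real (path_len I q)"
      using stretch_real_ge[OF I] by (intro mult_right_mono) simp_all
    then show "\<exists>p. is_path (edges I) u v p \<and>
      real (path_len I p) \<le> stretch_real I * real (path_len I q)" using q by auto
  qed
  then show ?thesis unfolding is_spanner_iff_all[OF I] by blast
qed

lemma path_dist_Int_preprocess: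
  assumes I: "valid_instance I" and F: "is_spanner I F"
  shows "path_dist I (F \<inter> kept_edges I) u v = path_dist I F u v"
proof (rule antisym)
  show "path_dist I (F \<inter> kept_edges I) u v \<le> path_dist I F u v"
    unfolding path_dist_def
  proof (rule INF_mono)
    fix q assume "q \<in> {p. is_path F u v p}"
    then show "\<exists>p\<in>{p. is_path (F \<inter> kept_edges I) u v p}. ereal (real (path_len I p)) \<le> ereal (real (path_len I q))"
      using spanner_detour_path[OF I F] by simp
  qed
  show "path_dist I F u v \<le> path_dist I (F \<inter> kept_edges I) u v"
    unfolding path_dist_def
    by (rule INF_superset_mono) (auto simp: is_path_def)
qed

text \<open>The whole graph is a spanner of itself, so the detours apply to it too.\<close>

lemma path_dist_preprocess_edges:
  "valid_instance I \<Longrightarrow> path_dist I (kept_edges I) u v = path_dist I (edges I) u v"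
  using path_dist_Int_preprocess[OF _ is_spanner_edges, of I u v] edges_preprocess[of I]
  by (simp add: Int_absorb1)

lemma distinct_preprocess:
  "valid_instance I \<Longrightarrow> distinct (map (\<lambda>(u, v, w, l). {u, v}) (edge_list (preprocess I)))"
  unfolding preprocess_def using valid_instanceD(6) by (simp add: distinct_map_filter)

lemma len_preprocess:
  assumes I: "valid_instance I" and e: "e \<in> kept_edges I"
  shows "len (preprocess I) e = len I e" "weight (preprocess I) e = weight I e"
proof -
  obtain u v w l where uv: "(u, v, w, l) \<in> set (edge_list (preprocess I))" "e = {u, v}"
    using edges_edge_list[OF e] .
  have uv': "(u, v, w, l) \<in> set (edge_list I)" using uv(1) set_preprocess by blast
  show "len (preprocess I) e = len I e"
    using map_of_entry[OF distinct_preprocess[OF I] uv(1), of "\<lambda>w l. l"] len_entry[OF I uv'] uv(2)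
    by (simp add: len_def)
  show "weight (preprocess I) e = weight I e"
    using map_of_entry[OF distinct_preprocess[OF I] uv(1), of "\<lambda>w l. w"] weight_entry[OF I uv'] uv(2)
    by (simp add: weight_def)
qed

lemma path_len_preprocess:
  assumes I: "valid_instance I" and p: "set (path_edges p) \<subseteq> kept_edges I"
  shows "path_len (preprocess I) p = path_len I p"
  unfolding path_len_def using len_preprocess(1)[OF I] p
  by (intro arg_cong[where f = sum_list] map_cong) auto

lemma path_dist_preprocess:
  assumes I: "valid_instance I" and F: "F \<subseteq> kept_edges I"
  shows "path_dist (preprocess I) F u v = path_dist I F u v"
  unfolding path_dist_def
proof (rule INF_cong[OF refl])
  fix p assume "p \<in> {p. is_path F u v p}"
  then have "set (path_edges p) \<subseteq> kept_edges I" using F unfolding is_path_def by blast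
  then show "ereal (real (path_len (preprocess I) p)) = ereal (real (path_len I p))"
    using path_len_preprocess[OF I] by simp
qed

lemma is_spanner_preprocess:
  assumes I: "valid_instance I"
  shows "is_spanner (preprocess I) F \<longleftrightarrow> F \<subseteq> kept_edges I \<and> is_spanner I F"
  unfolding is_spanner_def
  using path_dist_preprocess[OF I, of F] path_dist_preprocess[OF I order_refl]
    path_dist_preprocess_edges[OF I] edges_preprocess[of I] by auto

text \<open>Deleting once is enough: detours preserve connectivity and all distances, so the kept
  edges still settle themselves in the smaller graph.\<close>

lemma preprocess_unit_instances:
  assumes "I \<in> unit_instances"
  shows "preprocess I \<in> unit_instances" "self_settling (preprocess I)"
proof -
  have I: "valid_instance I" and uw: "unit_weights I" using assms by (simp_all add: unit_instances_def)
  have con: "\<exists>p. is_path (kept_edges I) u v p" if uv: "u \<in> verts I" "v \<in> verts I" for u v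
  proof -
    obtain q where "is_path (edges I) u v q" using I uv unfolding valid_instance_def by blast
    then show ?thesis
      using spanner_detour_path[OF I is_spanner_edges[OF I]] edges_preprocess[of I] by (simp add: Int_absorb1) blast
  qed
  have "\<forall>(u, v, w, l)\<in>set (edge_list (preprocess I)).
      u \<in> verts I \<and> v \<in> verts I \<and> u \<noteq> v \<and> l \<ge> 1"
    using I set_preprocess[of I] unfolding valid_instance_def by fast
  then have "valid_instance (preprocess I)"
    using I con distinct_preprocess[OF I] unfolding valid_instance_def by simp
  moreover have "unit_weights (preprocess I)"
    using uw len_preprocess(2)[OF I] edges_preprocess[of I] unfolding unit_weights_def by auto
  ultimately show "preprocess I \<in> unit_instances" by (simp add: unit_instances_def)
  show "self_settling (preprocess I)"
    unfolding self_settling_def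
  proof (clarify)
    fix u v w l assume e: "(u, v, w, l) \<in> set (edge_list (preprocess I))"
    then have s: "settling I u v [u, v]" by (simp add: preprocess_def)
    have uv: "{u, v} \<in> kept_edges I" by (rule edge_list_edge[OF e])
    have "u \<noteq> v" using valid_entry(3)[OF I] e set_preprocess by blast
    then have "is_path (kept_edges I) u v [u, v]" using uv by (simp add: is_path_edge)
    then show "settling (preprocess I) u v [u, v]"
      using s path_len_preprocess[OF I, of "[u, v]"] uv path_dist_preprocess[OF I order_refl]
        path_dist_preprocess_edges[OF I] unfolding settling_def by simp
  qed
qed

section \<open>From light spanners to removable sets\<close>

lemma unit_weight_sum:
  "unit_weights I \<Longrightarrow> F \<subseteq> edges I \<Longrightarrow> (\<Sum>e\<in>F. weight I e) = card F"
  unfolding unit_weights_def by (simp add: subset_iff)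

text \<open>Dropping from a spanner the edges that preprocessing deletes changes none of its
  distances and does not increase its number of edges.\<close>

lemma has_spanner_preprocess:
  assumes "I \<in> unit_instances"
  shows "has_spanner I \<longleftrightarrow> (\<exists>F. is_spanner (preprocess I) F \<and> card F \<le> weight_bound I)"
proof
  have I: "valid_instance I" and uw: "unit_weights I" using assms by (simp_all add: unit_instances_def)
  {
    assume "has_spanner I"
    then obtain F where F: "is_spanner I F" "card F \<le> weight_bound I"
      using unit_weight_sum[OF uw] unfolding has_spanner_def is_spanner_iff_all[OF I] by metis
    have FE: "F \<subseteq> edges I" using F(1) unfolding is_spanner_def by blast
    have "is_spanner I (F \<inter> kept_edges I)"
      using F(1) path_dist_Int_preprocess[OF I F(1)] FE unfolding is_spanner_def by auto
    then have "is_spanner (preprocess I) (F \<inter> kept_edges I)" unfolding is_spanner_preprocess[OF I] by blast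
    moreover have "card (F \<inter> kept_edges I) \<le> card F"
      using finite_subset[OF FE] by (intro card_mono) auto
    ultimately show "\<exists>F. is_spanner (preprocess I) F \<and> card F \<le> weight_bound I"
      using F(2) le_trans by blast
  next
    assume "\<exists>F. is_spanner (preprocess I) F \<and> card F \<le> weight_bound I"
    then obtain F where F: "is_spanner I F" "F \<subseteq> kept_edges I" "card F \<le> weight_bound I"
      unfolding is_spanner_preprocess[OF I] by blast
    then have "(\<Sum>e\<in>F. weight I e) \<le> weight_bound I"
      using unit_weight_sum[OF uw, of F] edges_preprocess[of I] by auto
    then show "has_spanner I" unfolding has_spanner_def using F(1) by blast
  }
qed

lemma small_spanner_iff_removable:
  assumes "I \<in> unit_instances" and ss: "self_settling I"
  shows "(\<exists>F. is_spanner I F \<and> card F \<le> W) \<longleftrightarrow> card (edges I) \<le> W \<or>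
    (\<exists>\<rho>\<in>{1..feedback_number I}. removable I \<rho> \<and> card (edges I) \<le> W + \<rho>)"
proof
  have I: "valid_instance I" and uw: "unit_weights I" using assms by (simp_all add: unit_instances_def)
  {
    assume "\<exists>F. is_spanner I F \<and> card F \<le> W"
    then obtain F where F: "is_spanner I F" "card F \<le> W" by blast
    have FE: "F \<subseteq> edges I" using F(1) unfolding is_spanner_def by blast
    have fF: "finite F" using finite_subset[OF FE finite_edges] .
    define R where "R = edges I - F"
    have cR: "card R + card F = card (edges I)"
      unfolding R_def using card_Diff_subset[OF fF FE] card_mono[OF finite_edges FE] by simp
    show "card (edges I) \<le> W \<or>
      (\<exists>\<rho>\<in>{1..feedback_number I}. removable I \<rho> \<and> card (edges I) \<le> W + \<rho>)"
    proof (cases "card R = 0")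
      case True
      then show ?thesis using cR F(2) by simp
    next
      case False
      have "connected_on (verts I) F"
        unfolding connected_on_def
      proof (intro ballI)
        fix u v assume uv: "u \<in> verts I" "v \<in> verts I"
        obtain q where "is_path (edges I) u v q" using I uv unfolding valid_instance_def by blast
        then show "\<exists>p. is_path F u v p"
          using F(1) uv unfolding is_spanner_iff_all[OF I] connects_def by blast
      qed
      then have "card (verts I) \<le> Suc (card F)"
        using connected_on_card[OF valid_instanceD(3)[OF I] fF] by blast
      then have "card R \<le> feedback_number I" using feedback_number_eq[OF I] cR by simp
      \<comment> \<open>Supersets of a spanner are spanners, so each edge of \<open>R\<close> can
        also be removed on its own.\<close>
      moreover have "R \<subseteq> nontrivial_edges I"
      proof
        fix e assume e: "e \<in> R"
        then have "is_spanner I (edges I - {e})"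
          using is_spanner_mono[OF I F(1), of "edges I - {e}"] FE unfolding R_def by blast
        then show "e \<in> nontrivial_edges I" using nontrivial_iff[OF I ss uw] e unfolding R_def by blast
      qed
      moreover have "edges I - R = F" using FE unfolding R_def by blast
      ultimately have "removable I (card R)" "card R \<in> {1..feedback_number I}"
        unfolding removable_def using F(1) False by auto
      then show ?thesis using cR F(2) by (intro disjI2 bexI[of _ "card R"]) simp_all
    qed
  next
    assume *: "card (edges I) \<le> W \<or>
      (\<exists>\<rho>\<in>{1..feedback_number I}. removable I \<rho> \<and> card (edges I) \<le> W + \<rho>)"
    show "\<exists>F. is_spanner I F \<and> card F \<le> W"
    proof (cases "card (edges I) \<le> W")
      case True
      then show ?thesis using is_spanner_edges[OF I] by blast
    next
      case False
      then obtain \<rho> R where R: "card (edges I) \<le> W + \<rho>" "R \<subseteq> nontrivial_edges I" "\<rho> \<le> card R"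
        "is_spanner I (edges I - R)"
        using * unfolding removable_def by blast
      have RE: "R \<subseteq> edges I" using R(2) unfolding nontrivial_edges_def by blast
      have "card (edges I - R) = card (edges I) - card R"
        using card_Diff_subset[OF finite_subset[OF RE finite_edges] RE] .
      then show ?thesis using R by (intro exI[of _ "edges I - R"]) simp
    qed
  }
qed

section \<open>Correctness of the distance computation\<close>

definition list_edges :: "edge list \<Rightarrow> nat set set" where
  "list_edges F = (\<lambda>(u, v, w, l). {u, v}) ` set F"

text \<open>An inequality, because an entry may stem from a walk that revisits vertices; the simple
  path inside it can be shorter.\<close>

definition table_sound :: "spanner_instance \<Rightarrow> edge list \<Rightarrow> nat \<Rightarrow> (nat \<times> nat) list \<Rightarrow> bool" where
  "table_sound I F u D \<longleftrightarrow>
    (\<forall>(x, d)\<in>set D. \<exists>p. is_path (list_edges F) u x p \<and> plen (len I) p \<le> d)"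

text \<open>\<open>length p\<close> counts vertices, so these are the paths with at most
  \<open>k\<close> edges.\<close>

definition table_complete :: "spanner_instance \<Rightarrow> edge list \<Rightarrow> nat \<Rightarrow> nat \<Rightarrow> (nat \<times> nat) list \<Rightarrow> bool" where
  "table_complete I F u k D \<longleftrightarrow>
    (\<forall>x p. is_path (list_edges F) u x p \<and> length p \<le> Suc k \<longrightarrow>
      (\<exists>d. (x, d) \<in> set D \<and> d \<le> plen (len I) p))"

lemma relax1_superset: "set D \<subseteq> set (relax1 x y l D)"
  by (auto simp: relax1_def split: option.split)

lemma relax1_improves:
  assumes "(x, d) \<in> set D"
  shows "\<exists>d'. (y, d') \<in> set (relax1 x y l D) \<and> d' \<le> d + l"
proof -
  obtain m where m: "minl x D = Some m" using minl_None[of x D] assms by (cases "minl x D") auto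
  then have "m \<le> d" using minl_Some[OF m] assms by blast
  then show ?thesis using m by (auto simp: relax1_def)
qed

lemma table_sound_relax1:
  assumes "table_sound I F u D" "{x, y} \<in> list_edges F" "len I {x, y} = l"
  shows "table_sound I F u (relax1 x y l D)"
proof (cases "minl x D")
  case None
  then show ?thesis using assms by (simp add: relax1_def)
next
  case (Some m)
  then have "(x, m) \<in> set D" using minl_Some by blast
  then obtain p where p: "is_path (list_edges F) u x p" "plen (len I) p \<le> m"
    using assms(1) unfolding table_sound_def by blast
  obtain q where "is_path (list_edges F) u y q" "plen (len I) q \<le> plen (len I) p + l"
    using is_path_extend[OF p(1) assms(2), of "len I"] assms(3) by blast
  then have "is_path (list_edges F) u y q \<and> plen (len I) q \<le> m + l" using p(2) by simp
  then show ?thesis using Some assms(1) unfolding table_sound_def by (auto simp: relax1_def)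
qed

context
  fixes I :: spanner_instance and F :: "edge list"
  assumes I: "valid_instance I" and F: "set F \<subseteq> set (edge_list I)"
begin

lemma list_edge:
  assumes "(x, y, w, l) \<in> set F"
  shows "{x, y} \<in> list_edges F" "len I {x, y} = l"
proof -
  show "{x, y} \<in> list_edges F" using assms unfolding list_edges_def by force
  show "len I {x, y} = l" using len_entry[OF I] assms F by blast
qed

lemma table_sound_relax: "e \<in> set F \<Longrightarrow> table_sound I F u D \<Longrightarrow> table_sound I F u (relax D e)"
proof (cases e)
  case (fields x y w l)
  assume "e \<in> set F" "table_sound I F u D"
  then have xy: "(x, y, w, l) \<in> set F" using fields by simp
  have yx: "{y, x} = {x, y}" by blast
  have "table_sound I F u (relax1 x y l D)"
    using table_sound_relax1[OF \<open>table_sound I F u D\<close> list_edge[OF xy]] .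
  then have "table_sound I F u (relax1 y x l (relax1 x y l D))"
    by (rule table_sound_relax1) (simp_all add: yx list_edge[OF xy])
  then show ?thesis using fields by simp
qed

lemma relax_superset: "set D \<subseteq> set (relax D e)"
  by (cases e) (simp add: subset_trans[OF relax1_superset relax1_superset])

lemma foldl_relax_superset: "set D \<subseteq> set (foldl relax D G)"
proof (induction G arbitrary: D)
  case (Cons e G)
  show ?case using subset_trans[OF relax_superset Cons.IH] by simp
qed simp

lemma table_sound_foldl_relax:
  "set G \<subseteq> set F \<Longrightarrow> table_sound I F u D \<Longrightarrow> table_sound I F u (foldl relax D G)"
  by (induction G arbitrary: D) (simp_all add: table_sound_relax)

lemma relax_improves:
  assumes "(x, d) \<in> set D" "{x, y} = {a, b}" "x \<noteq> y"
  shows "\<exists>d'. (y, d') \<in> set (relax D (a, b, w, l)) \<and> d' \<le> d + l"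
proof (cases "x = a")
  case True
  then have "y = b" using assms by (auto simp: doubleton_eq_iff)
  then show ?thesis
    using relax1_improves[OF assms(1), of y l] relax1_superset[of "relax1 a b l D" b a l] True
    by (metis relax.simps subsetD)
next
  case False
  then have "x = b" "y = a" using assms by (auto simp: doubleton_eq_iff)
  then show ?thesis
    using relax1_improves[OF subsetD[OF relax1_superset assms(1)], of y l a b l] by simp
qed

lemma table_complete_round:
  assumes "table_complete I F u k D"
  shows "table_complete I F u (Suc k) (foldl relax D F)"
  unfolding table_complete_def
proof (intro allI impI, elim conjE)
  fix x p assume p: "is_path (list_edges F) u x p" "length p \<le> Suc (Suc k)"
  from p(1) show "\<exists>d. (x, d) \<in> set (foldl relax D F) \<and> d \<le> plen (len I) p"
  proof (cases rule: is_path_snoc_cases)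
    case 1
    then have "length p \<le> Suc k" by simp
    then obtain d where "(x, d) \<in> set D" "d \<le> plen (len I) p"
      using assms p(1) unfolding table_complete_def by blast
    then show ?thesis using foldl_relax_superset[of D F] by blast
  next
    case (2 q z)
    have "length q \<le> Suc k" using 2(1) p(2) by simp
    then obtain d where d: "(z, d) \<in> set D" "d \<le> plen (len I) q"
      using assms 2(2) unfolding table_complete_def by blast
    obtain e where e0: "e \<in> set F" "{z, x} = (case e of (a, b, w, l) \<Rightarrow> {a, b})"
      using 2(3) unfolding list_edges_def by (rule imageE)
    obtain a b w l where "e = (a, b, w, l)" by (cases e)
    then have e: "(a, b, w, l) \<in> set F" "{z, x} = {a, b}" using e0 by simp_all
    have l: "len I {z, x} = l" using list_edge(2)[OF e(1)] e(2) by simp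
    \<comment> \<open>The round reaches the last edge of the path after relaxing \<open>F1\<close>.
      The entry for the vertex before it is still present by then, and the new entry survives
      \<open>F2\<close>, since the table only grows.\<close>
    obtain F1 F2 where FF: "F = F1 @ (a, b, w, l) # F2" using split_list[OF e(1)] by blast
    define D1 where "D1 = foldl relax D F1"
    have "(z, d) \<in> set D1" using d(1) foldl_relax_superset[of D F1] unfolding D1_def by blast
    from relax_improves[OF this e(2) 2(4), of w l] obtain d' where
      d': "(x, d') \<in> set (relax D1 (a, b, w, l))" "d' \<le> d + l" by blast
    have "foldl relax D F = foldl relax (relax D1 (a, b, w, l)) F2" unfolding FF D1_def by simp
    then have "(x, d') \<in> set (foldl relax D F)"
      using subsetD[OF foldl_relax_superset d'(1), of F2] by (simp only:)
    moreover have "d' \<le> plen (len I) p" using d'(2) d(2) 2(5)[of "len I"] l by simp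
    ultimately show ?thesis by blast
  qed
qed

lemma rounds:
  "table_sound I F u D \<Longrightarrow> table_complete I F u k D \<Longrightarrow>
    table_sound I F u (foldl (\<lambda>D (_ :: edge). foldl relax D F) D G) \<and>
    table_complete I F u (k + length G) (foldl (\<lambda>D (_ :: edge). foldl relax D F) D G)"
proof (induction G arbitrary: D k)
  case (Cons e G)
  show ?case
    using Cons.IH[OF table_sound_foldl_relax[OF order_refl Cons.prems(1)] table_complete_round[OF Cons.prems(2)]]
    by simp
qed simp

lemma bellman_ford:
  "table_sound I F u (bellman_ford F u)" "table_complete I F u (length F) (bellman_ford F u)"
proof -
  have "table_sound I F u [(u, 0)]"
    unfolding table_sound_def by (auto intro!: exI[of _ "[u]"] is_path_refl)
  moreover have "table_complete I F u 0 [(u, 0)]"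
    unfolding table_complete_def
  proof (intro allI impI, elim conjE)
    fix x p assume p: "is_path (list_edges F) u x p" "length p \<le> Suc 0"
    then have "p = [u]" "x = u" unfolding is_path_def by (cases p; auto)+
    then show "\<exists>d. (x, d) \<in> set [(u, 0)] \<and> d \<le> plen (len I) p" by simp
  qed
  ultimately show "table_sound I F u (bellman_ford F u)"
    "table_complete I F u (length F) (bellman_ford F u)"
    using rounds[of u "[(u, 0)]" 0 F] unfolding bellman_ford_def by simp_all
qed

text \<open>The edges of a simple path are distinct, so the rounds of \<open>bellman_ford\<close>
  cover all paths.\<close>

lemma path_length_bound:
  assumes "is_path (list_edges F) u v p"
  shows "length p \<le> Suc (length F)"
proof -
  have sub: "e \<in> set (path_edges r) \<Longrightarrow> e \<subseteq> set r" for e r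
    by (induction r rule: path_edges.induct) auto
  have "distinct p \<Longrightarrow> distinct (path_edges p)" for p
  proof (induction p rule: path_edges.induct)
    case (1 u v p)
    then have "{u, v} \<notin> set (path_edges (v # p))" using sub[of "{u, v}" "v # p"] by auto
    then show ?case using 1 by simp
  qed simp_all
  then have "length (path_edges p) = card (set (path_edges p))"
    using assms by (simp add: is_path_def distinct_card)
  also have "\<dots> \<le> card (list_edges F)"
    using assms by (intro card_mono) (simp_all add: is_path_def list_edges_def)
  also have "\<dots> \<le> length F"
    unfolding list_edges_def by (rule le_trans[OF card_image_le card_length]) simp
  moreover have "length p \<le> Suc (length (path_edges p))" by (induction p rule: path_edges.induct) auto
  ultimately show ?thesis by simp
qed

lemma distl_None: "distl F u v = None \<longleftrightarrow> (\<nexists>p. is_path (list_edges F) u v p)"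
proof
  assume "distl F u v = None"
  then have no: "\<And>d. (v, d) \<notin> set (bellman_ford F u)" unfolding distl_def minl_None by blast
  show "\<nexists>p. is_path (list_edges F) u v p"
    using bellman_ford(2)[of u] path_length_bound no unfolding table_complete_def by blast
next
  assume "\<nexists>p. is_path (list_edges F) u v p"
  then show "distl F u v = None"
    using bellman_ford(1)[of u] unfolding distl_def minl_None table_sound_def by blast
qed

lemma distl_Some:
  assumes "distl F u v = Some d"
  shows "\<exists>p. is_path (list_edges F) u v p \<and> plen (len I) p = d"
    "is_path (list_edges F) u v p \<Longrightarrow> d \<le> plen (len I) p"
proof -
  have d: "(v, d) \<in> set (bellman_ford F u)" "\<And>d'. (v, d') \<in> set (bellman_ford F u) \<Longrightarrow> d \<le> d'"
    using minl_Some assms unfolding distl_def by blast+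
  show *: "d \<le> plen (len I) p" if p: "is_path (list_edges F) u v p" for p
  proof -
    obtain d' where "(v, d') \<in> set (bellman_ford F u)" "d' \<le> plen (len I) p"
      using bellman_ford(2)[of u] path_length_bound[OF p] p unfolding table_complete_def by blast
    then show ?thesis using d(2) le_trans by blast
  qed
  obtain p where "is_path (list_edges F) u v p" "plen (len I) p \<le> d"
    using bellman_ford(1)[of u] d(1) unfolding table_sound_def by blast
  then show "\<exists>p. is_path (list_edges F) u v p \<and> plen (len I) p = d" using *[of p] by (intro exI[of _ p]) simp
qed

end

section \<open>Polynomial bounds\<close>

definition poly_bounded :: "(nat \<Rightarrow> nat) \<Rightarrow> bool" where
  "poly_bounded T \<longleftrightarrow> (\<exists>q :: nat poly. \<forall>n. T n \<le> poly q n)"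

lemma poly_bounded_const: "poly_bounded (\<lambda>_. c)"
  unfolding poly_bounded_def by (rule exI[of _ "[:c:]"]) simp

lemma poly_bounded_id: "poly_bounded (\<lambda>n. n)"
  unfolding poly_bounded_def by (rule exI[of _ "[:0, 1:]"]) simp

lemma poly_bounded_add: "poly_bounded f \<Longrightarrow> poly_bounded g \<Longrightarrow> poly_bounded (\<lambda>n. f n + g n)"
  unfolding poly_bounded_def by (metis add_mono poly_add)

lemma poly_bounded_mult: "poly_bounded f \<Longrightarrow> poly_bounded g \<Longrightarrow> poly_bounded (\<lambda>n. f n * g n)"
  unfolding poly_bounded_def by (metis mult_le_mono poly_mult)

lemmas poly_bounded_intros =
  poly_bounded_const poly_bounded_id poly_bounded_add poly_bounded_mult

text \<open>Stated for a composed argument because the distance program applies this bound to a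
  quadratic function of \<open>s\<close>.\<close>

lemma poly_bounded_min: "poly_bounded f \<Longrightarrow> poly_bounded (\<lambda>n. T_min (f n))"
  unfolding T_min_def by (intro poly_bounded_intros)

lemma poly_bounded_relax1: "poly_bounded f \<Longrightarrow> poly_bounded (\<lambda>n. T_relax1 (f n))"
  unfolding T_relax1_def by (intro poly_bounded_intros poly_bounded_min)

lemma poly_bounded_dist: "poly_bounded T_dist"
  unfolding T_dist_def T_round_def
  by (intro poly_bounded_intros poly_bounded_min poly_bounded_relax1)

lemma poly_bounded_cmp: "poly_bounded f \<Longrightarrow> poly_bounded (\<lambda>n. T_cmp (f n))"
  unfolding T_cmp_def by (intro poly_bounded_intros)

lemma poly_bounded_spans: "poly_bounded T_spans"
  unfolding T_spans_def T_stretch_def T_notin_def dist_bits_def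
  by (intro poly_bounded_intros poly_bounded_cmp poly_bounded_dist)

lemma poly_bounded_removal: "poly_bounded T_removal"
  unfolding T_removal_def T_test_def T_nontrivial_def
  by (intro poly_bounded_intros poly_bounded_spans)

lemma poly_bounded_spanner: "poly_bounded T_spanner"
  unfolding T_spanner_def T_preprocess_def T_settles_def dist_bits_def
  by (intro poly_bounded_intros poly_bounded_cmp poly_bounded_dist)

section \<open>Encoded instances\<close>

definition num :: "spanner_instance \<Rightarrow> nat" where
  "num I = nat (fst (quotient_of (stretch I)))"

definition den :: "spanner_instance \<Rightarrow> nat" where
  "den I = nat (snd (quotient_of (stretch I)))"

lemma enc_instance_eq: "enc_instance I =
  enc_inst (enc_nat (num_verts I)) (edge_list I) (num I) (den I) (enc_nat (weight_bound I))"
  by (simp add: enc_instance_def enc_rat_def num_def den_def case_prod_unfold Let_def)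

lemma stretch_frac:
  assumes "valid_instance I"
  shows "den I > 0" "stretch_real I = real (num I) / real (den I)"
proof -
  obtain a b where ab: "quotient_of (stretch I) = (a, b)" by fastforce
  have b: "b > 0" using quotient_of_denom_pos[OF ab] .
  have r: "stretch I = of_int a / of_int b" using quotient_of_div[OF ab] .
  have "1 \<le> stretch I" using assms by (simp add: valid_instance_def)
  then have "a \<ge> 0" using b unfolding r by (simp add: field_simps)
  then have "real (num I) = of_int a" "real (den I) = of_int b"
    using b ab by (simp_all add: num_def den_def)
  then show "stretch_real I = real (num I) / real (den I)"
    unfolding stretch_real_def r by (simp add: of_rat_divide)
  show "den I > 0" using b ab by (simp add: den_def)
qed

lemma stretch_le_iff:
  assumes "valid_instance I"
  shows "real x \<le> stretch_real I * real y \<longleftrightarrow> x * den I \<le> num I * y"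
proof -
  have "real x \<le> stretch_real I * real y \<longleftrightarrow> real x * real (den I) \<le> real (num I) * real y"
    unfolding stretch_frac(2)[OF assms] using stretch_frac(1)[OF assms] by (simp add: field_simps)
  also have "\<dots> \<longleftrightarrow> x * den I \<le> num I * y"
    unfolding of_nat_mult[symmetric] of_nat_le_iff ..
  finally show ?thesis .
qed

lemma enc_list_size: "length xs \<le> size (enc_list f xs)"
  "x \<in> set xs \<Longrightarrow> size (f x) \<le> size (enc_list f xs)"
  by (induction xs) auto

lemma small_instance:
  assumes "size (enc_instance I) \<le> s"
  shows "small_inst s (edge_list I) (num I) (den I)" "bl (num_verts I) \<le> s" "bl (weight_bound I) \<le> s"
proof -
  have s: "size (enc_nat (num_verts I)) + size (enc_list enc_edge (edge_list I)) +
    size (enc_nat (num I)) + size (enc_nat (den I)) + size (enc_nat (weight_bound I)) \<le> s"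
    using assms unfolding enc_instance_eq by simp
  show "small_inst s (edge_list I) (num I) (den I)"
    using s enc_list_size(1)[of "edge_list I" enc_edge] enc_list_size(2)[of _ "edge_list I" enc_edge]
      size_enc_nat(1)[of "num I"] size_enc_nat(1)[of "den I"]
    unfolding small_inst_def small_edges_def by fastforce
  show "bl (num_verts I) \<le> s" "bl (weight_bound I) \<le> s"
    using s size_enc_nat(1)[of "num_verts I"] size_enc_nat(1)[of "weight_bound I"] by simp_all
qed

lemma list_edges_edge_list: "list_edges (edge_list I) = edges I"
  by (simp add: list_edges_def edges_def)

context
  fixes I :: spanner_instance
  assumes I: "valid_instance I"
begin

lemma distl_edge_list:
  assumes "(u, v, w, l) \<in> set (edge_list I)"
  obtains q where "is_path (edges I) u v q" "path_len I q = the0 (distl (edge_list I) u v)"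
    "\<And>q'. is_path (edges I) u v q' \<Longrightarrow> path_len I q \<le> path_len I q'"
proof -
  have "\<exists>p. is_path (list_edges (edge_list I)) u v p"
    using valid_entry(4)[OF I assms] list_edges_edge_list by auto
  then obtain d where d: "distl (edge_list I) u v = Some d"
    using distl_None[OF I order_refl] by (cases "distl (edge_list I) u v") auto
  note D = distl_Some[OF I order_refl d, unfolded list_edges_edge_list, folded path_len_eq]
  show ?thesis using D(1) D(2) that d by auto
qed

lemma settles_edge_iff:
  assumes "(u, v, w, l) \<in> set (edge_list I)"
  shows "settles_edge (edge_list I) (num I) (den I) (u, v, w, l) \<longleftrightarrow> settling I u v [u, v]"
proof -
  note ve = valid_entry[OF I assms]
  obtain q where q: "is_path (edges I) u v q" "path_len I q = the0 (distl (edge_list I) u v)"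
    "\<And>q'. is_path (edges I) u v q' \<Longrightarrow> path_len I q \<le> path_len I q'"
    using distl_edge_list[OF assms] by blast
  have l: "path_len I [u, v] = l" using len_entry[OF I assms] by (simp add: path_len_eq)
  show ?thesis
    unfolding settling_iff[OF I ve(1,2)] settles_edge.simps q(2)[symmetric] l stretch_le_iff[OF I]
    using q(1) ve(4) mult_le_mono2[OF q(3), of _ "num I"] le_trans by blast
qed

lemma filter_settles:
  "filter (settles_edge (edge_list I) (num I) (den I)) (edge_list I) = edge_list (preprocess I)"
  unfolding preprocess_def using settles_edge_iff by (auto intro!: filter_cong)

lemma stretch_ok_iff:
  assumes e: "(u, v, w, l) \<in> set (edge_list I)" and F: "set F \<subseteq> set (edge_list I)"
  shows "stretch_ok (edge_list I) (num I) (den I) F (u, v, w, l) \<longleftrightarrow> connects I (list_edges F) u v"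
proof -
  obtain q where q: "is_path (edges I) u v q" "path_len I q = the0 (distl (edge_list I) u v)"
    "\<And>q'. is_path (edges I) u v q' \<Longrightarrow> path_len I q \<le> path_len I q'"
    using distl_edge_list[OF e] by blast
  show ?thesis
  proof (cases "distl F u v")
    case None
    then show ?thesis using distl_None[OF I F, of u v] q(1) unfolding connects_def by auto
  next
    case (Some d)
    note D = distl_Some[OF I F Some, folded path_len_eq]
    have "d * den I \<le> num I * path_len I q \<longleftrightarrow> connects I (list_edges F) u v"
      unfolding connects_def stretch_le_iff[OF I]
    proof (intro iffI allI impI)
      fix q' assume "d * den I \<le> num I * path_len I q" "is_path (edges I) u v q'"
      then have "d * den I \<le> num I * path_len I q'" using mult_le_mono2[OF q(3), of q' "num I"] le_trans by blast
      then show "\<exists>p. is_path (list_edges F) u v p \<and> path_len I p * den I \<le> num I * path_len I q'"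
        using D(1) by auto
    next
      assume "\<forall>q. is_path (edges I) u v q \<longrightarrow>
        (\<exists>p. is_path (list_edges F) u v p \<and> path_len I p * den I \<le> num I * path_len I q)"
      then obtain p where "is_path (list_edges F) u v p" "path_len I p * den I \<le> num I * path_len I q"
        using q(1) by blast
      then show "d * den I \<le> num I * path_len I q"
        using mult_le_mono1[OF D(2), of p "den I"] le_trans by blast
    qed
    then show ?thesis using Some q(2) by simp
  qed
qed

lemma inj_edge: "inj_on (\<lambda>(u, v, w, l). {u, v}) (set (edge_list I))"
  using valid_instanceD(6)[OF I] by (simp add: distinct_map)

lemma distinct_edge_list: "distinct (edge_list I)"
  using valid_instanceD(6)[OF I] by (simp add: distinct_map)

lemma card_list_edges:
  "distinct R \<Longrightarrow> set R \<subseteq> set (edge_list I) \<Longrightarrow> card (list_edges R) = length R"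
  unfolding list_edges_def using inj_on_subset[OF inj_edge] by (simp add: card_image distinct_card)

text \<open>The program removes list entries, the definition removes vertex pairs; these agree
  because different entries stand for different edges.\<close>

lemma list_edges_filter_notin:
  assumes "set R \<subseteq> set (edge_list I)"
  shows "list_edges (filter (\<lambda>e. e \<notin> set R) (edge_list I)) = edges I - list_edges R"
proof -
  have "set (filter (\<lambda>e. e \<notin> set R) (edge_list I)) = set (edge_list I) - set R" by auto
  then show ?thesis
    unfolding list_edges_def edges_def using inj_on_image_set_diff[OF inj_edge, of "set (edge_list I)" "set R"] assms
    by simp
qed

lemma spans_without_iff:
  assumes R: "set R \<subseteq> set (edge_list I)"
  shows "spans_without (edge_list I) (num I) (den I) R \<longleftrightarrow> is_spanner I (edges I - list_edges R)"
proof -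
  let ?F = "filter (\<lambda>e. e \<notin> set R) (edge_list I)"
  have "stretch_ok (edge_list I) (num I) (den I) ?F e \<longleftrightarrow>
    (case e of (u, v, w, l) \<Rightarrow> connects I (edges I - list_edges R) u v)"
    if "e \<in> set (edge_list I)" for e
    using stretch_ok_iff[of _ _ _ _ ?F] that list_edges_filter_notin[OF R] by (cases e) auto
  then show ?thesis
    unfolding spans_without_def is_spanner_iff[OF I] list_all_iff by blast
qed

end

section \<open>Correctness of the search\<close>

lemma some_subset_iff: "some_subset t R P \<longleftrightarrow> (\<exists>xs\<in>set (subseqs P). t (rev xs @ R))"
  by (induction P arbitrary: R) (simp_all add: Let_def bex_Un)

text \<open>The last prefix tried is the whole list, so the order of the search loses no
  solution.\<close>

lemma some_prefix_complete: "some_subset t [] (rev N @ P) \<Longrightarrow> some_prefix t P N"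
  by (induction N arbitrary: P) auto

lemma some_prefix_sound:
  "some_prefix t P N \<Longrightarrow> distinct (P @ N) \<Longrightarrow>
    \<exists>xs. distinct xs \<and> set xs \<subseteq> set P \<union> set N \<and> t xs"
proof (induction N arbitrary: P)
  have sub: "\<exists>xs. distinct xs \<and> set xs \<subseteq> set P \<and> t xs" if "some_subset t [] P" "distinct P" for P
  proof -
    obtain xs where xs: "xs \<in> set (subseqs P)" "t (rev xs)" using \<open>some_subset t [] P\<close> some_subset_iff by auto
    then have "distinct xs" "set xs \<subseteq> set P"
      using subseqs_distinctD[OF xs(1) that(2)] subseqs_powset[of P] by auto
    then show ?thesis using xs(2) by (intro exI[of _ "rev xs"]) simp
  qed
  {
    case Nil
    then show ?case using sub[of P] by simp
  next
    case (Cons x N)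
    show ?case
    proof (cases "some_subset t [] P")
      case True
      then show ?thesis using sub[of P] Cons.prems(2) by fastforce
    next
      case False
      then show ?thesis using Cons.IH[of "x # P"] Cons.prems by auto
    qed
  }
qed

context
  fixes I :: spanner_instance
  assumes I: "I \<in> unit_instances" and ss: "self_settling I"
begin

lemma valid: "valid_instance I" and unit: "unit_weights I"
  using I by (simp_all add: unit_instances_def)

abbreviation "nontriv \<equiv> nontrivial_list (edge_list I) (num I) (den I)"
abbreviation "rtest \<rho> \<equiv> removal_test (edge_list I) (num I) (den I) \<rho>"

lemma set_nontriv: "set nontriv \<subseteq> set (edge_list I)" "distinct nontriv"
  using distinct_edge_list[OF valid] by (auto simp: nontrivial_list_def)

lemma list_edges_nontriv: "list_edges nontriv = nontrivial_edges I"
proof -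
  have sp: "spans_without (edge_list I) (num I) (den I) [(u, v, w, l)] \<longleftrightarrow> {u, v} \<in> nontrivial_edges I"
    if "(u, v, w, l) \<in> set (edge_list I)" for u v w l
    using spans_without_iff[OF valid, of "[(u, v, w, l)]"] that
      nontrivial_iff[OF valid ss unit edge_list_edge[OF that]] by (simp add: list_edges_def)
  show ?thesis
  proof (intro set_eqI iffI)
    fix e assume "e \<in> list_edges nontriv"
    then show "e \<in> nontrivial_edges I"
      using sp by (auto simp: list_edges_def nontrivial_list_def)
  next
    fix e assume e: "e \<in> nontrivial_edges I"
    then have "e \<in> edges I" unfolding nontrivial_edges_def by blast
    then obtain u v w l where "(u, v, w, l) \<in> set (edge_list I)" "e = {u, v}"
      by (rule edges_edge_list)
    then show "e \<in> list_edges nontriv"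
      using sp e unfolding list_edges_def nontrivial_list_def by force
  qed
qed

lemma some_subset_removal:
  assumes L: "set L \<subseteq> set (edge_list I)" "distinct L"
    and R: "R \<subseteq> list_edges L" "\<rho> \<le> card R" "is_spanner I (edges I - R)"
  shows "some_subset (rtest \<rho>) [] L"
proof -
  define X where "X = {e \<in> set L. (case e of (u, v, w, l) \<Rightarrow> {u, v}) \<in> R}"
  have "X \<in> set ` set (subseqs L)" unfolding subseqs_powset X_def by blast
  then obtain xs where xs: "xs \<in> set (subseqs L)" "set xs = X" by blast
  have d: "distinct xs" using subseqs_distinctD[OF xs(1) L(2)] .
  have XL: "set (rev xs) \<subseteq> set (edge_list I)" using xs(2) L(1) X_def by auto
  have le: "list_edges (rev xs) = R"
    unfolding list_edges_def set_rev xs(2) X_def using R(1) unfolding list_edges_def by blast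
  have "rtest \<rho> (rev xs)"
    unfolding removal_test_def spans_without_iff[OF valid XL] le
    using R(2,3) card_list_edges[OF valid _ XL] d le by simp
  then show ?thesis unfolding some_subset_iff using xs(1) by auto
qed

lemma some_prefix_removal: "some_prefix (rtest \<rho>) [] nontriv \<longleftrightarrow> removable I \<rho>"
proof
  assume "some_prefix (rtest \<rho>) [] nontriv"
  then obtain xs where xs: "distinct xs" "set xs \<subseteq> set nontriv" "rtest \<rho> xs"
    using some_prefix_sound[of "rtest \<rho>" "[]" nontriv] set_nontriv(2) by auto
  have XE: "set xs \<subseteq> set (edge_list I)" using xs(2) set_nontriv(1) by blast
  have "list_edges xs \<subseteq> nontrivial_edges I"
    unfolding list_edges_nontriv[symmetric] list_edges_def using xs(2) by blast
  then show "removable I \<rho>"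
    using xs(1,3) card_list_edges[OF valid xs(1) XE]
    unfolding removable_def removal_test_def spans_without_iff[OF valid XE] by (metis)
next
  assume "removable I \<rho>"
  then obtain R where "R \<subseteq> list_edges (rev nontriv)" "\<rho> \<le> card R" "is_spanner I (edges I - R)"
    unfolding removable_def list_edges_nontriv[symmetric] by (auto simp: list_edges_def)
  then have "some_subset (rtest \<rho>) [] (rev nontriv @ [])"
    using some_subset_removal[of "rev nontriv"] set_nontriv by simp
  then show "some_prefix (rtest \<rho>) [] nontriv" by (rule some_prefix_complete)
qed

lemma some_subset_prefix:
  fixes \<rho> :: nat
  defines "k \<equiv> \<rho> * (2 * tightness I + 1)"
  assumes "k \<le> length nontriv"
  shows "some_subset (rtest \<rho>) [] (rev (take k nontriv))"
proof -
  let ?L = "take k nontriv"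
  have LE: "set ?L \<subseteq> set (edge_list I)" using set_nontriv(1) set_take_subset[of k nontriv] by blast
  have dL: "distinct ?L" using set_nontriv(2) by simp
  have "list_edges ?L \<subseteq> nontrivial_edges I"
    unfolding list_edges_nontriv[symmetric] list_edges_def using set_take_subset[of k nontriv] by blast
  moreover have "\<rho> * (2 * tightness I + 1) \<le> card (list_edges ?L)"
    using card_list_edges[OF valid dL LE] assms by simp
  ultimately obtain R where R: "R \<subseteq> list_edges ?L" "card R = \<rho>" "is_spanner I (edges I - R)"
    using removable_subset[OF valid ss] by blast
  then show ?thesis using some_subset_removal[of "rev ?L" R \<rho>] LE dL by (simp add: list_edges_def)
qed

lemma p_removal_correct:
  assumes sm: "small_inst s (edge_list I) (num I) (den I)" and \<rho>: "bl \<rho> \<le> s"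
  shows "computes p_removal (enc_removal (I, \<rho>)) (enc_bool (removable I \<rho>))
    (2 ^ (\<rho> * (2 * tightness I + 1)) * T_removal s)"
  unfolding enc_removal_def prod.case enc_instance_eq some_prefix_removal[symmetric]
  \<comment> \<open>With \<open>k = \<rho> * (2 * tightness I + 1)\<close>, either the list of
    nontrivial edges has at most \<open>k\<close> entries, or its prefix of length \<open>k\<close>
    contains a removable set.\<close>
  by (rule p_removal[OF sm \<rho>]) (use some_subset_prefix[of \<rho>] in linarith)

end

section \<open>Running times in terms of the parameters\<close>

lemma removal_fpt_p_removal: "removal_fpt p_removal"
proof -
  obtain q :: "nat poly" where q: "\<And>n. T_removal n \<le> poly q n"
    using poly_bounded_removal unfolding poly_bounded_def by blast
  show ?thesis
    unfolding removal_fpt_def fpt_algorithm_def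
  proof (rule exI[of _ "\<lambda>(a, b). 2 ^ (a * (2 * b + 1))"], rule exI[of _ q], rule exI[of _ 1],
      rule conjI, rule computable2_exp, rule ballI)
    fix i :: "spanner_instance \<times> nat" assume i: "i \<in> {(I, \<rho>). I \<in> unit_instances \<and> self_settling I}"
    obtain I \<rho> where i_eq: "i = (I, \<rho>)" by (cases i)
    have I: "I \<in> unit_instances" "self_settling I" using i i_eq by simp_all
    let ?s = "size (enc_removal (I, \<rho>))"
    have s: "size (enc_instance I) \<le> ?s" "bl \<rho> \<le> ?s"
      using size_enc_nat(1)[of \<rho>] by (simp_all add: enc_removal_def)
    have "computes p_removal (enc_removal (I, \<rho>)) (enc_bool (removable I \<rho>))
      (2 ^ (\<rho> * (2 * tightness I + 1)) * T_removal ?s)"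
      by (rule p_removal_correct[OF I small_instance(1)[OF s(1)] s(2)])
    then have "computes p_removal (enc_removal (I, \<rho>)) (enc_bool (removable I \<rho>))
      (1 * (2 ^ (\<rho> * (2 * tightness I + 1)) * poly q ?s))"
      by (rule computes_mono) (simp add: q)
    then show "\<exists>t cs. run p_removal (enc_removal i) (enc_bool (case i of (I, \<rho>) \<Rightarrow> removable I \<rho>)) t cs \<and>
      t \<le> 1 * ((case case i of (I, \<rho>) \<Rightarrow> (\<rho>, tightness I) of (a, b) \<Rightarrow> 2 ^ (a * (2 * b + 1))) *
        poly q (size (enc_removal i)))"
      unfolding computes_def run_iff i_eq prod.case by blast
  qed
qed

lemma p_spanner_correct:
  assumes I: "I \<in> unit_instances"
  defines "J \<equiv> preprocess I"
  shows "computes p_spanner (enc_instance I) (enc_bool (has_spanner I))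
      (2 ^ (feedback_number J * (2 * tightness J + 1)) *
        ((size (enc_instance I) + 2) * T_removal (size (enc_instance I)) + T_spanner (size (enc_instance I))))"
    "{y. (p_removal, y) \<in> set (calls p_spanner (enc_instance I))} =
      (\<lambda>\<rho>. enc_removal (J, \<rho>)) ` {1..feedback_number J}"
proof -
  define s where "s = size (enc_instance I)"
  define K where "K = feedback_number J * (2 * tightness J + 1)"
  have vI: "valid_instance I" using I by (simp add: unit_instances_def)
  note J = preprocess_unit_instances[OF I, folded J_def]
  have vJ: "valid_instance J" using J(1) by (simp add: unit_instances_def)
  have s: "small_inst s (edge_list I) (num I) (den I)" "bl (num_verts I) \<le> s" "bl (weight_bound I) \<le> s"
    using small_instance[of I s] by (simp_all add: s_def)
  have nd: "num J = num I" "den J = den I" "num_verts J = num_verts I" "weight_bound J = weight_bound I"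
    by (simp_all add: num_def den_def J_def)
  note fil = filter_settles[OF vI, folded J_def]
  have sJ: "small_inst s (edge_list J) (num J) (den J)"
    using s(1) unfolding small_inst_def small_edges_def nd fil[symmetric]
    by (auto intro: le_trans[OF length_filter_le])
  have cE: "card (edges J) = length (edge_list J)" by (rule valid_instanceD(7)[OF vJ])
  have f: "feedback_number J + num_verts I = Suc (length (edge_list J))"
    using feedback_number_eq[OF vJ] valid_instanceD(5)[OF vJ] cE nd(3) by simp
  have n: "num_verts I \<ge> 1" using vI by (simp add: valid_instance_def)
  \<comment> \<open>There is at least one vertex, so \<phi> is at most the number of edges; this
    bounds the bit length of every \<rho> in the loop.\<close>
  have fle: "feedback_number J \<le> s"
    using f n sJ by (simp add: small_inst_def small_edges_def)
  have \<phi>: "Suc (length (edge_list J)) - num_verts I = feedback_number J" using f by simp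
  have encJ: "enc_removal (J, \<rho>) = Node (enc_nat \<rho>)
    (enc_inst (enc_nat (num_verts I)) (edge_list J) (num I) (den I) (enc_nat (weight_bound I)))" for \<rho>
    by (simp add: enc_removal_def enc_instance_eq nd)
  have rem: "computes p_removal (enc_removal (J, \<rho>)) (enc_bool (removable J \<rho>)) (2 ^ K * T_removal s)"
    if "\<rho> \<le> feedback_number J" for \<rho>
  proof (rule computes_mono[OF p_removal_correct[OF J sJ]])
    show "bl \<rho> \<le> s" using bl_le_self[of \<rho>] that fle by simp
    \<comment> \<open>The exponent grows with \<rho>, so the bound for \<rho> = \<phi> covers every
      call, and the loop contributes only a polynomial factor.\<close>
    have "\<rho> * (2 * tightness J + 1) \<le> K" unfolding K_def using that by (rule mult_le_mono1)
    then show "2 ^ (\<rho> * (2 * tightness J + 1)) * T_removal s \<le> 2 ^ K * T_removal s" by simp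
  qed
  have nle: "num_verts I \<le> Suc (length (edge_list J))" using f by simp
  have sp: "computes p_spanner (enc_instance I) (enc_bool (length (edge_list J) \<le> weight_bound I \<or>
      (\<exists>r\<in>{1..feedback_number J}. removable J r \<and> length (edge_list J) \<le> weight_bound I + r)))
      ((s + 2) * (2 ^ K * T_removal s) + T_spanner s)"
    "{y. (p_removal, y) \<in> set (calls p_spanner (enc_instance I))} =
      (\<lambda>r. enc_removal (J, r)) ` {1..feedback_number J}"
    using p_spanner[where ?E0.0 = "edge_list I" and a = "num I" and b = "den I" and n = "num_verts I" and
        W = "weight_bound I" and s = s and Rm = "removable J" and T = "2 ^ K * T_removal s",
        unfolded fil, OF s(1,2) nle s(3), unfolded \<phi> encJ[symmetric] enc_instance_eq[symmetric], OF rem]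
    by blast+
  have "has_spanner I \<longleftrightarrow> length (edge_list J) \<le> weight_bound I \<or>
      (\<exists>r\<in>{1..feedback_number J}. removable J r \<and> length (edge_list J) \<le> weight_bound I + r)"
    unfolding has_spanner_preprocess[OF I] J_def[symmetric] small_spanner_iff_removable[OF J] cE ..
  moreover have "(s + 2) * (2 ^ K * T_removal s) + T_spanner s \<le>
    2 ^ K * ((s + 2) * T_removal s + T_spanner s)"
  proof -
    have "T_spanner s \<le> 2 ^ K * T_spanner s" by simp
    then show ?thesis by (simp add: algebra_simps)
  qed
  ultimately show "computes p_spanner (enc_instance I) (enc_bool (has_spanner I))
      (2 ^ (feedback_number J * (2 * tightness J + 1)) *
        ((size (enc_instance I) + 2) * T_removal (size (enc_instance I)) + T_spanner (size (enc_instance I))))"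
    using sp(1) computes_mono unfolding K_def[symmetric] s_def[symmetric] by simp
  show "{y. (p_removal, y) \<in> set (calls p_spanner (enc_instance I))} =
      (\<lambda>\<rho>. enc_removal (J, \<rho>)) ` {1..feedback_number J}" by (rule sp(2))
qed

lemma spanner_fpt_p_spanner: "spanner_fpt p_spanner"
proof -
  have "poly_bounded (\<lambda>n. (n + 2) * T_removal n + T_spanner n)"
    by (intro poly_bounded_intros poly_bounded_removal poly_bounded_spanner)
  then obtain q :: "nat poly" where q: "\<And>n. (n + 2) * T_removal n + T_spanner n \<le> poly q n"
    unfolding poly_bounded_def by blast
  show ?thesis
    unfolding spanner_fpt_def fpt_algorithm_def
  proof (rule exI[of _ "\<lambda>(a, b). 2 ^ (a * (2 * b + 1))"], rule exI[of _ q], rule exI[of _ 1],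
      rule conjI, rule computable2_exp, rule ballI)
    fix I assume I: "I \<in> unit_instances"
    let ?J = "preprocess I"
    have "computes p_spanner (enc_instance I) (enc_bool (has_spanner I))
      (1 * ((case (feedback_number ?J, tightness ?J) of (a, b) \<Rightarrow> 2 ^ (a * (2 * b + 1))) *
        poly q (size (enc_instance I))))"
      by (rule computes_mono[OF p_spanner_correct(1)[OF I]]) (simp only: prod.case mult_1, rule mult_le_mono2, rule q)
    then show "\<exists>t cs. run p_spanner (enc_instance I) (enc_bool (has_spanner I)) t cs \<and>
      t \<le> 1 * ((case (feedback_number ?J, tightness ?J) of (a, b) \<Rightarrow> 2 ^ (a * (2 * b + 1))) *
        poly q (size (enc_instance I)))"
      unfolding computes_def run_iff by blast
  qed
qed

lemma runs_for_all_removals_p_spanner: "runs_for_all_removals p_spanner p_removal"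
  unfolding runs_for_all_removals_def run_iff using p_spanner_correct(2) by blast

theorem corollary7:
  shows "(\<forall>I\<in>unit_instances.
            int (feedback_number I) = int (card (edges I)) - int (card (verts I)) + 1) \<and>
         (\<exists>A B. removal_fpt A \<and> spanner_fpt B \<and> runs_for_all_removals B A)"
proof -
  have "int (feedback_number I) = int (card (edges I)) - int (card (verts I)) + 1"
    if "I \<in> unit_instances" for I
    using feedback_number_eq[of I] that by (simp add: unit_instances_def)
  then show ?thesis
    using removal_fpt_p_removal spanner_fpt_p_spanner runs_for_all_removals_p_spanner by blast
qed

end
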